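(* Let $d\ge 1$ and let $T$ be a quasihyperbolic automorphism of $\mathbb{T}^d=\mathbb{R}^d/\mathbb{Z}^d$. Let $\{S_k\}_k$ be a countable collection of quasihyperbolic endomorphisms of $\mathbb{T}^d$. Let $\mathfrak{t}_-$ (resp. $\mathfrak{s}^k_-$) be the subspace of $\mathbb{R}^d$ contracted by $T$ (resp. by $S_k$), and let $\mathfrak{t}_0'$ (resp. $(\mathfrak{s}^k_0)'$) be the sum of the eigenspaces of $T$ (resp. of $S_k$) for eigenvalues of modulus $1$. Assume that for every $k$, $\mathbb{R}^d$ is spanned by $\mathfrak{s}^k_-\oplus(\mathfrak{s}^k_0)'$ and $\mathfrak{t}_-\oplus\mathfrak{t}_0'$. Then $$\dim\Big(\bigcap_k Eq(S_k)\cap ND(T)\Big)=d,$$ where $\dim$ denotes Hausdorff dimension.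
   Context: An endomorphism $S$ of $\mathbb{T}^d$ is identified with a nonsingular $d\times d$ integer matrix, acting on both $\mathbb{R}^d$ and $\mathbb{T}^d$; it is an automorphism if its determinant is $\pm1$. It is quasihyperbolic if no eigenvalue of the matrix is a root of unity (equivalently, $S$ is ergodic for Haar measure). The subspace $\mathfrak{t}_-\subset\mathbb{R}^d$ contracted by $T$ is the real subspace corresponding to the generalized eigenspaces of $T$ for eigenvalues of modulus less than $1$, i.e. $\mathbb{R}^d\cap\bigoplus_{|\lambda|<1}\ker_{\mathbb{C}^d}(T-\lambda)^d$. The space $\mathfrak{t}_0'$ is the real subspace corresponding to the genuine (not generalized) eigenspaces for eigenvalues of modulus $1$, i.e. $\mathfrak{t}_0'=\mathbb{R}^d\cap\bigoplus_{|\lambda|=1}\ker_{\mathbb{C}^d}(T-\lambda)$. The spaces $\mathfrak{s}^k_-,(\mathfrak{s}^k_0)'$ are defined in the same way for $S_k$. "Spanned by" means that the (not necessarily direct) sum of the two subspaces is $\mathbb{R}^d$. Let $m$ be the Haar probability measure on $\mathbb{T}^d$. Then $$Eq(S)=\Big\{x\in\mathbb{T}^d:\ \tfrac1N\sum_{n=0}^{N-1}f(S^nx)\to\int f\,dm\ (N\to\infty)\ \text{for all } f\in C(\mathbb{T}^d)\Big\},$$ $D(T)=\{x\in\mathbb{T}^d:\ \overline{\{T^nx: n\ge 0\}}=\mathbb{T}^d\}$ and $ND(T)=\mathbb{T}^d\setminus D(T)$. *)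

theory Defs
  imports "HOL-Analysis.Analysis"
begin

definition int_lattice :: "(real ^ 'n) set" where
  "int_lattice = {v. \<forall>i. v $ i \<in> \<int>}"

lemma int_lattice_0 [simp]: "0 \<in> int_lattice"
  by (simp add: int_lattice_def)

lemma int_lattice_minus: "v \<in> int_lattice \<Longrightarrow> - v \<in> int_lattice"
  by (simp add: int_lattice_def)

lemma int_lattice_add: "v \<in> int_lattice \<Longrightarrow> w \<in> int_lattice \<Longrightarrow> v + w \<in> int_lattice"
  by (simp add: int_lattice_def)

lemma int_lattice_diff: "v \<in> int_lattice \<Longrightarrow> w \<in> int_lattice \<Longrightarrow> v - w \<in> int_lattice"
  by (simp add: int_lattice_def)

lemma closed_int_lattice: "closed (int_lattice :: (real ^ 'n) set)"
proof -
  have "int_lattice = (\<Inter>i. (\<lambda>v :: real ^ 'n. v $ i) -` \<int>)"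
    by (auto simp: int_lattice_def)
  moreover have "closed ((\<lambda>v :: real ^ 'n. v $ i) -` \<int>)" for i
    by (intro continuous_closed_vimage closed_Ints) (auto intro: continuous_intros)
  ultimately show ?thesis by (metis (no_types, lifting) closed_INT)
qed

definition torus_rel :: "real ^ 'n \<Rightarrow> real ^ 'n \<Rightarrow> bool" where
  "torus_rel v w \<longleftrightarrow> v - w \<in> int_lattice"

quotient_type 'n torus = "real ^ 'n" / torus_rel
  morphisms rep_torus to_torus
proof (rule equivpI)
  show "reflp torus_rel" by (auto intro!: reflpI simp: torus_rel_def)
  show "symp torus_rel"
    unfolding torus_rel_def by (rule sympI, drule int_lattice_minus) simp
  show "transp torus_rel"
    unfolding torus_rel_def by (rule transpI, drule (1) int_lattice_add) simp
qed

lemma to_torus_eq_iff: "to_torus v = to_torus w \<longleftrightarrow> v - w \<in> int_lattice"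
  by (simp add: torus.abs_eq_iff torus_rel_def)

lemma to_torus_cases: obtains v where "x = to_torus v"
  by (induct x rule: torus.abs_induct) auto

instantiation torus :: (finite) ab_group_add
begin

lift_definition zero_torus :: "'a torus" is 0 .

lift_definition plus_torus :: "'a torus \<Rightarrow> 'a torus \<Rightarrow> 'a torus" is "(+)"
  unfolding torus_rel_def by (drule (1) int_lattice_add) (simp add: algebra_simps)

lift_definition uminus_torus :: "'a torus \<Rightarrow> 'a torus" is uminus
  unfolding torus_rel_def by (drule int_lattice_minus) simp

lift_definition minus_torus :: "'a torus \<Rightarrow> 'a torus \<Rightarrow> 'a torus" is "(-)"
  unfolding torus_rel_def by (drule (1) int_lattice_diff) (simp add: algebra_simps)

instance
  by standard (transfer, simp add: torus_rel_def algebra_simps)+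

end

lemma infdist_int_lattice_le:
  "z \<in> int_lattice \<Longrightarrow> infdist v int_lattice \<le> norm (v - z)"
  by (metis dist_norm infdist_le)

lemma infdist_int_lattice_attained:
  fixes v :: "real ^ 'n"
  obtains z where "z \<in> int_lattice" "infdist v int_lattice = norm (v - z)"
  using infdist_attains_inf[OF closed_int_lattice, of v]
  by (metis dist_norm empty_iff int_lattice_0)

text \<open>The quotient metric:
  \<open>dist (to_torus v) (to_torus w) = inf {norm (v - w - z) | z \<in> \<int>\<^sup>d}\<close>.
  It induces the quotient topology, see \<open>open_torus_iff\<close> below.\<close>

instantiation torus :: (finite) metric_space
begin

lift_definition dist_torus :: "'a torus \<Rightarrow> 'a torus \<Rightarrow> real"
  is "\<lambda>v w. infdist (v - w) int_lattice"
proof -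
  have le: "infdist v int_lattice \<le> infdist w int_lattice"
    if "v - w \<in> int_lattice" for v w :: "real ^ 'a"
  proof -
    obtain z where z: "z \<in> int_lattice" "infdist w int_lattice = norm (w - z)"
      using infdist_int_lattice_attained .
    show ?thesis
      using infdist_int_lattice_le[OF int_lattice_add[OF that z(1)], of v] z(2) by simp
  qed
  fix v v' w w' :: "real ^ 'a"
  assume "torus_rel v v'" "torus_rel w w'"
  then have *: "(v - w) - (v' - w') \<in> int_lattice"
    unfolding torus_rel_def
    using int_lattice_diff[of "v - v'" "w - w'"] by (simp add: algebra_simps)
  show "infdist (v - w) int_lattice = infdist (v' - w') int_lattice"
    using le[OF *] le[of "v' - w'" "v - w"] int_lattice_minus[OF *] by simp
qed

definition uniformity_torus :: "('a torus \<times> 'a torus) filter" where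
  "uniformity_torus = (INF e\<in>{0 <..}. principal {(x, y). dist x y < e})"

definition open_torus :: "'a torus set \<Rightarrow> bool" where
  "open_torus U \<longleftrightarrow> (\<forall>x\<in>U. \<forall>\<^sub>F (x', y) in uniformity. x' = x \<longrightarrow> y \<in> U)"

instance
proof
  fix x y z :: "'a torus"
  show "dist x y = 0 \<longleftrightarrow> x = y"
  proof transfer
    fix v w :: "real ^ 'a"
    show "infdist (v - w) int_lattice = 0 \<longleftrightarrow> torus_rel v w"
      using in_closed_iff_infdist_zero[OF closed_int_lattice, of "v - w"] int_lattice_0
      unfolding torus_rel_def by blast
  qed
  show "dist x y \<le> dist x z + dist y z"
  proof transfer
    fix u v w :: "real ^ 'a"
    obtain a where a: "a \<in> int_lattice" "infdist (u - w) int_lattice = norm (u - w - a)"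
      using infdist_int_lattice_attained .
    obtain b where b: "b \<in> int_lattice" "infdist (v - w) int_lattice = norm (v - w - b)"
      using infdist_int_lattice_attained .
    have "infdist (u - v) int_lattice \<le> norm (u - v - (a - b))"
      using a b by (intro infdist_int_lattice_le int_lattice_diff)
    also have "\<dots> = norm ((u - w - a) - (v - w - b))"
      by (simp add: algebra_simps)
    also have "\<dots> \<le> norm (u - w - a) + norm (v - w - b)"
      by (rule norm_triangle_ineq4)
    finally show "infdist (u - v) int_lattice
        \<le> infdist (u - w) int_lattice + infdist (v - w) int_lattice"
      using a b by simp
  qed
qed (simp_all add: uniformity_torus_def open_torus_def)

end

lemma dist_to_torus: "dist (to_torus v) (to_torus w) = infdist (v - w) int_lattice"
  by (rule dist_torus.abs_eq)

lemma dist_to_torus_le: "dist (to_torus v) (to_torus w) \<le> norm (v - w)"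
  using infdist_int_lattice_le[OF int_lattice_0, of "v - w"] by (simp add: dist_to_torus)

lemma plus_to_torus: "to_torus v + to_torus w = to_torus (v + w)"
  by (rule plus_torus.abs_eq)

lemma continuous_on_to_torus: "continuous_on A to_torus"
  unfolding continuous_on_iff by (metis dist_norm dist_to_torus_le le_less_trans)

lemma open_torus_iff: "open U \<longleftrightarrow> open (to_torus -` U)"
proof
  assume "open U"
  then show "open (to_torus -` U)"
    by (intro open_vimage continuous_on_to_torus)
next
  assume V: "open (to_torus -` U)"
  show "open U"
    unfolding open_dist
  proof
    fix x assume "x \<in> U"
    obtain v where v: "x = to_torus v" by (rule to_torus_cases)
    with \<open>x \<in> U\<close> have "v \<in> to_torus -` U" by simp
    with V obtain e where e: "e > 0" "\<And>w. dist w v < e \<Longrightarrow> to_torus w \<in> U"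
      unfolding open_dist by auto
    have "y \<in> U" if "dist y x < e" for y
    proof -
      obtain w where w: "y = to_torus w" by (rule to_torus_cases)
      obtain z where z: "z \<in> int_lattice" "infdist (w - v) int_lattice = norm (w - v - z)"
        using infdist_int_lattice_attained .
      have "dist (w - z) v < e"
        using that z(2) unfolding v w dist_to_torus by (simp add: dist_norm algebra_simps)
      then have "to_torus (w - z) \<in> U" by (rule e(2))
      moreover have "to_torus (w - z) = y"
        using int_lattice_minus[OF z(1)] unfolding w to_torus_eq_iff by simp
      ultimately show ?thesis by simp
    qed
    with e(1) show "\<exists>e>0. \<forall>y. dist y x < e \<longrightarrow> y \<in> U" by blast
  qed
qed

definition unit_cube :: "(real ^ 'n) set" where
  "unit_cube = {v. \<forall>i. 0 \<le> v $ i \<and> v $ i < 1}"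

definition haar :: "'n::finite torus measure" where
  "haar = distr (restrict_space lborel unit_cube) borel to_torus"

lemma unit_cube_measurable [measurable]: "unit_cube \<in> sets (borel :: (real ^ 'n) measure)"
  unfolding unit_cube_def by measurable

lemma to_torus_measurable [measurable]: "to_torus \<in> borel_measurable borel"
  by (rule borel_measurable_continuous_onI[OF continuous_on_to_torus])

lemma emeasure_haar:
  assumes B: "B \<in> sets borel"
  shows "emeasure haar B = emeasure lborel (unit_cube \<inter> to_torus -` B)"
proof -
  have m: "to_torus \<in> restrict_space lborel unit_cube \<rightarrow>\<^sub>M borel"
    by (rule measurable_restrict_space1) simp
  show ?thesis
    unfolding haar_def using B
    by (subst emeasure_distr[OF m]) (auto simp: space_restrict_space emeasure_restrict_space Int_commute)
qed

lemma emeasure_unit_cube: "emeasure lborel (unit_cube :: (real ^ 'n) set) = 1"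
proof (rule antisym)
  have basis: "1 \<bullet> b = 1" if "b \<in> Basis" for b :: "real ^ 'n"
    using that by (auto simp: Basis_vec_def inner_axis)
  have 1: "emeasure lborel (box (0 :: real ^ 'n) 1) = 1"
    by (subst emeasure_lborel_box) (auto simp: basis)
  have 2: "emeasure lborel (cbox (0 :: real ^ 'n) 1) = 1"
    by (subst emeasure_lborel_cbox) (auto simp: basis)
  have "unit_cube \<subseteq> cbox (0 :: real ^ 'n) 1"
    by (auto simp: unit_cube_def mem_box_cart less_imp_le)
  then show "emeasure lborel (unit_cube :: (real ^ 'n) set) \<le> 1"
    using emeasure_mono[of unit_cube "cbox (0 :: real ^ 'n) 1" lborel] 2 by simp
  have "box (0 :: real ^ 'n) 1 \<subseteq> unit_cube"
    by (auto simp: unit_cube_def mem_box_cart less_imp_le)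
  then show "1 \<le> emeasure lborel (unit_cube :: (real ^ 'n) set)"
    using emeasure_mono[of "box (0 :: real ^ 'n) 1" unit_cube lborel] 1 by simp
qed

lemma sets_haar [simp]: "sets haar = sets borel"
  by (simp add: haar_def)

lemma space_haar [simp]: "space haar = UNIV"
  by (simp add: haar_def)

lemma emeasure_haar_UNIV: "emeasure haar UNIV = 1"
  by (simp add: emeasure_haar emeasure_unit_cube)

lemma countable_int_lattice: "countable (int_lattice :: (real ^ 'n) set)"
proof -
  have "int_lattice \<subseteq> range (\<lambda>k :: int ^ 'n. (\<chi> i. real_of_int (k $ i)))"
  proof
    fix v :: "real ^ 'n" assume "v \<in> int_lattice"
    then have "v = (\<chi> i. real_of_int ((\<chi> i. \<lfloor>v $ i\<rfloor>) $ i))"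
      by (auto simp: int_lattice_def vec_eq_iff elim!: Ints_cases)
    then show "v \<in> range (\<lambda>k :: int ^ 'n. (\<chi> i. real_of_int (k $ i)))" by (rule range_eqI)
  qed
  then show ?thesis by (rule countable_subset) simp
qed

lemma emeasure_lborel_translate:
  fixes a :: "'a :: euclidean_space"
  assumes [measurable]: "A \<in> sets borel"
  shows "emeasure lborel ((\<lambda>v. v + a) -` A) = emeasure lborel A"
proof -
  have "emeasure lborel A = emeasure (distr lborel borel ((+) a)) A"
    by (simp add: lborel_distr_plus)
  also have "\<dots> = emeasure lborel ((\<lambda>v. v + a) -` A)"
    by (subst emeasure_distr) (auto simp: add.commute[of a] vimage_def)
  finally show ?thesis by simp
qed

lemma unit_cube_translate_exists:
  "\<exists>z\<in>int_lattice. v + z \<in> unit_cube"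
proof
  show "(\<chi> i. - real_of_int \<lfloor>v $ i\<rfloor>) \<in> int_lattice" by (simp add: int_lattice_def)
  show "v + (\<chi> i. - real_of_int \<lfloor>v $ i\<rfloor>) \<in> unit_cube"
    unfolding unit_cube_def by (auto; linarith)
qed

lemma unit_cube_translate_unique:
  assumes "v \<in> unit_cube" "v + z \<in> unit_cube" "z \<in> int_lattice"
  shows "z = 0"
proof -
  have "z $ i = 0" for i
  proof -
    obtain k where k: "z $ i = of_int k"
      using assms(3) by (auto simp: int_lattice_def elim!: Ints_cases)
    have "0 \<le> v $ i" "v $ i < 1" "0 \<le> v $ i + z $ i" "v $ i + z $ i < 1"
      using assms by (auto simp: unit_cube_def)
    then have "-1 < real_of_int k" "real_of_int k < 1" unfolding k by linarith+
    then show ?thesis using k by simp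
  qed
  then show ?thesis by (simp add: vec_eq_iff)
qed

text \<open>\<^term>\<open>haar\<close> is the Haar probability measure: it has total mass 1 (shown above) and
  it is translation invariant.\<close>

lemma dist_torus_add_right: "dist (x + t) (y + t) = dist x (y :: 'n::finite torus)"
  by transfer simp

lemma haar_translation_invariant:
  "distr haar borel (\<lambda>x. x + t) = (haar :: 'n::finite torus measure)"
proof (rule measure_eqI)
  fix B :: "'n torus set" assume "B \<in> sets (distr haar borel (\<lambda>x. x + t))"
  then have B [measurable]: "B \<in> sets borel" by simp
  obtain a where a: "t = to_torus a" by (rule to_torus_cases)
  define E where "E = to_torus -` B"
  have E [measurable]: "E \<in> sets borel"
    unfolding E_def using measurable_sets_borel[OF to_torus_measurable B] by simp
  have Ez: "v + z \<in> E \<longleftrightarrow> v \<in> E" if "z \<in> int_lattice" for v z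
  proof -
    have "to_torus (v + z) = to_torus v" using that by (simp add: to_torus_eq_iff)
    then show ?thesis by (simp add: E_def)
  qed
  have "continuous_on UNIV (\<lambda>x :: 'n torus. x + t)"
    unfolding continuous_on_iff dist_torus_add_right by blast
  then have m: "(\<lambda>x :: 'n torus. x + t) \<in> borel \<rightarrow>\<^sub>M borel"
    by (rule borel_measurable_continuous_onI)
  have mB: "(\<lambda>x. x + t) -` B \<in> sets borel"
    using measurable_sets_borel[OF m B] by simp
  define Q where "Q = (unit_cube :: (real ^ 'n) set)"
  have Q [measurable]: "Q \<in> sets borel" unfolding Q_def by measurable
  define W where "W = {w \<in> E. w - a \<in> Q}"
  define X where "X z = {w \<in> W. w + z \<in> Q}" for z
  define Y where "Y z = {u \<in> Q \<inter> E. u - z - a \<in> Q}" for z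
  have W [measurable]: "W \<in> sets borel" unfolding W_def by measurable
  have X [measurable]: "X z \<in> sets borel" for z unfolding X_def by measurable
  have Y [measurable]: "Y z \<in> sets borel" for z unfolding Y_def by measurable
  have unique: "z = z'"
    if "v + z \<in> Q" "v + z' \<in> Q" "z \<in> int_lattice" "z' \<in> int_lattice" for v z z'
  proof -
    have "z' - z = 0"
      using that by (intro unit_cube_translate_unique[of "v + z"])
        (auto simp: Q_def intro: int_lattice_diff)
    then show ?thesis by simp
  qed
  have "emeasure (distr haar borel (\<lambda>x. x + t)) B = emeasure haar ((\<lambda>x. x + t) -` B)"
    using m B by (subst emeasure_distr) (auto simp: measurable_cong_sets[OF sets_haar refl])
  also have "\<dots> = emeasure lborel (Q \<inter> to_torus -` ((\<lambda>x. x + t) -` B))"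
    unfolding Q_def by (rule emeasure_haar[OF mB])
  also have "Q \<inter> to_torus -` ((\<lambda>x. x + t) -` B) = (\<lambda>v. v + a) -` W"
    by (auto simp: W_def E_def a plus_to_torus)
  also have "emeasure lborel \<dots> = emeasure lborel W"
    by (rule emeasure_lborel_translate[OF W])
  also have "W = (\<Union>z\<in>int_lattice. X z)"
    using unit_cube_translate_exists unfolding X_def Q_def by blast
  also have "emeasure lborel \<dots> = (\<integral>\<^sup>+z. emeasure lborel (X z) \<partial>count_space int_lattice)"
    by (rule emeasure_UN_countable)
      (auto simp: countable_int_lattice disjoint_family_on_def X_def[symmetric],
       auto simp: X_def dest: unique)
  also have "\<dots> = (\<integral>\<^sup>+z. emeasure lborel (Y z) \<partial>count_space int_lattice)"
  proof (rule nn_integral_cong)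
    fix z :: "real ^ 'n" assume "z \<in> space (count_space int_lattice)"
    then have "X z = (\<lambda>v. v + z) -` Y z"
      unfolding X_def Y_def W_def by (auto simp: Ez)
    then show "emeasure lborel (X z) = emeasure lborel (Y z)"
      using emeasure_lborel_translate[OF Y] by simp
  qed
  also have "\<dots> = emeasure lborel (\<Union>z\<in>int_lattice. Y z)"
  proof (rule emeasure_UN_countable[symmetric])
    show "disjoint_family_on Y int_lattice"
      unfolding disjoint_family_on_def
    proof (intro ballI impI equals0I)
      fix z z' u assume *: "z \<in> int_lattice" "z' \<in> int_lattice" "z \<noteq> z'" "u \<in> Y z \<inter> Y z'"
      then have "(u - a) + (- z) \<in> Q" "(u - a) + (- z') \<in> Q"
        by (auto simp: Y_def algebra_simps)
      then have "- z = - z'"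
        using * by (intro unique[of "u - a"] int_lattice_minus)
      with * show False by simp
    qed
  qed (auto simp: countable_int_lattice)
  also have "(\<Union>z\<in>int_lattice. Y z) = Q \<inter> E"
  proof -
    have "\<exists>z\<in>int_lattice. u - z - a \<in> Q" for u
    proof -
      obtain z where "z \<in> int_lattice" "(u - a) + z \<in> Q"
        using unit_cube_translate_exists[of "u - a"] unfolding Q_def by blast
      then show ?thesis
        by (intro bexI[of _ "- z"] int_lattice_minus) (auto simp: algebra_simps)
    qed
    then show ?thesis unfolding Y_def by blast
  qed
  also have "emeasure lborel (Q \<inter> E) = emeasure haar B"
    unfolding Q_def E_def by (rule emeasure_haar[OF B, symmetric])
  finally show "emeasure (distr haar borel (\<lambda>x. x + t)) B = emeasure haar B" .
qed simp

text \<open>Endomorphisms of the torus are identified with nonsingular integer matrices; the matrix \<open>A\<close>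
  acts by \<open>toral_map A\<close>.\<close>

lemma int_lattice_matrix_mult:
  "v \<in> int_lattice \<Longrightarrow> map_matrix real_of_int A *v v \<in> int_lattice"
  unfolding int_lattice_def matrix_vector_mult_def by (auto intro!: Ints_sum Ints_mult)

lift_definition toral_map :: "int ^ 'n ^ 'n \<Rightarrow> 'n torus \<Rightarrow> 'n torus"
  is "\<lambda>A v. map_matrix real_of_int A *v v"
  unfolding torus_rel_def
  by (metis int_lattice_matrix_mult matrix_vector_mult_diff_distrib)

definition toral_endomorphism :: "int ^ 'n ^ 'n \<Rightarrow> bool" where
  "toral_endomorphism A \<longleftrightarrow> det A \<noteq> 0"

definition toral_automorphism :: "int ^ 'n ^ 'n \<Rightarrow> bool" where
  "toral_automorphism A \<longleftrightarrow> det A = 1 \<or> det A = - 1"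

definition complex_matrix :: "int ^ 'n ^ 'n \<Rightarrow> complex ^ 'n ^ 'n" where
  "complex_matrix A = map_matrix of_int A"

definition complex_vector :: "real ^ 'n \<Rightarrow> complex ^ 'n" where
  "complex_vector v = (\<chi> i. complex_of_real (v $ i))"

definition eigenspace :: "int ^ 'n ^ 'n \<Rightarrow> complex \<Rightarrow> (complex ^ 'n) set" where
  "eigenspace A c = {v. (complex_matrix A - mat c) *v v = 0}"

definition gen_eigenspace :: "int ^ 'n ^ 'n \<Rightarrow> complex \<Rightarrow> (complex ^ 'n) set" where
  "gen_eigenspace A c = {v. ((\<lambda>w. (complex_matrix A - mat c) *v w) ^^ CARD('n)) v = 0}"

definition is_eigenvalue :: "int ^ 'n ^ 'n \<Rightarrow> complex \<Rightarrow> bool" where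
  "is_eigenvalue A c \<longleftrightarrow> (\<exists>v. v \<noteq> 0 \<and> complex_matrix A *v v = c *s v)"

definition quasihyperbolic :: "int ^ 'n ^ 'n \<Rightarrow> bool" where
  "quasihyperbolic A \<longleftrightarrow> (\<forall>c. is_eigenvalue A c \<longrightarrow> (\<forall>n>0. c ^ n \<noteq> 1))"

text \<open>In the next two definitions \<open>c\<close> may range over all complex numbers of the given modulus, as
  the (generalized) eigenspace is trivial when \<open>c\<close> is not an eigenvalue; \<^term>\<open>vec.span\<close> is the
  complex linear span.\<close>

definition contracted_space :: "int ^ 'n ^ 'n \<Rightarrow> (real ^ 'n) set" where
  "contracted_space A =
    {v. complex_vector v \<in> vec.span (\<Union>c\<in>{c. cmod c < 1}. gen_eigenspace A c)}"

definition unimodular_eigenspaces :: "int ^ 'n ^ 'n \<Rightarrow> (real ^ 'n) set" where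
  "unimodular_eigenspaces A =
    {v. complex_vector v \<in> vec.span (\<Union>c\<in>{c. cmod c = 1}. eigenspace A c)}"

definition subspace_sum :: "(real ^ 'n) set \<Rightarrow> (real ^ 'n) set \<Rightarrow> (real ^ 'n) set" where
  "subspace_sum U V = {u + v | u v. u \<in> U \<and> v \<in> V}"

definition Eq :: "int ^ 'n ^ 'n \<Rightarrow> 'n torus set" where
  "Eq A = {x. \<forall>f :: 'n torus \<Rightarrow> real. continuous_on UNIV f \<longrightarrow>
    (\<lambda>N. (\<Sum>n<N. f ((toral_map A ^^ n) x)) / real N) \<longlonglongrightarrow> (\<integral>y. f y \<partial>haar)}"

definition D :: "int ^ 'n ^ 'n \<Rightarrow> 'n torus set" where
  "D A = {x. closure {(toral_map A ^^ n) x | n. True} = UNIV}"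

definition ND :: "int ^ 'n ^ 'n \<Rightarrow> 'n torus set" where
  "ND A = UNIV - D A"

text \<open>The diameter raised to the power \<open>s\<close>, with the usual conventions: the empty set contributes 0,
  and \<open>0\<^sup>0 = 1\<close> (whereas \<open>0 powr 0 = 0\<close> in the library).\<close>

definition diam_power :: "real \<Rightarrow> 'a::metric_space set \<Rightarrow> ennreal" where
  "diam_power s U =
    (if U = {} then 0 else if s = 0 then 1 else ennreal (diameter U powr s))"

text \<open>Boundedness is required because \<^term>\<open>diameter U\<close> is unspecified for unbounded \<open>U\<close>.\<close>

definition hausdorff_premeasure :: "real \<Rightarrow> real \<Rightarrow> 'a::metric_space set \<Rightarrow> ennreal" where
  "hausdorff_premeasure s \<delta> A =
    Inf {(\<Sum>i. diam_power s (U i)) | U :: nat \<Rightarrow> 'a set.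
      A \<subseteq> (\<Union>i. U i) \<and> (\<forall>i. bounded (U i) \<and> diameter (U i) \<le> \<delta>)}"

definition hausdorff_measure :: "real \<Rightarrow> 'a::metric_space set \<Rightarrow> ennreal" where
  "hausdorff_measure s A = (SUP \<delta>\<in>{0<..}. hausdorff_premeasure s \<delta> A)"

definition hausdorff_dim :: "'a::metric_space set \<Rightarrow> ennreal" where
  "hausdorff_dim A = Inf {ennreal s | s. s \<ge> 0 \<and> hausdorff_measure s A = 0}"

end

(*
  Let V be the space of vectors with bounded forward T-orbit and W_k the analogous space for S_k;
  they contain the subspaces in question, so R^d = V + W_k.  We take a random point x = y + v, where v
  is Gaussian on V and y is distributed on a Cantor set in a complement of V.

  Equidistribution: for an integer vector l <> 0 the vectors l_n = (S_k^T)^n l are distinct, and the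
  l_n - l_m are uniformly bounded as functionals on W_k, so their size is felt on V.  Hence the
  correlations of the characters l_n along x decay like a Gaussian in l_n - l_m, their sum over m is
  bounded, and a strong law of large numbers gives x in Eq(S_k) almost surely, without any ergodic
  theorem.

  Nondense orbits: passing to the squarefree part of an annihilating polynomial one finds an integer
  vector k on whose orbit T^T acts semisimply; then |(T^T)^n k| is of exact order rho^n, and rho > 1
  because bounded orbits of integer vectors are periodic.  Along multiples of a large p the functionals
  k_n = (T^T)^(pn) k are lacunary.  In each M-adic cube of side comparable to 1/|k_n| only one slab
  |<k_n,y> - z| < eps (z an integer) is met, and it is removed at the cost of O(M^(u-1)) of the M^u
  subcubes, u = codim V.  Points of the resulting Cantor set have T-orbits that avoid a neighbourhood
  of 0, also after adding a small v in V.

  The law of x gives balls of radius r measure O(r^s) with s as close to d as desired, so the mass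
  distribution principle applies.
*)
theory Submission
  imports Defs "HOL-Probability.Probability" "HOL-Computational_Algebra.Computational_Algebra"
    "HOL-Computational_Algebra.Field_as_Ring"
begin

section \<open>Hausdorff dimension on the torus\<close>

text \<open>The obstacle is that a Cantor set built for \<open>T\<close> need not have any Fourier
  decay, and that the spaces \<open>W_k\<close> bear no relation to it. All decay is therefore taken
  from the Gaussian on \<open>V\<close>; the resulting bound does not depend on the law of
  \<open>y\<close>, so \<open>y\<close> can be designed for \<open>T\<close> alone and one random
  point serves every \<open>S_k\<close>. Conversely the Gaussian does not spoil the avoidance:
  <(T^T)^n k, v> = <k, T^n v> stays bounded in n for v in \<open>V\<close>, hence is uniformly small
  for small v. The same identity bounds l_n - l_m on \<open>W_k\<close>. It also explains why
  eigenvalues of modulus 1 enter only through genuine eigenvectors: along a Jordan block the orbit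
  would grow polynomially. Smallness of v is imposed as an event of positive probability, not built
  into the law, so that almost sure equidistribution is simply inherited. Exponents: keeping M^u -
  (2u+2) M^(u-1) of M^u subcubes means keeping at least M^(u-eta) of them once M is large, so a ball
  of radius r has mass of order r^(u-eta) from the Cantor coordinates, times r^(dim V) from the
  bounded Gaussian density, up to constants.\<close>

lemma to_torus_unit_cube_cases:
  obtains v where "x = to_torus v" "v \<in> unit_cube"
proof -
  obtain v where v: "x = to_torus v" by (rule to_torus_cases)
  obtain z where z: "z \<in> int_lattice" "v + z \<in> unit_cube"
    using unit_cube_translate_exists by blast
  have "x = to_torus (v + z)"
    unfolding v to_torus_eq_iff using int_lattice_minus[OF z(1)] by simp
  then show ?thesis using z(2) that by blast
qed

lemma compact_torus: "compact (UNIV :: 'n::finite torus set)"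
proof -
  have "x \<in> to_torus ` cbox 0 1" for x :: "'n torus"
    by (cases x rule: to_torus_unit_cube_cases) (auto simp: unit_cube_def mem_box_cart less_imp_le)
  then have "(UNIV :: 'n torus set) = to_torus ` cbox 0 1" by blast
  then show ?thesis
    using compact_continuous_image[OF continuous_on_to_torus compact_cbox] by metis
qed

lemma bounded_torus: "bounded (A :: 'n::finite torus set)"
  using compact_imp_bounded[OF compact_torus] bounded_subset by blast

text \<open>The mass distribution principle, phrased for a random point \<open>X\<close> and an
  event \<open>A\<close> instead of a measure carried by \<open>E\<close>. Each nonempty cover set
  lies in a ball about one of its points with radius its diameter, so its share of \<open>A\<close>
  is at most \<open>C\<close> times that diameter to the power \<open>s\<close>. Membership in
  \<open>E\<close> is required only almost surely, so \<open>E\<close> itself need not be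
  measurable.\<close>

lemma hausdorff_measure_mass_distribution:
  fixes X :: "'w \<Rightarrow> 'a::metric_space" and E :: "'a set"
  assumes "finite_measure \<mu>"
    and A: "A \<in> sets \<mu>" "emeasure \<mu> A > 0"
    and E: "AE \<omega> in \<mu>. \<omega> \<in> A \<longrightarrow> X \<omega> \<in> E"
    and meas: "\<And>x r. X -` cball x r \<inter> A \<in> sets \<mu>"
    and s: "s > 0" and t: "0 \<le> t" "t \<le> s" and C: "C > 0" and r0: "r0 > 0"
    and ball: "\<And>x r. 0 < r \<Longrightarrow> r \<le> r0 \<Longrightarrow> emeasure \<mu> (X -` cball x r \<inter> A) \<le> ennreal (C * r powr s)"
  shows "hausdorff_measure t E > 0"
proof -
  \<comment> \<open>Diameters at most 1 make the power with the smaller exponent \<open>t\<close>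
    the larger one; diameters at most \<open>r0\<close> admit the ball estimate.\<close>
  define \<delta> where "\<delta> = min 1 r0"
  have \<delta>: "\<delta> > 0" "\<delta> \<le> 1" "\<delta> \<le> r0" using r0 by (auto simp: \<delta>_def)
  \<comment> \<open>Cover sets of diameter 0 are out of reach of \<open>ball\<close>, which needs a
    positive radius; letting the radius tend to 0 shows that they carry no mass.\<close>
  have ball0: "emeasure \<mu> (X -` cball x 0 \<inter> A) = 0" for x
  proof (rule ccontr)
    assume "emeasure \<mu> (X -` cball x 0 \<inter> A) \<noteq> 0"
    have lim: "((\<lambda>r. ennreal (C * r powr s)) \<longlongrightarrow> ennreal 0) (at_right 0)"
    proof (rule tendsto_ennrealI)
      have "((\<lambda>r. r powr s) \<longlongrightarrow> 0 powr s) (at_right (0::real))"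
        by (intro tendsto_powr2 tendsto_intros) (auto simp: s eventually_at_right_less intro: eventually_mono[OF eventually_at_right_less])
      then show "((\<lambda>r. C * r powr s) \<longlongrightarrow> 0) (at_right 0)"
        using tendsto_mult_right_zero by (metis powr_zero_eq_one powr_0 mult_zero_right tendsto_mult_left)
    qed
    have "emeasure \<mu> (X -` cball x 0 \<inter> A) \<le> ennreal 0"
    proof (rule tendsto_lowerbound[OF lim])
      show "\<forall>\<^sub>F r in at_right 0. emeasure \<mu> (X -` cball x 0 \<inter> A) \<le> ennreal (C * r powr s)"
        unfolding eventually_at_right_field
      proof (intro exI[of _ r0] conjI allI impI r0)
        fix r assume r: "0 < r" "r < r0"
        have "emeasure \<mu> (X -` cball x 0 \<inter> A) \<le> emeasure \<mu> (X -` cball x r \<inter> A)"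
          using r by (intro emeasure_mono meas) auto
        also have "\<dots> \<le> ennreal (C * r powr s)" using r by (intro ball) auto
        finally show "emeasure \<mu> (X -` cball x 0 \<inter> A) \<le> ennreal (C * r powr s)" .
      qed
    qed simp
    then show False using \<open>emeasure \<mu> (X -` cball x 0 \<inter> A) \<noteq> 0\<close> by simp
  qed
  have "emeasure \<mu> A / ennreal C \<le> hausdorff_premeasure t \<delta> E"
    unfolding hausdorff_premeasure_def
  proof (rule Inf_greatest, clarify)
    fix U :: "nat \<Rightarrow> 'a set"
    assume cover: "E \<subseteq> (\<Union>i. U i)" and U: "\<forall>i. bounded (U i) \<and> diameter (U i) \<le> \<delta>"
    define p where "p i = (SOME x. x \<in> U i)" for i
    define B where "B i = (if U i = {} then {} else X -` cball (p i) (diameter (U i)) \<inter> A)" for i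
    have Bm: "B i \<in> sets \<mu>" for i using meas by (auto simp: B_def)
    have UB: "X -` U i \<inter> A \<subseteq> B i" for i
    proof
      fix \<omega> assume w: "\<omega> \<in> X -` U i \<inter> A"
      then have "p i \<in> U i" unfolding p_def by (auto intro: someI)
      then have "dist (p i) (X \<omega>) \<le> diameter (U i)"
        using U w by (intro diameter_bounded_bound) auto
      then show "\<omega> \<in> B i" using w by (auto simp: B_def)
    qed
    have "emeasure \<mu> A \<le> emeasure \<mu> (\<Union>i. B i)"
    proof (rule emeasure_mono_AE)
      show "AE \<omega> in \<mu>. \<omega> \<in> A \<longrightarrow> \<omega> \<in> (\<Union>i. B i)"
        using E
      proof (rule AE_mp, intro AE_I2 impI)
        fix \<omega> assume "\<omega> \<in> A \<longrightarrow> X \<omega> \<in> E" "\<omega> \<in> A"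
        then obtain i where "X \<omega> \<in> U i" using cover by auto
        then show "\<omega> \<in> (\<Union>i. B i)" using UB[of i] \<open>\<omega> \<in> A\<close> by auto
      qed
    qed (use Bm in auto)
    also have "\<dots> \<le> (\<Sum>i. emeasure \<mu> (B i))"
      using Bm by (intro emeasure_subadditive_countably) auto
    also have "\<dots> \<le> (\<Sum>i. ennreal C * diam_power t (U i))"
    proof (intro suminf_le summableI)
      fix i
      show "emeasure \<mu> (B i) \<le> ennreal C * diam_power t (U i)"
      proof (cases "U i = {} \<or> diameter (U i) = 0")
        case True then show ?thesis using ball0[simplified] by (auto simp: B_def)
      next
        case False
        let ?d = "diameter (U i)"
        have d: "0 < ?d" "?d \<le> 1" "?d \<le> r0"
          using False U \<delta> diameter_ge_0[of "U i"] by (auto intro: order_trans)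
        have "emeasure \<mu> (B i) \<le> ennreal (C * ?d powr s)"
          using False d ball by (simp add: B_def)
        also have "\<dots> = ennreal C * ennreal (?d powr s)"
          using C by (simp add: ennreal_mult')
        also have "ennreal (?d powr s) \<le> diam_power t (U i)"
        proof (cases "t = 0")
          case True
          have "?d powr s \<le> 1" using d s powr_mono2[of s ?d 1] by simp
          then show ?thesis using True False by (simp add: diam_power_def)
        next
          case False': False
          have "?d powr s \<le> ?d powr t" using d t by (intro powr_mono') auto
          then show ?thesis using False' False by (auto simp: diam_power_def intro: ennreal_leI)
        qed
        finally show ?thesis by (simp add: mult_left_mono)
      qed
    qed
    also have "\<dots> = (\<Sum>i. diam_power t (U i)) * ennreal C" by (simp add: mult.commute)
    finally show "emeasure \<mu> A / ennreal C \<le> (\<Sum>i. diam_power t (U i))"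
      using C by (intro divide_le_posI_ennreal) (auto simp: mult.commute)
  qed
  moreover have "emeasure \<mu> A / ennreal C > 0"
    using A C by (simp add: ennreal_zero_less_divide)
  moreover have "hausdorff_premeasure t \<delta> E \<le> hausdorff_measure t E"
    unfolding hausdorff_measure_def using \<delta> by (intro SUP_upper) auto
  ultimately show ?thesis by (metis order_less_le_trans)
qed

text \<open>The unit cube is cut into a grid of side \<open>1 / M\<close>. Cell diameters are
  estimated through the l1 norm, which produces the factor \<open>CARD('n)\<close>.\<close>

lemma hausdorff_premeasure_torus_le:
  fixes A :: "'n::finite torus set"
  assumes s: "s > 0" and M: "M > 0" "real CARD('n) / real M \<le> \<delta>"
  shows "hausdorff_premeasure s \<delta> A \<le>
    ennreal (real M ^ CARD('n) * (real CARD('n) / real M) powr s)"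
proof -
  define F where "F = (UNIV :: 'n set) \<rightarrow>\<^sub>E {..<M}"
  have F: "finite F" "card F = M ^ CARD('n)"
    unfolding F_def by (auto simp: card_PiE intro: finite_PiE)
  obtain h where h: "bij_betw h {..<card F} F"
    using ex_bij_betw_nat_finite[OF F(1)] by (auto simp: lessThan_atLeast0)
  define Q where "Q f = to_torus ` {v :: real ^ 'n. \<forall>i. real (f i) / M \<le> v $ i \<and> v $ i \<le> (real (f i) + 1) / M}"
    for f :: "'n \<Rightarrow> nat"
  define U where "U i = (if i < card F then Q (h i) else {})" for i
  have diam: "diameter (Q f) \<le> real CARD('n) / M" for f
  proof -
    have "dist x y \<le> real CARD('n) / M" if "x \<in> Q f" "y \<in> Q f" for x y
    proof -
      obtain v w where vw: "x = to_torus v" "y = to_torus w"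
        "\<And>i. real (f i) / M \<le> v $ i" "\<And>i. v $ i \<le> (real (f i) + 1) / M"
        "\<And>i. real (f i) / M \<le> w $ i" "\<And>i. w $ i \<le> (real (f i) + 1) / M"
        using \<open>x \<in> Q f\<close> \<open>y \<in> Q f\<close> unfolding Q_def by blast
      have "dist x y \<le> norm (v - w)" unfolding vw by (rule dist_to_torus_le)
      also have "\<dots> \<le> (\<Sum>i\<in>UNIV. \<bar>(v - w) $ i\<bar>)" by (rule norm_le_l1_cart)
      also have "\<dots> \<le> (\<Sum>i\<in>(UNIV :: 'n set). 1 / M)"
      proof (rule sum_mono)
        fix i show "\<bar>(v - w) $ i\<bar> \<le> 1 / M"
          using vw(3-6)[of i] by (simp add: add_divide_distrib abs_le_iff)
      qed
      finally show ?thesis by simp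
    qed
    then show ?thesis unfolding diameter_def by (auto intro!: cSUP_least)
  qed
  have "A \<subseteq> (\<Union>i. U i)"
  proof
    fix x assume "x \<in> A"
    obtain v where x: "x = to_torus v" and vc: "v \<in> unit_cube" by (rule to_torus_unit_cube_cases)
    have v: "0 \<le> v $ i" "v $ i < 1" for i using vc by (auto simp: unit_cube_def)
    define f where "f i = nat \<lfloor>M * v $ i\<rfloor>" for i
    have f1: "real (f i) \<le> M * v $ i \<and> M * v $ i < real (f i) + 1" for i
    proof -
      have "0 \<le> M * v $ i" using v(1)[of i] by simp
      then show ?thesis unfolding f_def by linarith
    qed
    have "f i < M" for i
    proof -
      have "M * v $ i < real M" using v[of i] M mult_strict_left_mono[of "v $ i" 1 "real M"] by simp
      then have "real (f i) < real M" using f1[of i] by linarith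
      then show ?thesis by simp
    qed
    then have "f \<in> F" by (auto simp: F_def)
    then obtain i where i: "i < card F" "f = h i" using h unfolding bij_betw_def by blast
    have "real (f i) / M \<le> v $ i \<and> v $ i \<le> (real (f i) + 1) / M" for i
      using f1[of i] M by (simp add: field_simps)
    then have "x \<in> U i" unfolding U_def x Q_def using i by auto
    then show "x \<in> (\<Union>i. U i)" by blast
  qed
  moreover have "\<forall>i. bounded (U i) \<and> diameter (U i) \<le> \<delta>"
  proof -
    have "0 \<le> \<delta>" using M by (auto intro: order_trans[rotated])
    then show ?thesis
      using order_trans[OF diam M(2)] by (auto simp: U_def bounded_torus)
  qed
  ultimately have "hausdorff_premeasure s \<delta> A \<le> (\<Sum>i. diam_power s (U i))"
    unfolding hausdorff_premeasure_def by (intro Inf_lower) blast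
  also have "\<dots> = (\<Sum>i<card F. diam_power s (U i))"
    by (rule suminf_finite) (auto simp: U_def diam_power_def)
  also have "\<dots> \<le> (\<Sum>i<card F. ennreal ((real CARD('n) / M) powr s))"
  proof (rule sum_mono)
    fix i assume "i \<in> {..<card F}"
    then show "diam_power s (U i) \<le> ennreal ((real CARD('n) / M) powr s)"
      using s diam diameter_ge_0[OF bounded_torus]
      by (auto simp: diam_power_def U_def intro!: ennreal_leI powr_mono2)
  qed
  also have "\<dots> = ennreal (real M ^ CARD('n) * (real CARD('n) / real M) powr s)"
    by (simp add: F ennreal_of_nat_eq_real_of_nat ennreal_mult'[symmetric])
  finally show ?thesis .
qed

text \<open>For \<open>s\<close> above the number of coordinates the cost of the grid cover tends to
  0 as the grid is refined.\<close>

lemma hausdorff_dim_torus_le: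
  fixes A :: "'n::finite torus set"
  shows "hausdorff_dim A \<le> of_nat CARD('n)"
proof -
  have zero: "hausdorff_measure s A = 0" if s: "s > real CARD('n)" for s
  proof -
    have "hausdorff_premeasure s \<delta> A = 0" if "\<delta> > 0" for \<delta>
    proof -
      define g where "g M = real M ^ CARD('n) * (real CARD('n) / real M) powr s" for M
      have "g = (\<lambda>M. real M ^ CARD('n) * (real CARD('n) / real M) powr s)"
        by (simp add: g_def fun_eq_iff)
      have "(\<lambda>M. real CARD('n) powr s * real M powr - (s - real CARD('n))) \<longlonglongrightarrow> real CARD('n) powr s * 0"
        using s by (intro tendsto_mult tendsto_const tendsto_neg_powr filterlim_real_sequentially) auto
      moreover have "\<forall>\<^sub>F M in sequentially.
          real CARD('n) powr s * real M powr - (s - real CARD('n)) = g M"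
        using eventually_gt_at_top[of 0]
      proof eventually_elim
        case (elim M)
        then show ?case
          by (simp add: g_def powr_divide powr_diff powr_realpow field_simps)
      qed
      ultimately have "g \<longlonglongrightarrow> real CARD('n) powr s * 0" by (rule Lim_transform_eventually)
      then have "g \<longlonglongrightarrow> 0" by simp
      then have "(\<lambda>M. ennreal (g M)) \<longlonglongrightarrow> ennreal 0" by (rule tendsto_ennrealI)
      moreover have "\<forall>\<^sub>F M in sequentially. hausdorff_premeasure s \<delta> A \<le> ennreal (g M)"
      proof -
        have "(\<lambda>M. real CARD('n) / real M) \<longlonglongrightarrow> 0" by (rule lim_const_over_n)
        then have "\<forall>\<^sub>F M in sequentially. real CARD('n) / real M < \<delta>"
          using \<open>\<delta> > 0\<close> by (rule order_tendstoD)
        then show ?thesis using eventually_gt_at_top[of 0]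
        proof eventually_elim
          case (elim M)
          then show ?case unfolding g_def
            using s by (intro hausdorff_premeasure_torus_le) auto
        qed
      qed
      ultimately have "hausdorff_premeasure s \<delta> A \<le> ennreal 0"
        by (rule tendsto_lowerbound) simp
      then show ?thesis by simp
    qed
    then show ?thesis unfolding hausdorff_measure_def by simp
  qed
  show ?thesis
  proof (rule ennreal_le_epsilon)
    fix e :: real assume "e > 0"
    have "hausdorff_dim A \<le> ennreal (real CARD('n) + e)"
      unfolding hausdorff_dim_def using \<open>e > 0\<close> zero[of "real CARD('n) + e"]
      by (intro Inf_lower CollectI exI[of _ "real CARD('n) + e"]) auto
    also have "\<dots> = of_nat CARD('n) + ennreal e"
      using \<open>e > 0\<close> by (simp add: ennreal_of_nat_eq_real_of_nat)
    finally show "hausdorff_dim A \<le> of_nat CARD('n) + ennreal e" .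
  qed
qed

lemma hausdorff_dim_geI:
  assumes "\<And>t. 0 \<le> t \<Longrightarrow> t < d \<Longrightarrow> hausdorff_measure t A > 0"
  shows "ennreal d \<le> hausdorff_dim A"
  unfolding hausdorff_dim_def
  by (rule Inf_greatest) (use assms in \<open>fastforce intro: ennreal_leI leI\<close>)

section \<open>Characters and equidistribution\<close>

text \<open>A function on the covering space, for arbitrary real \<open>k\<close>; it descends to
  the torus when \<open>k\<close> is integral, see \<open>torus_char_int_lattice\<close>.\<close>

definition torus_char :: "real ^ 'n \<Rightarrow> real ^ 'n \<Rightarrow> complex" where
  "torus_char k v = cis (2 * pi * (k \<bullet> v))"

lemma norm_torus_char [simp]: "cmod (torus_char k v) = 1"
  by (simp add: torus_char_def)

lemma torus_char_0 [simp]: "torus_char 0 v = 1"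
  by (simp add: torus_char_def)

lemma torus_char_add_right: "torus_char k (v + w) = torus_char k v * torus_char k w"
  by (simp add: torus_char_def cis_mult inner_add_right algebra_simps)

lemma torus_char_add_left: "torus_char (k + l) v = torus_char k v * torus_char l v"
  by (simp add: torus_char_def cis_mult inner_add_left algebra_simps)

lemma torus_char_mult_cnj: "torus_char k v * cnj (torus_char l v) = torus_char (k - l) v"
  by (simp add: torus_char_def cis_cnj cis_mult inner_diff_left algebra_simps)

lemma continuous_on_torus_char: "continuous_on A (torus_char k)"
  unfolding torus_char_def by (intro continuous_intros)

lemma inner_int_lattice: "k \<in> int_lattice \<Longrightarrow> v \<in> int_lattice \<Longrightarrow> k \<bullet> v \<in> \<int>"
  by (auto simp: int_lattice_def inner_vec_def intro!: Ints_sum Ints_mult)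

lemma cis_2pi_Ints: "x \<in> \<int> \<Longrightarrow> cis (2 * pi * x) = 1"
  by (auto elim!: Ints_cases simp: cis_multiple_2pi)

lemma torus_char_int_lattice:
  "k \<in> int_lattice \<Longrightarrow> v \<in> int_lattice \<Longrightarrow> torus_char k v = 1"
  unfolding torus_char_def by (intro cis_2pi_Ints inner_int_lattice)

lemma toral_map_to_torus: "toral_map A (to_torus v) = to_torus (map_matrix real_of_int A *v v)"
  by (rule toral_map.abs_eq)

lemma toral_map_funpow_to_torus:
  "(toral_map A ^^ n) (to_torus v) = to_torus (((*v) (map_matrix real_of_int A) ^^ n) v)"
  by (induction n) (auto simp: toral_map_to_torus)

inductive trig_poly :: "(real ^ 'n \<Rightarrow> complex) \<Rightarrow> bool" where
  char: "k \<in> int_lattice \<Longrightarrow> trig_poly (\<lambda>v. c * torus_char k v)"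
| add: "trig_poly f \<Longrightarrow> trig_poly g \<Longrightarrow> trig_poly (\<lambda>v. f v + g v)"

lemma trig_poly_mult:
  assumes "trig_poly f" "trig_poly g"
  shows "trig_poly (\<lambda>v. f v * g v)"
  using assms
proof (induction rule: trig_poly.induct)
  case (char k c)
  from char(2) show ?case
  proof (induction rule: trig_poly.induct)
    case (char l d)
    have "trig_poly (\<lambda>v. (c * d) * torus_char (k + l) v)"
      using \<open>k \<in> int_lattice\<close> char by (intro trig_poly.char int_lattice_add)
    then show ?case by (simp add: torus_char_add_left mult_ac)
  qed (auto simp: algebra_simps intro: trig_poly.add)
qed (auto simp: algebra_simps intro: trig_poly.add)

lemma trig_poly_continuous: "trig_poly f \<Longrightarrow> continuous_on UNIV f"
  by (induction rule: trig_poly.induct)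
    (intro continuous_intros continuous_on_torus_char | assumption)+

lemma trig_poly_cos:
  assumes "k \<in> int_lattice"
  shows "trig_poly (\<lambda>v. of_real (cos (2 * pi * (k \<bullet> v))))"
proof -
  have "trig_poly (\<lambda>v. 1/2 * torus_char k v + 1/2 * torus_char (-k) v)"
    using assms by (intro trig_poly.intros int_lattice_minus)
  moreover have "1/2 * torus_char k v + 1/2 * torus_char (-k) v = of_real (cos (2 * pi * (k \<bullet> v)))" for v
    by (simp add: torus_char_def complex_eq_iff)
  ultimately show ?thesis by simp
qed

lemma trig_poly_sin:
  assumes "k \<in> int_lattice"
  shows "trig_poly (\<lambda>v. of_real (sin (2 * pi * (k \<bullet> v))))"
proof -
  have "trig_poly (\<lambda>v. (-\<i>/2) * torus_char k v + (\<i>/2) * torus_char (-k) v)"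
    using assms by (intro trig_poly.intros int_lattice_minus)
  moreover have "(-\<i>/2) * torus_char k v + (\<i>/2) * torus_char (-k) v = of_real (sin (2 * pi * (k \<bullet> v)))" for v
    by (simp add: torus_char_def complex_eq_iff)
  ultimately show ?thesis by simp
qed

lemma continuous_on_torusI:
  fixes f :: "'n::finite torus \<Rightarrow> 'b::topological_space"
  assumes "continuous_on UNIV (\<lambda>v. f (to_torus v))"
  shows "continuous_on UNIV f"
proof (subst continuous_on_open_vimage, simp, intro allI impI)
  fix B :: "'b set" assume "open B"
  then have "open ((\<lambda>v. f (to_torus v)) -` B)"
    using assms by (simp add: continuous_on_open_vimage)
  then have "open (to_torus -` (f -` B))" by (simp add: vimage_def)
  then show "open (f -` B \<inter> UNIV)" by (simp add: open_torus_iff)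
qed

text \<open>Stone-Weierstrass. Products stay in the class because characters multiply by adding
  frequencies. Two distinct torus points differ modulo 1 in some coordinate, which its cosine and
  sine together detect.\<close>

lemma trig_poly_dense:
  fixes f :: "'n::finite torus \<Rightarrow> real"
  assumes "continuous_on UNIV f" "e > 0"
  obtains g where "continuous_on UNIV g" "trig_poly (\<lambda>v. of_real (g (to_torus v)))"
    "\<And>x. \<bar>f x - g x\<bar> < e"
proof -
  define R where "R = {g :: 'n torus \<Rightarrow> real. trig_poly (\<lambda>v. of_real (g (to_torus v)))}"
  have cont: "continuous_on UNIV g" if "g \<in> R" for g
  proof (rule continuous_on_torusI)
    have "continuous_on UNIV (\<lambda>v. Re (complex_of_real (g (to_torus v))))"
      using that by (intro continuous_on_Re trig_poly_continuous) (auto simp: R_def)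
    then show "continuous_on UNIV (\<lambda>v. g (to_torus v))" by simp
  qed
  interpret function_ring_on R "UNIV :: 'n torus set"
  proof
    fix g h assume gh: "g \<in> R" "h \<in> R"
    show "(\<lambda>x. g x + h x) \<in> R" using gh by (auto simp: R_def intro: trig_poly.add)
    show "(\<lambda>x. g x * h x) \<in> R" using gh by (auto simp: R_def intro: trig_poly_mult)
  next
    fix c show "(\<lambda>_. c) \<in> R"
      using trig_poly.char[of 0 "of_real c"] by (simp add: R_def)
  next
    fix x y :: "'n torus" assume "x \<noteq> y"
    obtain v where v: "x = to_torus v" by (rule to_torus_cases)
    obtain w where w: "y = to_torus w" by (rule to_torus_cases)
    from \<open>x \<noteq> y\<close> obtain i where i: "v $ i - w $ i \<notin> \<int>"
      unfolding v w to_torus_eq_iff by (auto simp: int_lattice_def)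
    have ax: "axis i 1 \<in> int_lattice" by (auto simp: int_lattice_def axis_def)
    define F where "F h u = h (2 * pi * u $ i)" for h :: "real \<Rightarrow> real" and u :: "real ^ 'n"
    \<comment> \<open>\<open>rep_torus\<close> picks an arbitrary lift; periodicity makes the value
      independent of it.\<close>
    define G where "G h x = F h (rep_torus x)" for h x
    have G: "G h (to_torus u) = F h u" if h: "h = cos \<or> h = sin" for h u
    proof -
      have "to_torus (rep_torus (to_torus u)) = to_torus u"
        using Quotient_abs_rep[OF Quotient_torus] by metis
      then have "rep_torus (to_torus u) - u \<in> int_lattice" by (simp add: to_torus_eq_iff)
      then obtain m where m: "rep_torus (to_torus u) $ i = u $ i + of_int m"
        by (auto simp: int_lattice_def algebra_simps elim!: Ints_cases dest!: spec[of _ i])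
      have "cis (2 * pi * (u $ i + of_int m)) = cis (2 * pi * u $ i)"
        by (simp add: ring_distribs cis_mult[symmetric] cis_multiple_2pi)
      then show ?thesis using h unfolding G_def F_def m by (auto simp: complex_eq_iff)
    qed
    have inn: "axis i 1 \<bullet> u = u $ i" for u :: "real ^ 'n" by (simp add: inner_axis inner_commute)
    have "G cos \<in> R" "G sin \<in> R"
      using trig_poly_cos[OF ax] trig_poly_sin[OF ax] G by (auto simp: R_def F_def inn)
    moreover have "G cos x \<noteq> G cos y \<or> G sin x \<noteq> G sin y"
    proof (rule ccontr)
      assume "\<not> ?thesis"
      then have "cos (2 * pi * v $ i) = cos (2 * pi * w $ i)" "sin (2 * pi * v $ i) = sin (2 * pi * w $ i)"
        unfolding v w using G by (auto simp: F_def)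
      then obtain n :: int where "2 * pi * v $ i = 2 * pi * w $ i + 2 * pi * real_of_int n"
        using sin_cos_eq_iff[of "2 * pi * v $ i" "2 * pi * w $ i"] by metis
      then have "2 * pi * (v $ i - w $ i - real_of_int n) = 0" by (simp only: right_diff_distrib)
      then have "v $ i - w $ i = of_int n" by simp
      then show False using i by simp
    qed
    ultimately show "\<exists>f\<in>R. f x \<noteq> f y" by blast
  next
    show "compact (UNIV :: 'n torus set)" by (rule compact_torus)
    show "continuous_on UNIV g" if "g \<in> R" for g using that by (rule cont)
  qed
  obtain g where "g \<in> R" "\<And>x. \<bar>f x - g x\<bar> < e"
    using Stone_Weierstrass_basic[OF assms] by auto
  then show ?thesis using that cont by (auto simp: R_def)
qed

lemma haar_prob_space: "prob_space (haar :: 'n::finite torus measure)"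
  by (rule prob_spaceI) (simp add: emeasure_haar_UNIV)

lemma measure_haar_UNIV: "measure haar UNIV = 1"
  using prob_space.prob_space[OF haar_prob_space] by simp

lemma integrable_haar_continuous:
  fixes f :: "'n::finite torus \<Rightarrow> 'b::{banach,second_countable_topology}"
  assumes "continuous_on UNIV f"
  shows "integrable haar f"
proof -
  interpret prob_space "haar :: 'n torus measure" by (rule haar_prob_space)
  have "bounded (range f)"
    using compact_continuous_image[OF assms compact_torus] by (rule compact_imp_bounded)
  then obtain B where "\<And>x. norm (f x) \<le> B" by (auto simp: bounded_iff)
  moreover have "f \<in> borel_measurable haar"
    using borel_measurable_continuous_onI[OF assms] by (simp add: measurable_def)
  ultimately show ?thesis by (intro integrable_const_bound[of _ B]) auto
qed

text \<open>A suitable translation multiplies the character by -1 and preserves \<open>haar\<close>,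
  so the integral equals its own negative.\<close>

lemma haar_integral_char:
  fixes f :: "'n::finite torus \<Rightarrow> complex"
  assumes k: "k \<in> int_lattice" "k \<noteq> 0" and f: "\<And>v. f (to_torus v) = torus_char k v"
  shows "integral\<^sup>L haar f = 0"
proof -
  \<comment> \<open>Scaled so that \<open>k \<bullet> a = 1 / 2\<close>, half a period.\<close>
  define a where "a = (1 / (2 * (k \<bullet> k))) *\<^sub>R k"
  have ka: "torus_char k a = -1"
    using k by (simp add: torus_char_def a_def cis_pi)
  have cont: "continuous_on UNIV f"
    by (rule continuous_on_torusI) (simp add: f continuous_on_torus_char)
  have m: "f \<in> borel_measurable borel" by (rule borel_measurable_continuous_onI[OF cont])
  have "continuous_on UNIV (\<lambda>x :: 'n torus. x + to_torus a)"
    unfolding continuous_on_iff dist_torus_add_right by blast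
  then have m': "(\<lambda>x :: 'n torus. x + to_torus a) \<in> haar \<rightarrow>\<^sub>M borel"
    using borel_measurable_continuous_onI by (simp add: measurable_def)
  have "integral\<^sup>L haar f = integral\<^sup>L (distr haar borel (\<lambda>x. x + to_torus a)) f"
    by (simp add: haar_translation_invariant)
  also have "\<dots> = (\<integral>x. f (x + to_torus a) \<partial>haar)"
    by (rule integral_distr[OF m' m])
  also have "\<dots> = (\<integral>x. - f x \<partial>haar)"
  proof (rule Bochner_Integration.integral_cong)
    fix x :: "'n torus"
    obtain v where "x = to_torus v" by (rule to_torus_cases)
    then show "f (x + to_torus a) = - f x"
      by (simp add: plus_to_torus f torus_char_add_right ka)
  qed simp
  also have "\<dots> = - integral\<^sup>L haar f" by simp
  finally show ?thesis by simp
qed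

text \<open>Only the zero frequency contributes, to the averages in the limit as well as to the
  integral. The torus function \<open>f\<close> is part of the conclusion because \<open>g\<close>
  lives on the covering space.\<close>

lemma trig_poly_equidistribution:
  fixes x :: "nat \<Rightarrow> real ^ 'n" and g :: "real ^ 'n \<Rightarrow> complex"
  assumes "trig_poly g"
    and "\<And>k. k \<in> int_lattice \<Longrightarrow> k \<noteq> 0 \<Longrightarrow>
      (\<lambda>N. (\<Sum>n<N. torus_char k (x n)) / of_nat N) \<longlonglongrightarrow> 0"
  shows "\<exists>f. continuous_on UNIV f \<and> (\<forall>v. f (to_torus v) = g v) \<and>
    (\<lambda>N. (\<Sum>n<N. g (x n)) / of_nat N) \<longlonglongrightarrow> integral\<^sup>L haar f"
  using assms(1)
proof (induction rule: trig_poly.induct)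
  case (char k c)
  define f0 where "f0 y = torus_char k (rep_torus y)" for y :: "'n torus"
  have f0: "f0 (to_torus u) = torus_char k u" for u
  proof -
    have "to_torus (rep_torus (to_torus u)) = to_torus u"
      using Quotient_abs_rep[OF Quotient_torus] by metis
    then have "rep_torus (to_torus u) - u \<in> int_lattice" by (simp add: to_torus_eq_iff)
    then have "torus_char k (u + (rep_torus (to_torus u) - u)) = torus_char k u"
      using char by (simp only: torus_char_add_right torus_char_int_lattice)  simp
    then show ?thesis by (simp add: f0_def)
  qed
  have cont: "continuous_on UNIV f0"
    by (rule continuous_on_torusI) (simp add: f0 continuous_on_torus_char)
  interpret prob_space "haar :: 'n torus measure" by (rule haar_prob_space)
  have "(\<lambda>N. (\<Sum>n<N. torus_char k (x n)) / of_nat N) \<longlonglongrightarrow> integral\<^sup>L haar f0"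
  proof (cases "k = 0")
    case True
    have "f0 y = 1" for y using f0 by (cases y rule: to_torus_cases) (simp add: True)
    then have "f0 = (\<lambda>_. 1)" by (simp add: fun_eq_iff)
    then have "integral\<^sup>L haar f0 = 1" by (simp add: measure_haar_UNIV)
    moreover have "(\<lambda>N. (\<Sum>n<N. torus_char k (x n)) / of_nat N) \<longlonglongrightarrow> 1"
      by (rule Lim_transform_eventually[OF tendsto_const eventually_mono[OF eventually_gt_at_top[of 0]]])
        (simp add: True)
    ultimately show ?thesis by simp
  next
    case False
    then show ?thesis using haar_integral_char[OF char False f0] assms(2)[OF char False] by simp
  qed
  then have "(\<lambda>N. c * ((\<Sum>n<N. torus_char k (x n)) / of_nat N)) \<longlonglongrightarrow> c * integral\<^sup>L haar f0"
    by (rule tendsto_mult_left)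
  then show ?case
    by (intro exI[of _ "\<lambda>y. c * f0 y"])
      (auto simp: f0 sum_distrib_left intro!: continuous_intros cont)
next
  case (add g h)
  then obtain f1 f2 where f: "continuous_on UNIV f1" "\<forall>v. f1 (to_torus v) = g v"
    "(\<lambda>N. (\<Sum>n<N. g (x n)) / of_nat N) \<longlonglongrightarrow> integral\<^sup>L haar f1"
    "continuous_on UNIV f2" "\<forall>v. f2 (to_torus v) = h v"
    "(\<lambda>N. (\<Sum>n<N. h (x n)) / of_nat N) \<longlonglongrightarrow> integral\<^sup>L haar f2" by blast
  have "(\<lambda>N. (\<Sum>n<N. g (x n)) / of_nat N + (\<Sum>n<N. h (x n)) / of_nat N) \<longlonglongrightarrow> integral\<^sup>L haar f1 + integral\<^sup>L haar f2"
    using f by (intro tendsto_add)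
  then show ?case using f
    by (intro exI[of _ "\<lambda>y. f1 y + f2 y"])
     (auto simp: sum.distrib add_divide_distrib integrable_haar_continuous intro!: continuous_intros)
qed

text \<open>Weyl's criterion: replacing \<open>f\<close> by a uniformly close trigonometric
  polynomial moves both the averages and the integral by at most \<open>e / 3\<close>.\<close>

lemma Eq_weyl_criterion:
  fixes v :: "real ^ 'n"
  assumes "\<And>k. k \<in> int_lattice \<Longrightarrow> k \<noteq> 0 \<Longrightarrow>
      (\<lambda>N. (\<Sum>n<N. torus_char k (((*v) (map_matrix real_of_int A) ^^ n) v)) / of_nat N) \<longlonglongrightarrow> 0"
  shows "to_torus v \<in> Eq A"
  unfolding Eq_def
proof (intro CollectI allI impI)
  fix f :: "'n torus \<Rightarrow> real" assume f: "continuous_on UNIV f"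
  define x where "x n = ((*v) (map_matrix real_of_int A) ^^ n) v" for n
  define avg where "avg g N = (\<Sum>n<N. g (to_torus (x n))) / real N" for g :: "'n torus \<Rightarrow> real" and N
  interpret prob_space "haar :: 'n torus measure" by (rule haar_prob_space)
  have "avg f \<longlonglongrightarrow> integral\<^sup>L haar f"
  proof (rule LIMSEQ_I)
    fix e :: real assume e: "e > 0"
    obtain g where g: "continuous_on UNIV g" "trig_poly (\<lambda>v. of_real (g (to_torus v)))"
      "\<And>x. \<bar>f x - g x\<bar> < e / 3"
      using trig_poly_dense[OF f, of "e / 3"] e by auto
    obtain h :: "'n torus \<Rightarrow> complex" where h: "\<forall>v. h (to_torus v) = of_real (g (to_torus v))"
      "(\<lambda>N. (\<Sum>n<N. of_real (g (to_torus (x n)))) / of_nat N) \<longlonglongrightarrow> integral\<^sup>L haar h"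
      using trig_poly_equidistribution[OF g(2), of x] assms unfolding x_def by blast
    have "h = (\<lambda>y. of_real (g y))"
    proof
      fix y show "h y = of_real (g y)" using h(1) by (cases y rule: to_torus_cases) simp
    qed
    then have "(\<lambda>N. complex_of_real (avg g N)) \<longlonglongrightarrow> of_real (integral\<^sup>L haar g)"
      using h(2) by (simp add: avg_def)
    then have "avg g \<longlonglongrightarrow> integral\<^sup>L haar g" by (simp add: tendsto_of_real_iff)
    then obtain N0 where N0: "\<And>N. N \<ge> N0 \<Longrightarrow> norm (avg g N - integral\<^sup>L haar g) < e / 3"
      using LIMSEQ_D[of "avg g" _ "e / 3"] e by auto
    have "norm (avg f N - integral\<^sup>L haar f) < e" if "N \<ge> N0" for N
    proof -
      have "\<bar>avg f N - avg g N\<bar> \<le> e / 3"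
      proof (cases "N = 0")
        case False
        have "\<bar>avg f N - avg g N\<bar> = \<bar>\<Sum>n<N. f (to_torus (x n)) - g (to_torus (x n))\<bar> / N"
          by (simp add: avg_def sum_subtractf flip: diff_divide_distrib)
        also have "\<dots> \<le> (\<Sum>n<N. e / 3) / N"
          using g(3) by (intro divide_right_mono order_trans[OF sum_abs] sum_mono) (auto intro: less_imp_le)
        finally show ?thesis using False by simp
      qed (use e in \<open>simp add: avg_def\<close>)
      moreover have "\<bar>integral\<^sup>L haar f - integral\<^sup>L haar g\<bar> \<le> e / 3"
      proof -
        have "\<bar>integral\<^sup>L haar f - integral\<^sup>L haar g\<bar> = \<bar>\<integral>y. f y - g y \<partial>haar\<bar>"
          using f g by (simp add: integrable_haar_continuous)
        also have "\<dots> \<le> (\<integral>y. \<bar>f y - g y\<bar> \<partial>haar)" by (rule integral_abs_bound)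
        also have "\<dots> \<le> (\<integral>y. e / 3 \<partial>(haar :: 'n torus measure))"
          using f g by (intro integral_mono integrable_abs Bochner_Integration.integrable_diff
              integrable_haar_continuous) (auto intro: less_imp_le)
        finally show ?thesis by (simp add: measure_haar_UNIV)
      qed
      ultimately show ?thesis using N0[OF that] unfolding real_norm_def by linarith
    qed
    then show "\<exists>N0. \<forall>N\<ge>N0. norm (avg f N - integral\<^sup>L haar f) < e" by blast
  qed
  then show "(\<lambda>N. (\<Sum>n<N. f ((toral_map A ^^ n) (to_torus v))) / real N) \<longlonglongrightarrow> integral\<^sup>L haar f"
    by (simp add: avg_def[abs_def] x_def toral_map_funpow_to_torus)
qed

section \<open>A strong law of large numbers\<close>

text \<open>Beyond the last square \<open>k ^ 2\<close> below \<open>N\<close> there are at most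
  \<open>2 * k\<close> further terms of norm at most 1, which change the average by at most
  \<open>2 / k\<close>.\<close>

lemma cesaro_tendsto_0_of_squares:
  fixes z :: "nat \<Rightarrow> 'a::real_normed_field"
  assumes z: "\<And>n. norm (z n) \<le> 1"
    and lim: "(\<lambda>j. (\<Sum>n<(Suc j)\<^sup>2. z n) / of_nat ((Suc j)\<^sup>2)) \<longlonglongrightarrow> 0"
  shows "(\<lambda>N. (\<Sum>n<N. z n) / of_nat N) \<longlonglongrightarrow> 0"
proof -
  define S where "S N = (\<Sum>n<N. z n)" for N
  define j where "j N = nat \<lfloor>sqrt (real N)\<rfloor>" for N
  have j_lim: "filterlim j at_top sequentially"
    unfolding j_def
    by (intro filterlim_compose[OF filterlim_nat_sequentially]
        filterlim_compose[OF filterlim_floor_sequentially]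
        filterlim_compose[OF sqrt_at_top] filterlim_real_sequentially)
  have lim0: "(\<lambda>k. S (k\<^sup>2) / of_nat (k\<^sup>2)) \<longlonglongrightarrow> 0"
    by (subst filterlim_sequentially_Suc[symmetric]) (use lim in \<open>simp add: S_def\<close>)
  have "(\<lambda>N. norm (S ((j N)\<^sup>2) / of_nat ((j N)\<^sup>2)) + 2 / real (j N)) \<longlonglongrightarrow> 0 + 0"
    by (intro tendsto_add tendsto_norm_zero filterlim_compose[OF lim0 j_lim]
        filterlim_compose[OF lim_const_over_n j_lim])
  then have *: "(\<lambda>N. norm (S ((j N)\<^sup>2) / of_nat ((j N)\<^sup>2)) + 2 / real (j N)) \<longlonglongrightarrow> 0" by simp
  show ?thesis
  proof (rule Lim_null_comparison[OF _ *])
    show "\<forall>\<^sub>F N in sequentially. norm ((\<Sum>n<N. z n) / of_nat N)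
        \<le> norm (S ((j N)\<^sup>2) / of_nat ((j N)\<^sup>2)) + 2 / real (j N)"
      using eventually_ge_at_top[of 1]
    proof eventually_elim
      case (elim N)
      let ?k = "j N"
      have "sqrt (real N) \<ge> 1" using elim by simp
      then have k1: "real ?k \<le> sqrt (real N)" "sqrt (real N) < real ?k + 1" "?k \<ge> 1"
        unfolding j_def by linarith+
      have "(real ?k)\<^sup>2 \<le> real N" using k1(1) power_mono[OF k1(1), of 2] by simp
      then have kN: "?k\<^sup>2 \<le> N" by (metis of_nat_le_iff of_nat_power)
      have "real N < (real ?k + 1)\<^sup>2"
        using k1(2) power_strict_mono[OF k1(2), of 2] by simp
      then have "real N < real ((?k + 1)\<^sup>2)" by (simp add: add.commute)
      then have "N < (?k + 1)\<^sup>2" by (simp only: of_nat_less_iff)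
      then have Nk: "N - ?k\<^sup>2 \<le> 2 * ?k" by (simp add: power2_eq_square)
      have "norm (S N) \<le> norm (S (?k\<^sup>2)) + norm (\<Sum>n=?k\<^sup>2..<N. z n)"
      proof -
        have "S N = S (?k\<^sup>2) + (\<Sum>n=?k\<^sup>2..<N. z n)"
          unfolding S_def using kN by (simp add: lessThan_atLeast0 sum.atLeastLessThan_concat)
        then show ?thesis by (simp add: norm_triangle_ineq)
      qed
      also have "norm (\<Sum>n=?k\<^sup>2..<N. z n) \<le> real (N - ?k\<^sup>2)"
        using sum_norm_bound[of "{?k\<^sup>2..<N}" z 1] z by simp
      also have "\<dots> \<le> 2 * real ?k" using Nk by linarith
      finally have "norm (S N) / real N \<le> (norm (S (?k\<^sup>2)) + 2 * real ?k) / real N"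
        by (intro divide_right_mono) auto
      also have "\<dots> \<le> (norm (S (?k\<^sup>2)) + 2 * real ?k) / real (?k\<^sup>2)"
        using kN k1 elim by (intro divide_left_mono) (auto intro!: mult_pos_pos simp del: of_nat_power)
      also have "\<dots> = norm (S (?k\<^sup>2)) / real (?k\<^sup>2) + 2 / real ?k"
        using k1 by (simp add: add_divide_distrib power2_eq_square)
      finally show ?case by (simp add: S_def norm_divide norm_power)
    qed
  qed
qed

text \<open>Expanding the square and using the row sums of \<open>a\<close>, the second moment of
  the average over \<open>N\<close> terms is at most \<open>C / N\<close>. Along
  \<open>N = j ^ 2\<close> this is summable, so the averages tend to 0 almost surely there, and
  boundedness of the terms fills the gaps between squares.\<close>

lemma (in prob_space) AE_cesaro_tendsto_0:
  fixes f :: "nat \<Rightarrow> 'a \<Rightarrow> complex"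
  assumes m [measurable]: "\<And>n. f n \<in> borel_measurable M"
    and f: "\<And>n x. cmod (f n x) \<le> 1"
    and a: "\<And>n m. cmod (\<integral>x. f n x * cnj (f m x) \<partial>M) \<le> a n m"
    and C: "\<And>n N. (\<Sum>m<N. a n m) \<le> C"
  shows "AE x in M. (\<lambda>N. (\<Sum>n<N. f n x) / of_nat N) \<longlonglongrightarrow> 0"
proof -
  define S where "S N x = (\<Sum>n<N. f n x)" for N x
  have S [measurable]: "S N \<in> borel_measurable M" for N unfolding S_def by measurable
  have Sle: "cmod (S N x) \<le> N" for N x
    unfolding S_def using sum_norm_bound[of "{..<N}" "\<lambda>n. f n x" 1] f by simp
  have [measurable]: "cnj \<in> borel_measurable borel"
    by (intro borel_measurable_continuous_onI continuous_intros)
  have int: "integrable M (\<lambda>x. f n x * cnj (f m x))" for n m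
    using f by (intro integrable_const_bound[of _ 1]) (auto simp: norm_mult mult_le_one)
  have intS: "integrable M (\<lambda>x. (cmod (S N x))\<^sup>2)" for N
    using Sle by (intro integrable_const_bound[of _ "(real N)\<^sup>2"]) (auto intro!: power_mono)
  have S2: "(\<integral>x. (cmod (S N x))\<^sup>2 \<partial>M) \<le> real N * C" for N
  proof -
    have "complex_of_real (\<integral>x. (cmod (S N x))\<^sup>2 \<partial>M) = (\<integral>x. complex_of_real ((cmod (S N x))\<^sup>2) \<partial>M)"
      by (rule integral_complex_of_real[symmetric])
    also have "\<dots> = (\<integral>x. (\<Sum>n<N. \<Sum>m<N. f n x * cnj (f m x)) \<partial>M)"
      by (intro Bochner_Integration.integral_cong refl)
        (simp only: complex_norm_square, simp add: S_def sum_product)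
    also have "\<dots> = (\<Sum>n<N. \<Sum>m<N. (\<integral>x. f n x * cnj (f m x) \<partial>M))"
      using int by simp
    finally have "cmod (complex_of_real (\<integral>x. (cmod (S N x))\<^sup>2 \<partial>M)) \<le> (\<Sum>n<N. \<Sum>m<N. a n m)"
      using a by (auto intro!: order_trans[OF norm_sum] sum_mono)
    also have "\<dots> \<le> (\<Sum>n<N. C)" by (intro sum_mono C)
    finally show ?thesis by simp
  qed
  have C0: "C \<ge> 0" using C[of 0 0] by simp
  define g where "g j x = (cmod (S ((Suc j)\<^sup>2) x / of_nat ((Suc j)\<^sup>2)))\<^sup>2" for j x
  have g [measurable]: "g j \<in> borel_measurable M" for j unfolding g_def by measurable
  \<comment> \<open>A series of nonnegative functions with finite total integral converges almost
    everywhere, hence its terms tend to 0; this takes the place of Borel-Cantelli.\<close>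
  have "(\<integral>\<^sup>+x. (\<Sum>j. ennreal (g j x)) \<partial>M) = (\<Sum>j. \<integral>\<^sup>+x. ennreal (g j x) \<partial>M)"
    by (rule nn_integral_suminf) measurable
  also have "\<dots> \<le> (\<Sum>j. ennreal (C * (1 / (real (Suc j))\<^sup>2)))"
  proof (intro suminf_le summableI)
    fix j
    let ?k = "real (Suc j)"
    have "(\<integral>\<^sup>+x. ennreal (g j x) \<partial>M) = ennreal (\<integral>x. g j x \<partial>M)"
      unfolding g_def norm_divide power_divide
      by (intro nn_integral_eq_integral integrable_divide intS) auto
    also have "(\<integral>x. g j x \<partial>M) = (\<integral>x. (cmod (S ((Suc j)\<^sup>2) x))\<^sup>2 \<partial>M) / (?k\<^sup>2)\<^sup>2"
      unfolding g_def norm_divide power_divide by (simp del: of_nat_Suc add: norm_power)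
    also have "\<dots> \<le> (?k\<^sup>2 * C) / (?k\<^sup>2)\<^sup>2"
      using S2[of "(Suc j)\<^sup>2"] by (intro divide_right_mono) (auto simp del: of_nat_Suc)
    also have "\<dots> = C * (1 / ?k\<^sup>2)" by (simp add: power2_eq_square del: of_nat_Suc)
    finally show "(\<integral>\<^sup>+x. ennreal (g j x) \<partial>M) \<le> ennreal (C * (1 / ?k\<^sup>2))"
      by (simp add: ennreal_leI)
  qed
  also have "\<dots> = ennreal (\<Sum>j. C * (1 / (real (Suc j))\<^sup>2))"
    using C0 inverse_squares_sums by (intro suminf_ennreal2 summable_mult) (auto simp: sums_iff)
  also have "\<dots> < \<infinity>" by simp
  finally have "AE x in M. (\<Sum>j. ennreal (g j x)) \<noteq> \<infinity>"
    by (intro nn_integral_PInf_AE) auto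
  then show ?thesis
  proof eventually_elim
    case (elim x)
    have "summable (\<lambda>j. g j x)"
      using elim by (intro summable_suminf_not_top) (auto simp: g_def)
    then have "(\<lambda>j. g j x) \<longlonglongrightarrow> 0" by (rule summable_LIMSEQ_zero)
    then have "(\<lambda>j. sqrt (g j x)) \<longlonglongrightarrow> sqrt 0" by (rule tendsto_real_sqrt)
    then have "(\<lambda>j. S ((Suc j)\<^sup>2) x / of_nat ((Suc j)\<^sup>2)) \<longlonglongrightarrow> 0"
      unfolding g_def by (subst tendsto_norm_zero_iff[symmetric]) simp
    then show ?case using f unfolding S_def by (intro cesaro_tendsto_0_of_squares) auto
  qed
qed

section \<open>Bounded and periodic orbits of toral endomorphisms\<close>

abbreviation real_matrix :: "int ^ 'n ^ 'n \<Rightarrow> real ^ 'n ^ 'n" where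
  "real_matrix A \<equiv> map_matrix real_of_int A"

definition bounded_orbits :: "real ^ 'n ^ 'n \<Rightarrow> (real ^ 'n) set" where
  "bounded_orbits M = {v. bounded (range (\<lambda>n. ((*v) M ^^ n) v))}"

lemma mat_vector_mult: "mat c *v v = c *s (v :: 'a::comm_ring_1 ^ 'n)"
  by (simp add: vec_eq_iff matrix_vector_mult_def mat_def if_distrib[of "\<lambda>x. x * _"] sum.delta cong: if_cong)

lemma funpow_matrix_add: "((*v) (M :: 'a::field ^ 'n ^ 'n) ^^ n) (v + w) = ((*v) M ^^ n) v + ((*v) M ^^ n) w"
  by (induction n) (auto simp: matrix_vector_right_distrib)

lemma funpow_matrix_smult: "((*v) (M :: 'a::field ^ 'n ^ 'n) ^^ n) (c *s v) = c *s ((*v) M ^^ n) v"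
  by (induction n) (auto simp: vector_scalar_commute)

lemma funpow_matrix_scaleR: "((*v) (M :: real ^ 'n ^ 'n) ^^ n) (c *\<^sub>R v) = c *\<^sub>R ((*v) M ^^ n) v"
  using funpow_matrix_smult[of n M c v] by (simp add: scalar_mult_eq_scaleR)

lemma funpow_matrix_diff: "((*v) (M :: 'a::field ^ 'n ^ 'n) ^^ n) (v - w) = ((*v) M ^^ n) v - ((*v) M ^^ n) w"
  by (induction n) (auto simp: matrix_vector_mult_diff_distrib)

lemma funpow_matrix_0 [simp]: "((*v) (M :: 'a::field ^ 'n ^ 'n) ^^ n) 0 = 0"
  by (induction n) auto

lemma subspace_bounded_orbits: "subspace (bounded_orbits M)"
  unfolding subspace_def bounded_orbits_def mem_Collect_eq
proof (intro conjI ballI allI impI)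
  fix v w assume "v \<in> {v. bounded (range (\<lambda>n. ((*v) M ^^ n) v))}" "w \<in> {v. bounded (range (\<lambda>n. ((*v) M ^^ n) v))}"
  then obtain a b where "\<And>n. norm (((*v) M ^^ n) v) \<le> a" "\<And>n. norm (((*v) M ^^ n) w) \<le> b"
    by (auto simp: bounded_iff)
  then have "norm (((*v) M ^^ n) (v + w)) \<le> a + b" for n
    unfolding funpow_matrix_add by (intro norm_triangle_le add_mono)
  then show "bounded (range (\<lambda>n. ((*v) M ^^ n) (v + w)))" by (auto simp: bounded_iff)
next
  fix c v assume "v \<in> {v. bounded (range (\<lambda>n. ((*v) M ^^ n) v))}"
  then show "bounded (range (\<lambda>n. ((*v) M ^^ n) (c *\<^sub>R v)))"
    unfolding funpow_matrix_scaleR using bounded_scaling[of "range (\<lambda>n. ((*v) M ^^ n) v)" c]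
    by (simp add: image_image)
qed simp

text \<open>Stated by coordinates, on which the complex scaling \<open>*s\<close> acts directly; the
  real norm bound is recovered in \<open>bounded_orbits_of_complex\<close>.\<close>

definition bounded_orbits_complex :: "complex ^ 'n ^ 'n \<Rightarrow> (complex ^ 'n) set" where
  "bounded_orbits_complex M = {v. \<exists>C. \<forall>n i. cmod (((*v) M ^^ n) v $ i) \<le> C}"

lemma subspace_bounded_orbits_complex: "vec.subspace (bounded_orbits_complex M)"
  unfolding vec.subspace_def bounded_orbits_complex_def mem_Collect_eq
proof (intro conjI ballI allI)
  fix v w assume "v \<in> {v. \<exists>C. \<forall>n i. cmod (((*v) M ^^ n) v $ i) \<le> C}"
    "w \<in> {v. \<exists>C. \<forall>n i. cmod (((*v) M ^^ n) v $ i) \<le> C}"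
  then obtain a b where "\<And>n i. cmod (((*v) M ^^ n) v $ i) \<le> a" "\<And>n i. cmod (((*v) M ^^ n) w $ i) \<le> b"
    by auto
  then have "cmod (((*v) M ^^ n) (v + w) $ i) \<le> a + b" for n i
    unfolding funpow_matrix_add vector_add_component by (intro norm_triangle_le add_mono)
  then show "\<exists>C. \<forall>n i. cmod (((*v) M ^^ n) (v + w) $ i) \<le> C" by blast
next
  fix c v assume "v \<in> {v. \<exists>C. \<forall>n i. cmod (((*v) M ^^ n) v $ i) \<le> C}"
  then obtain a where "\<And>n i. cmod (((*v) M ^^ n) v $ i) \<le> a" by auto
  then have "cmod (((*v) M ^^ n) (c *s v) $ i) \<le> cmod c * a" for n i
    unfolding funpow_matrix_smult by (simp add: norm_mult mult_left_mono)
  then show "\<exists>C. \<forall>n i. cmod (((*v) M ^^ n) (c *s v) $ i) \<le> C" by blast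
qed (auto intro: exI[of _ 0])

lemma complex_vector_matrix_mult:
  "complex_matrix A *v complex_vector v = complex_vector (real_matrix A *v v)"
  by (simp add: complex_matrix_def complex_vector_def matrix_vector_mult_def vec_eq_iff map_matrix_def)

lemma complex_vector_funpow:
  "((*v) (complex_matrix A) ^^ n) (complex_vector v) = complex_vector (((*v) (real_matrix A) ^^ n) v)"
  by (induction n) (auto simp: complex_vector_matrix_mult)

text \<open>Induction on the nilpotency index. The vector \<open>w = f v\<close> has smaller index,
  hence a bounded orbit, and \<open>M *v v = c *s v + w\<close> makes the orbit of \<open>v\<close>
  obey an affine recursion with factor \<open>cmod c < 1\<close>.\<close>

lemma gen_eigenspace_bounded_orbits:
  assumes "v \<in> gen_eigenspace A c" "cmod c < 1"
  shows "v \<in> bounded_orbits_complex (complex_matrix A)"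
proof -
  define M where "M = complex_matrix A"
  define f where "f = (\<lambda>w. (M - mat c) *v w)"
  have "v \<in> bounded_orbits_complex M" if "(f ^^ j) v = 0" for j v
    using that
  proof (induction j arbitrary: v)
    case 0
    then show ?case by (auto simp: bounded_orbits_complex_def intro: exI[of _ 0])
  next
    case (Suc j)
    define w where "w = f v"
    have "(f ^^ j) w = 0" using Suc.prems by (simp add: w_def funpow_swap1)
    then have "w \<in> bounded_orbits_complex M" by (rule Suc.IH)
    then obtain C where C: "\<And>n i. cmod (((*v) M ^^ n) w $ i) \<le> C"
      by (auto simp: bounded_orbits_complex_def)
    have Mv: "M *v v = c *s v + w"
      by (simp add: w_def f_def matrix_vector_mult_diff_rdistrib mat_vector_mult)
    \<comment> \<open>The first summand covers the initial vector; the second is the fixed point of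
      x -> \<open>cmod c\<close> x + \<open>C\<close>, above which that map does not increase a
      bound.\<close>
    define B where "B = Max (insert 0 (range (\<lambda>i. cmod (v $ i)))) + C / (1 - cmod c)"
    have C0: "C \<ge> 0" using C[of 0 undefined] norm_ge_zero order_trans by blast
    have v: "cmod (v $ i) \<le> B" for i
    proof -
      have "cmod (v $ i) \<le> Max (insert 0 (range (\<lambda>i. cmod (v $ i))))" by (intro Max_ge) auto
      then show ?thesis using C0 assms(2) by (simp add: B_def add_increasing2)
    qed
    have B: "cmod c * B + C \<le> B"
    proof -
      have "C / (1 - cmod c) \<le> B" unfolding B_def by simp
      then show ?thesis using assms(2) by (simp add: field_simps)
    qed
    have "cmod (((*v) M ^^ n) v $ i) \<le> B" for n i
    proof (induction n)
      case (Suc n)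
      have "((*v) M ^^ Suc n) v = ((*v) M ^^ n) (M *v v)" by (simp add: funpow_swap1)
      also have "\<dots> = c *s ((*v) M ^^ n) v + ((*v) M ^^ n) w"
        by (simp only: Mv funpow_matrix_add funpow_matrix_smult)
      finally have "cmod (((*v) M ^^ Suc n) v $ i) \<le> cmod c * cmod (((*v) M ^^ n) v $ i) + C"
        using C[of n i] by (simp del: funpow.simps add: norm_mult norm_triangle_le)
      also have "\<dots> \<le> cmod c * B + C" using Suc by (intro add_right_mono mult_left_mono) auto
      finally show ?case using B by linarith
    qed (use v in simp)
    then show ?case by (auto simp: bounded_orbits_complex_def)
  qed
  then show ?thesis using assms(1) unfolding gen_eigenspace_def f_def M_def by blast
qed

lemma eigenspace_bounded_orbits:
  assumes "v \<in> eigenspace A c" "cmod c = 1"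
  shows "v \<in> bounded_orbits_complex (complex_matrix A)"
proof -
  have "complex_matrix A *v v = c *s v"
    using assms(1) by (simp add: eigenspace_def matrix_vector_mult_diff_rdistrib mat_vector_mult)
  then have "((*v) (complex_matrix A) ^^ n) v = c ^ n *s v" for n
    by (induction n) (auto simp: vector_scalar_commute vector_smult_assoc mult_ac)
  then have "cmod (((*v) (complex_matrix A) ^^ n) v $ i) \<le> Max (range (\<lambda>i. cmod (v $ i)))" for n i
    using assms(2) by (auto simp: norm_mult norm_power)
  then show ?thesis by (auto simp: bounded_orbits_complex_def)
qed

lemma bounded_orbits_of_complex:
  assumes "complex_vector v \<in> bounded_orbits_complex (complex_matrix A)"
  shows "v \<in> bounded_orbits (real_matrix A)"
proof -
  obtain C where C: "\<And>n i. cmod (complex_vector (((*v) (real_matrix A) ^^ n) v) $ i) \<le> C"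
    using assms by (auto simp: bounded_orbits_complex_def complex_vector_funpow)
  have "norm (((*v) (real_matrix A) ^^ n) v) \<le> real CARD('a) * C" for n
  proof -
    have "norm (((*v) (real_matrix A) ^^ n) v) \<le> (\<Sum>i\<in>UNIV. \<bar>((*v) (real_matrix A) ^^ n) v $ i\<bar>)"
      by (rule norm_le_l1_cart)
    also have "\<dots> \<le> (\<Sum>i\<in>(UNIV :: 'a set). C)"
      using C by (intro sum_mono) (simp add: complex_vector_def)
    finally show ?thesis by simp
  qed
  then show ?thesis by (auto simp: bounded_orbits_def bounded_iff)
qed

lemma contracted_space_subset: "contracted_space A \<subseteq> bounded_orbits (real_matrix A)"
proof
  fix v assume "v \<in> contracted_space A"
  then have "complex_vector v \<in> vec.span (\<Union>c\<in>{c. cmod c < 1}. gen_eigenspace A c)"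
    by (simp add: contracted_space_def)
  also have "\<dots> \<subseteq> bounded_orbits_complex (complex_matrix A)"
    by (rule vec.span_minimal[OF _ subspace_bounded_orbits_complex])
      (auto intro: gen_eigenspace_bounded_orbits)
  finally show "v \<in> bounded_orbits (real_matrix A)" by (rule bounded_orbits_of_complex)
qed

lemma unimodular_eigenspaces_subset: "unimodular_eigenspaces A \<subseteq> bounded_orbits (real_matrix A)"
proof
  fix v assume "v \<in> unimodular_eigenspaces A"
  then have "complex_vector v \<in> vec.span (\<Union>c\<in>{c. cmod c = 1}. eigenspace A c)"
    by (simp add: unimodular_eigenspaces_def)
  also have "\<dots> \<subseteq> bounded_orbits_complex (complex_matrix A)"
    by (rule vec.span_minimal[OF _ subspace_bounded_orbits_complex])
      (auto intro: eigenspace_bounded_orbits)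
  finally show "v \<in> bounded_orbits (real_matrix A)" by (rule bounded_orbits_of_complex)
qed

lemma subspace_sum_bounded_orbits:
  "subspace_sum (contracted_space A) (unimodular_eigenspaces A) \<subseteq> bounded_orbits (real_matrix A)"
  unfolding subspace_sum_def
  using contracted_space_subset unimodular_eigenspaces_subset
    subspace_add[OF subspace_bounded_orbits] by blast

text \<open>A discrete Fourier transform over the period: \<open>w j\<close> is the component of the
  periodic orbit belonging to the eigenvalue \<open>\<zeta> ^ j\<close>. The eigenvector equation is
  a cyclic shift of the sum, whose boundary terms cancel by periodicity.\<close>

lemma root_of_unity_eigenvector:
  fixes M :: "complex ^ 'n ^ 'n"
  assumes p: "p > 0" and v: "v \<noteq> 0" "((*v) M ^^ p) v = v"
  obtains z w where "z ^ p = 1" "w \<noteq> 0" "M *v w = z *s w"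
proof -
  define \<zeta> where "\<zeta> = cis (2 * pi / p)"
  have \<zeta>: "\<zeta> ^ p = 1" unfolding \<zeta>_def Complex.DeMoivre using p by simp
  define F where "F i = ((*v) M ^^ i) v" for i
  have F: "M *v F i = F (Suc i)" for i by (simp add: F_def)
  define w where "w j = (\<Sum>i<p. (inverse \<zeta> ^ j) ^ i *s F i)" for j
  have w: "M *v w j = (\<zeta> ^ j) *s w j" for j
  proof -
    define u where "u = inverse \<zeta> ^ j"
    have u: "u ^ p = 1" unfolding u_def by (metis \<zeta> inverse_1 power_inverse power_mult power_one mult.commute)
    have u0: "u \<noteq> 0" "\<zeta> ^ j = inverse u"
      unfolding u_def by (simp add: \<zeta>_def) (simp add: power_inverse)
    have "u *s (M *v w j) = (\<Sum>i<p. u ^ Suc i *s F (Suc i))"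
      unfolding w_def u_def[symmetric]
      by (simp add: vec.linear_sum[OF matrix_vector_mul_linear_gen] vector_scalar_commute F
          vec.scale_sum_right vector_smult_assoc)
    also have "\<dots> = (\<Sum>i<p. u ^ i *s F i) + u ^ p *s F p - u ^ 0 *s F 0"
      using sum.lessThan_Suc_shift[of "\<lambda>i. u ^ i *s F i" p] sum.lessThan_Suc[of "\<lambda>i. u ^ i *s F i" p]
      by (simp add: algebra_simps)
    also have "\<dots> = w j" using v(2) u by (simp add: w_def u_def[symmetric] F_def)
    finally have "inverse u *s (u *s (M *v w j)) = inverse u *s w j" by simp
    then show ?thesis using u0 by (simp add: vector_smult_assoc)
  qed
  \<comment> \<open>Fourier inversion: the components add up to \<open>p\<close> times
    \<open>v\<close>, so they cannot all vanish.\<close>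
  have "(\<Sum>j<p. w j) = (\<Sum>i<p. (\<Sum>j<p. (inverse \<zeta> ^ i) ^ j) *s F i)"
    unfolding w_def vec.scale_sum_left
    by (subst sum.swap) (simp add: power_mult[symmetric] mult.commute)
  also have "\<dots> = (\<Sum>i<p. (if i = 0 then of_nat p else 0) *s F i)"
  proof (intro sum.cong refl arg_cong2[where f = "(*s)"])
    fix i assume i: "i \<in> {..<p}"
    show "(\<Sum>j<p. (inverse \<zeta> ^ i) ^ j) = (if i = 0 then of_nat p else 0)"
    proof (cases "i = 0")
      case False
      have "inverse \<zeta> ^ i \<noteq> 1"
      proof
        assume "inverse \<zeta> ^ i = 1"
        then have "\<zeta> ^ i = 1" by (metis inverse_inverse_eq inverse_1 power_inverse)
        then have "cis (real i * (2 * pi / p)) = 1" by (simp only: \<zeta>_def Complex.DeMoivre)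
        then have "cos (real i * (2 * pi / p)) = 1" by (simp add: complex_eq_iff)
        then obtain m :: int where "real i * (2 * pi / p) = of_int m * 2 * pi"
          using cos_one_2pi_int by blast
        then have "real i = real_of_int m * p" using p by (simp add: field_simps)
        then have "int i = m * int p" by (metis of_int_eq_iff of_int_mult of_int_of_nat_eq)
        then have "int p dvd int i" by simp
        then show False using i False by (auto dest: dvd_imp_le)
      qed
      moreover have "(inverse \<zeta> ^ i) ^ p = 1"
        by (metis \<zeta> inverse_1 power_inverse power_mult power_one mult.commute)
      ultimately show ?thesis using False by (simp add: geometric_sum)
    qed simp
  qed
  also have "\<dots> = of_nat p *s v" using p
    by (simp add: if_distrib[of "\<lambda>c. c *s _"] sum.delta F_def cong: if_cong)
  finally have "(\<Sum>j<p. w j) \<noteq> 0" using p v(1) by simp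
  then obtain j where "w j \<noteq> 0" by (metis sum.neutral)
  moreover have "(\<zeta> ^ j) ^ p = 1" by (metis \<zeta> power_mult power_one mult.commute)
  ultimately show ?thesis using w that by blast
qed

lemma eigenvalue_transpose:
  fixes M :: "complex ^ 'n ^ 'n"
  assumes "v \<noteq> 0" "transpose M *v v = z *s v"
  obtains w where "w \<noteq> 0" "M *v w = z *s w"
proof -
  have "(transpose M - mat z) *v v = 0"
    using assms(2) by (simp add: matrix_vector_mult_diff_rdistrib mat_vector_mult)
  then have "\<not> invertible (transpose M - mat z)"
    using assms(1) by (metis invertible_def matrix_left_invertible_ker)
  moreover have "transpose M - mat z = transpose (M - mat z)"
    by (simp add: transpose_def vec_eq_iff mat_def)
  ultimately have "det (M - mat z) = 0" by (metis det_transpose invertible_det_nz)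
  then have "\<not> invertible (M - mat z)" by (simp add: invertible_det_nz)
  then obtain w where "w \<noteq> 0" "(M - mat z) *v w = 0"
    by (metis invertible_left_inverse matrix_left_invertible_ker)
  then show ?thesis using that by (simp add: matrix_vector_mult_diff_rdistrib mat_vector_mult)
qed

lemma inj_real_matrix:
  assumes "det A \<noteq> 0" shows "inj ((*v) (real_matrix A))"
proof -
  have "det (real_matrix A) = real_of_int (det A)"
    by (simp add: det_def map_matrix_def)
  then have "invertible (real_matrix A)" using assms by (simp add: invertible_det_nz)
  then show ?thesis
    by (metis invertible_left_inverse matrix_left_invertible_injective inj_def)
qed

text \<open>Two equal orbit terms cancel down to \<open>(f ^^ p) k = k\<close>, since
  \<open>f\<close> is injective. A nonzero periodic vector produces an eigenvalue that is a root of
  unity, first of the transpose and then of \<open>A\<close>, against quasihyperbolicity.\<close>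

lemma inj_orbit_transpose:
  assumes A: "det A \<noteq> 0" "quasihyperbolic A" and k: "k \<noteq> 0"
  shows "inj (\<lambda>n. ((*v) (real_matrix (transpose A)) ^^ n) k)"
proof -
  define f where "f = (*v) (real_matrix (transpose A))"
  have inj: "inj (f ^^ n)" for n
    unfolding f_def using A by (intro inj_fn inj_real_matrix) (simp add: det_transpose)
  have "(f ^^ n) k \<noteq> (f ^^ m) k" if "n < m" for n m
  proof
    assume eq: "(f ^^ n) k = (f ^^ m) k"
    define p where "p = m - n"
    have p: "p > 0" "m = n + p" using that by (auto simp: p_def)
    have "(f ^^ n) k = (f ^^ n) ((f ^^ p) k)" using eq p by (simp add: funpow_add)
    then have "(f ^^ p) k = k" using inj[of n] by (metis injD)
    then have "((*v) (complex_matrix (transpose A)) ^^ p) (complex_vector k) = complex_vector k"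
      by (simp add: complex_vector_funpow f_def)
    moreover have "complex_vector k \<noteq> 0" using k by (auto simp: complex_vector_def vec_eq_iff)
    ultimately obtain z w where z: "z ^ p = 1" "w \<noteq> 0" "complex_matrix (transpose A) *v w = z *s w"
      using root_of_unity_eigenvector p(1) by metis
    have "complex_matrix (transpose A) = transpose (complex_matrix A)"
      by (simp add: complex_matrix_def transpose_def map_matrix_def vec_eq_iff)
    then obtain u where "u \<noteq> 0" "complex_matrix A *v u = z *s u"
      using eigenvalue_transpose z by metis
    then have "is_eigenvalue A z" by (auto simp: is_eigenvalue_def)
    then show False using A(2) z(1) p(1) by (auto simp: quasihyperbolic_def)
  qed
  then show ?thesis unfolding f_def by (intro injI) (metis nat_neq_iff)
qed

section \<open>Duality with the transpose and a criterion for nondense orbits\<close>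

lemma norm_funpow_matrix_le:
  fixes M :: "real ^ 'n ^ 'n"
  obtains B where "B \<ge> 1" "\<And>n v. norm (((*v) M ^^ n) v) \<le> B ^ n * norm v"
proof -
  obtain B0 where B0: "\<And>v. norm (M *v v) \<le> B0 * norm v"
    using linear_bounded[of "(*v) M"] by auto
  define B where "B = max 1 B0"
  have B: "norm (M *v v) \<le> B * norm v" for v
    by (rule order_trans[OF B0]) (auto simp: B_def intro!: mult_right_mono)
  have "norm (((*v) M ^^ n) v) \<le> B ^ n * norm v" for n v
  proof (induction n)
    case (Suc n)
    have "norm (((*v) M ^^ Suc n) v) \<le> B * norm (((*v) M ^^ n) v)" using B by simp
    also have "\<dots> \<le> B * (B ^ n * norm v)" using Suc by (intro mult_left_mono) (auto simp: B_def)
    finally show ?case by (simp add: mult_ac)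
  qed simp
  then show ?thesis using that[of B] by (auto simp: B_def)
qed

lemma real_matrix_transpose: "real_matrix (transpose A) = transpose (real_matrix A)"
  by (simp add: transpose_def map_matrix_def vec_eq_iff)

lemma inner_funpow_transpose:
  "((*v) (real_matrix (transpose A)) ^^ n) k \<bullet> v = k \<bullet> ((*v) (real_matrix A) ^^ n) v"
proof (induction n arbitrary: k)
  case (Suc n)
  have "((*v) (real_matrix (transpose A)) ^^ Suc n) k \<bullet> v
      = ((*v) (real_matrix (transpose A)) ^^ n) (real_matrix (transpose A) *v k) \<bullet> v"
    by (simp add: funpow_swap1)
  also have "\<dots> = (real_matrix (transpose A) *v k) \<bullet> ((*v) (real_matrix A) ^^ n) v" by (rule Suc)
  also have "\<dots> = k \<bullet> (real_matrix A *v ((*v) (real_matrix A) ^^ n) v)"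
    unfolding real_matrix_transpose transpose_matrix_vector by (rule dot_lmul_matrix)
  finally show ?case by simp
qed simp

lemma int_lattice_funpow:
  "k \<in> int_lattice \<Longrightarrow> ((*v) (real_matrix A) ^^ n) k \<in> int_lattice"
  by (induction n) (auto intro: int_lattice_matrix_mult)

text \<open>A dense orbit would come close to 0 at some time \<open>n\<close>. After at most
  \<open>p\<close> more steps it is at a time divisible by \<open>p\<close> and still close to an
  integer vector, so pairing with \<open>k\<close> would give a value close to an integer.\<close>

lemma ND_I:
  fixes A :: "int ^ 'n ^ 'n"
  assumes k: "k \<in> int_lattice" and "\<epsilon> > 0"
    and av: "\<And>i z. z \<in> \<int> \<Longrightarrow> \<epsilon> \<le> \<bar>((*v) (real_matrix (transpose A)) ^^ (p * i)) k \<bullet> v - z\<bar>"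
    and p: "p > 0"
  shows "to_torus v \<in> ND A"
  unfolding ND_def
proof (rule DiffI[OF UNIV_I], rule notI)
  assume "to_torus v \<in> D A"
  then have cl: "closure {(toral_map A ^^ n) (to_torus v) | n. True} = UNIV" by (simp add: D_def)
  let ?M = "real_matrix A"
  obtain B where B: "B \<ge> 1" "\<And>n w. norm (((*v) ?M ^^ n) w) \<le> B ^ n * norm w"
    using norm_funpow_matrix_le[of ?M] by blast
  \<comment> \<open>\<open>B ^ p\<close> is the possible expansion during the waiting time;
    \<open>norm k + 1\<close> keeps the denominator positive and makes the final inequality
    strict.\<close>
  define \<delta> where "\<delta> = \<epsilon> / ((norm k + 1) * B ^ p)"
  have den: "(norm k + 1) * B ^ p > 0" using B(1) by (intro mult_pos_pos) (auto simp: add_nonneg_pos)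
  have \<delta>: "\<delta> > 0" unfolding \<delta>_def using den \<open>\<epsilon> > 0\<close> by simp
  have "to_torus 0 \<in> closure {(toral_map A ^^ n) (to_torus v) | n. True}" unfolding cl by simp
  then obtain n where "dist ((toral_map A ^^ n) (to_torus v)) (to_torus 0) < \<delta>"
    using \<delta> unfolding closure_approachable by blast
  then have "infdist (((*v) ?M ^^ n) v) int_lattice < \<delta>"
    unfolding toral_map_funpow_to_torus dist_to_torus by simp
  then obtain z where z: "z \<in> int_lattice" "norm (((*v) ?M ^^ n) v - z) < \<delta>"
    using infdist_int_lattice_attained[of "((*v) ?M ^^ n) v"] by metis
  \<comment> \<open>The first multiple of \<open>p\<close> strictly after \<open>n\<close>, so the
    waiting time \<open>r\<close> is at most \<open>p\<close>.\<close>
  define i where "i = Suc (n div p)"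
  define r where "r = p * i - n"
  have r: "p * i = r + n" "r \<le> p"
    using times_div_less_eq_dividend[of p n] dividend_less_times_div[OF p, of n]
    unfolding r_def i_def mult_Suc_right by linarith+
  have "((*v) ?M ^^ (p * i)) v - ((*v) ?M ^^ r) z = ((*v) ?M ^^ r) (((*v) ?M ^^ n) v - z)"
    by (simp add: r(1) funpow_add funpow_matrix_diff)
  then have "norm (((*v) ?M ^^ (p * i)) v - ((*v) ?M ^^ r) z) \<le> B ^ r * norm (((*v) ?M ^^ n) v - z)"
    using B by simp
  also have "\<dots> \<le> B ^ p * \<delta>"
    using z(2) B(1) r(2) by (intro mult_mono power_increasing) auto
  finally have nm: "norm (((*v) ?M ^^ (p * i)) v - ((*v) ?M ^^ r) z) \<le> B ^ p * \<delta>" .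
  have "\<epsilon> \<le> \<bar>((*v) (real_matrix (transpose A)) ^^ (p * i)) k \<bullet> v - k \<bullet> ((*v) ?M ^^ r) z\<bar>"
    by (intro av inner_int_lattice k int_lattice_funpow z)
  also have "\<dots> = \<bar>k \<bullet> (((*v) ?M ^^ (p * i)) v - ((*v) ?M ^^ r) z)\<bar>"
    by (simp only: inner_funpow_transpose inner_diff_right)
  also have "\<dots> \<le> norm k * (B ^ p * \<delta>)"
    by (rule order_trans[OF Cauchy_Schwarz_ineq2]) (intro mult_left_mono nm norm_ge_zero)
  also have "\<dots> < (norm k + 1) * (B ^ p * \<delta>)"
    using \<delta> B(1) by (intro mult_strict_right_mono mult_pos_pos) auto
  also have "\<dots> = \<epsilon>"
    using den unfolding \<delta>_def mult.assoc[symmetric] by (metis less_irrefl nonzero_mult_div_cancel_left times_divide_eq_right)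
  finally show False by simp
qed

section \<open>Integer vectors of exact exponential growth\<close>

text \<open>The polynomial \<open>p\<close> in the shift operator, applied to the sequence
  \<open>s\<close>; a linear recurrence says that the result vanishes.
  \<open>shift_poly_mult\<close> makes factorisations of polynomials act on recurrences.\<close>

definition shift_poly :: "'a::comm_ring_1 poly \<Rightarrow> (nat \<Rightarrow> 'a) \<Rightarrow> nat \<Rightarrow> 'a" where
  "shift_poly p s n = (\<Sum>i\<le>degree p. coeff p i * s (n + i))"

lemma shift_poly_ge:
  assumes "degree p \<le> N" shows "shift_poly p s n = (\<Sum>i\<le>N. coeff p i * s (n + i))"
  unfolding shift_poly_def using assms
  by (intro sum.mono_neutral_left) (auto simp: coeff_eq_0)

lemma shift_poly_0 [simp]: "shift_poly 0 s n = 0"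
  by (simp add: shift_poly_def)

lemma shift_poly_pCons: "shift_poly (pCons a p) s n = a * s n + shift_poly p s (Suc n)"
proof -
  have "shift_poly (pCons a p) s n = (\<Sum>i\<le>Suc (degree p). coeff (pCons a p) i * s (n + i))"
    by (intro shift_poly_ge degree_pCons_le)
  also have "\<dots> = a * s n + shift_poly p s (Suc n)"
    by (subst sum.atMost_Suc_shift) (simp add: shift_poly_def)
  finally show ?thesis .
qed

lemma shift_poly_add: "shift_poly (p + q) s n = shift_poly p s n + shift_poly q s n"
proof -
  let ?N = "max (degree p) (degree q)"
  have "shift_poly (p + q) s n = (\<Sum>i\<le>?N. coeff (p + q) i * s (n + i))"
    by (intro shift_poly_ge degree_add_le_max)
  then show ?thesis
    using shift_poly_ge[of p ?N s n] shift_poly_ge[of q ?N s n] by (simp add: sum.distrib algebra_simps)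
qed

lemma shift_poly_smult: "shift_poly (smult c p) s n = c * shift_poly p s n"
  using shift_poly_ge[of "smult c p" "degree p" s n]
  by (simp add: degree_smult_le shift_poly_def sum_distrib_left mult_ac)

lemma shift_poly_mult: "shift_poly (p * q) s n = shift_poly p (shift_poly q s) n"
  by (induction p arbitrary: n) (auto simp: shift_poly_add shift_poly_smult shift_poly_pCons)

lemma shift_poly_diff_scale:
  "shift_poly p (\<lambda>m. s m - c * t m) n = shift_poly p s n - c * shift_poly p t n"
  by (simp add: shift_poly_def algebra_simps sum_subtractf sum_distrib_left)

lemma shift_poly_scale: "shift_poly p (\<lambda>m. c * s m) n = c * shift_poly p s n"
  by (simp add: shift_poly_def algebra_simps sum_distrib_left)

lemma shift_poly_sum:
  "shift_poly p (\<lambda>m. \<Sum>x\<in>X. s x m) n = (\<Sum>x\<in>X. shift_poly p (s x) n)"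
  unfolding shift_poly_def by (simp add: sum_distrib_left) (rule sum.swap)

lemma shift_poly_power: "shift_poly p (\<lambda>m. z ^ m) n = poly p z * z ^ n"
  by (simp add: shift_poly_def poly_altdef sum_distrib_left sum_distrib_right power_add mult_ac)

text \<open>Split off a root, \<open>Q = [:- z, 1:] * R\<close>. Then \<open>R\<close> in the shift
  turns \<open>s\<close> into a geometric sequence of ratio \<open>z\<close>; subtracting a multiple
  of \<open>z ^ n\<close> from \<open>s\<close> kills it, and the induction hypothesis applies to
  \<open>R\<close>. Simplicity of the root gives \<open>poly R z \<noteq> 0\<close>, which is why no
  polynomial factors in \<open>n\<close> arise.\<close>

lemma recurrence_simple_roots:
  fixes Q :: "complex poly"
  assumes "rsquarefree Q" "\<And>n. shift_poly Q s n = 0"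
  shows "\<exists>c. \<forall>n. s n = (\<Sum>z | poly Q z = 0. c z * z ^ n)"
  using assms
proof (induction "degree Q" arbitrary: Q s)
  case 0
  then obtain a where Q: "Q = [:a:]" by (metis degree_eq_zeroE)
  have "a \<noteq> 0" using 0(2) Q by (auto simp: rsquarefree_def)
  then have "s n = 0" for n using 0(3)[of n] Q by (simp add: shift_poly_pCons)
  then show ?case using Q \<open>a \<noteq> 0\<close> by simp
next
  case (Suc d)
  have Q0: "Q \<noteq> 0" using Suc.hyps(2) by auto
  have "\<not> constant (poly Q)" using Suc.hyps(2) by (simp add: constant_degree)
  then obtain z where "poly Q z = 0" using fundamental_theorem_of_algebra by blast
  then obtain R where R: "Q = [:- z, 1:] * R" by (metis dvdE poly_eq_0_iff_dvd)
  then have R0: "R \<noteq> 0" using Q0 by auto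
  have "degree Q = degree [:- z, 1:] + degree R"
    unfolding R using R0 by (intro degree_mult_eq) auto
  then have deg: "d = degree R" using Suc.hyps(2) by simp
  have roots: "\<not> (poly Q a = 0 \<and> poly (pderiv Q) a = 0)" for a
    using Suc.prems(1) by (simp add: rsquarefree_roots)
  have pd: "poly (pderiv Q) a = poly R a + (a - z) * poly (pderiv R) a" for a
    unfolding R pderiv_mult poly_add poly_mult by (simp add: pderiv_pCons algebra_simps)
  have Qa: "poly Q a = (a - z) * poly R a" for a unfolding R by (simp add: algebra_simps)
  have Rz: "poly R z \<noteq> 0" using roots[of z] by (simp add: pd Qa)
  have sqR: "rsquarefree R"
    unfolding rsquarefree_roots
  proof (intro allI notI)
    fix a assume "poly R a = 0 \<and> poly (pderiv R) a = 0"
    then show False using roots[of a] by (simp add: pd Qa)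
  qed
  define t where "t = shift_poly R s"
  have t: "t (Suc n) = z * t n" for n
    using Suc.prems(2)[of n] unfolding R shift_poly_mult t_def[symmetric] by (simp add: shift_poly_pCons)
  have tn: "t n = t 0 * z ^ n" for n by (induction n) (auto simp: t)
  \<comment> \<open>\<open>R\<close> acts on the powers of \<open>z\<close> as multiplication by
    \<open>poly R z\<close>, so \<open>b * z ^ n\<close> is sent exactly to
    \<open>t\<close>.\<close>
  define b where "b = t 0 / poly R z"
  define s' where "s' n = s n - b * z ^ n" for n
  have "shift_poly R s' n = 0" for n
    unfolding s'_def shift_poly_diff_scale shift_poly_power t_def[symmetric]
    using Rz by (simp add: tn[of n] b_def)
  then obtain c where c: "\<And>n. s' n = (\<Sum>z | poly R z = 0. c z * z ^ n)"
    using Suc.hyps(1)[OF deg sqR] by blast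
  have set: "{a. poly Q a = 0} = insert z {a. poly R a = 0}" by (auto simp: Qa)
  have fin: "finite {a. poly R a = 0}" using R0 by (rule poly_roots_finite)
  have "s n = (\<Sum>a | poly Q a = 0. (c(z := b)) a * a ^ n)" for n
  proof -
    have "(\<Sum>a | poly Q a = 0. (c(z := b)) a * a ^ n)
        = b * z ^ n + (\<Sum>a | poly R a = 0. (c(z := b)) a * a ^ n)"
      unfolding set using fin Rz by simp
    also have "(\<Sum>a | poly R a = 0. (c(z := b)) a * a ^ n) = s' n"
      unfolding c using Rz by (intro sum.cong) auto
    finally show ?thesis by (simp add: s'_def)
  qed
  then show ?case by blast
qed

text \<open>The polynomial with all other exponents as roots filters out a single exponential. This
  is how cancellation between terms of equal modulus is excluded later.\<close>

lemma exponential_sum_extract: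
  fixes c :: "complex \<Rightarrow> complex"
  assumes "finite R" "z \<in> R"
  obtains L where "\<And>n. shift_poly L (\<lambda>m. \<Sum>x\<in>R. c x * x ^ m) n = c z * poly L z * z ^ n"
    "poly L z \<noteq> 0"
proof
  define L where "L = (\<Prod>x\<in>R - {z}. [:- x, 1:])"
  show "poly L z \<noteq> 0" using assms by (auto simp: L_def poly_prod)
  have "poly L x = 0" if "x \<in> R - {z}" for x
    using that assms by (auto simp: L_def poly_prod)
  then have "(\<Sum>x\<in>R. c x * (poly L x * x ^ n)) = (\<Sum>x\<in>{z}. c x * (poly L x * x ^ n))" for n
    using assms by (intro sum.mono_neutral_right) auto
  then show "shift_poly L (\<lambda>m. \<Sum>x\<in>R. c x * x ^ m) n = c z * poly L z * z ^ n" for n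
    by (simp add: shift_poly_sum shift_poly_scale shift_poly_power)
qed

section \<open>Rational annihilating polynomials and their squarefree parts\<close>

lemma map_poly_of_rat_mult:
  "map_poly (of_rat :: rat \<Rightarrow> complex) (p * q) = map_poly of_rat p * map_poly of_rat q"
  by (rule poly_eqI) (simp add: coeff_map_poly coeff_mult of_rat_sum of_rat_mult)

lemma map_poly_of_rat_add:
  "map_poly (of_rat :: rat \<Rightarrow> complex) (p + q) = map_poly of_rat p + map_poly of_rat q"
  by (rule poly_eqI) (simp add: coeff_map_poly of_rat_add)

lemma map_poly_of_rat_pderiv:
  "map_poly (of_rat :: rat \<Rightarrow> complex) (pderiv p) = pderiv (map_poly of_rat p)"
  by (rule poly_eqI) (simp add: coeff_map_poly coeff_pderiv of_rat_add of_rat_mult)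

lemma shift_poly_of_rat:
  "shift_poly (map_poly (of_rat :: rat \<Rightarrow> complex) p) (\<lambda>m. of_rat (s m)) n = of_rat (shift_poly p s n)"
  by (simp add: shift_poly_def degree_map_poly coeff_map_poly of_rat_sum of_rat_mult)

text \<open>\<open>Q\<close> is \<open>P\<close> divided by the gcd of \<open>P\<close> and its
  derivative. The division is done over the rationals so that \<open>D\<close> sends rational
  vectors to rational vectors; the Bezout identity for the gcd survives the embedding into the
  complex numbers, where it shows that \<open>Q\<close> has only simple roots.\<close>

lemma rat_squarefree_part:
  fixes P :: "rat poly"
  assumes "degree P > 0"
  obtains Q D where "P = Q * D" "D \<noteq> 0" "degree D < degree P"
    "rsquarefree (map_poly (of_rat :: rat \<Rightarrow> complex) Q)"
proof
  define D where "D = gcd P (pderiv P)"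
  define Q where "Q = P div D"
  define E where "E = pderiv P div D"
  show P: "P = Q * D" by (simp add: Q_def D_def)
  have E: "pderiv P = E * D" by (simp add: E_def D_def)
  have P': "pderiv P \<noteq> 0" using assms by (simp add: pderiv_eq_0_iff)
  then show "D \<noteq> 0" by (simp add: D_def)
  have "degree D \<le> degree (pderiv P)" unfolding D_def using P' by (intro dvd_imp_degree_le) auto
  then show "degree D < degree P" using assms by (simp add: degree_pderiv)
  obtain r s where rs: "r * P + s * pderiv P = D"
    unfolding D_def using bezout_coefficients_fst_snd by blast
  let ?m = "map_poly (of_rat :: rat \<Rightarrow> complex)"
  show "rsquarefree (?m Q)"
  proof (rule poly_squarefree_decomp[THEN conjunct1])
    show "pderiv (?m P) \<noteq> 0"
      unfolding map_poly_of_rat_pderiv[symmetric] using P' by (subst map_poly_eq_0_iff) auto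
    show "?m P = ?m Q * ?m D" using P by (metis map_poly_of_rat_mult)
    show "pderiv (?m P) = ?m E * ?m D"
      using E by (metis map_poly_of_rat_mult map_poly_of_rat_pderiv)
    show "?m D = ?m r * ?m P + ?m s * pderiv (?m P)"
      using rs by (metis map_poly_of_rat_mult map_poly_of_rat_pderiv map_poly_of_rat_add)
  qed
qed

text \<open>More iterates than the dimension are linearly dependent. A repetition among them is
  treated apart, because the set \<open>S\<close> of iterates would hide it.\<close>

lemma rat_orbit_annihilator:
  fixes M :: "rat ^ 'n ^ 'n"
  defines "vp \<equiv> (\<lambda>P u. (\<Sum>i\<le>degree P. coeff P i *s ((*v) M ^^ i) u))"
  shows "\<exists>P. P \<noteq> 0 \<and> vp P u = 0"
proof (cases "inj_on (\<lambda>i. ((*v) M ^^ i) u) {..CARD('n)}")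
  case False
  then obtain a b where ab: "a < b" "((*v) M ^^ a) u = ((*v) M ^^ b) u"
    by (auto simp: inj_on_def) (metis nat_neq_iff)
  define P :: "rat poly" where "P = monom 1 b + monom (-1) a"
  have deg: "degree P = b"
    unfolding P_def using ab(1) by (subst degree_add_eq_left) (auto simp: degree_monom_eq)
  have "vp P u = (\<Sum>i\<le>b. (if i = b then ((*v) M ^^ i) u else 0) - (if i = a then ((*v) M ^^ i) u else 0))"
    unfolding vp_def deg using ab(1) by (intro sum.cong) (auto simp: P_def)
  also have "\<dots> = 0" using ab by (simp add: sum_subtractf sum.delta)
  finally have "vp P u = 0" .
  moreover have "P \<noteq> 0" using ab(1) deg by auto
  ultimately show ?thesis by blast
next
  case inj: True
  define S where "S = (\<lambda>i. ((*v) M ^^ i) u) ` {..CARD('n)}"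
  have "card S = Suc CARD('n)" unfolding S_def by (simp add: card_image[OF inj])
  moreover have "vec.dim S \<le> CARD('n)"
    using vec.dim_subset[of S UNIV] unfolding vec_dim_card by simp
  ultimately have "vec.dependent S"
    by (intro vec.dependent_biggerset_general) auto
  then obtain f where f: "\<exists>v\<in>S. f v \<noteq> 0" "(\<Sum>v\<in>S. f v *s v) = 0"
    using vec.dependent_finite[of S] by (auto simp: S_def)
  define a where "a i = f (((*v) M ^^ i) u)" for i
  define P where "P = (\<Sum>i\<le>CARD('n). monom (a i) i)"
  have cP: "coeff P i = (if i \<le> CARD('n) then a i else 0)" for i
    by (simp add: P_def coeff_sum sum.delta)
  have dP: "degree P \<le> CARD('n)"
    unfolding P_def by (intro degree_sum_le) (auto intro: order_trans[OF degree_monom_le])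
  have "vp P u = (\<Sum>i\<le>CARD('n). coeff P i *s ((*v) M ^^ i) u)"
    unfolding vp_def using dP by (intro sum.mono_neutral_left) (auto simp: coeff_eq_0)
  also have "\<dots> = (\<Sum>i\<le>CARD('n). f (((*v) M ^^ i) u) *s ((*v) M ^^ i) u)"
    by (intro sum.cong) (auto simp: cP a_def)
  also have "\<dots> = (\<Sum>v\<in>S. f v *s v)"
    unfolding S_def by (subst sum.reindex[OF inj]) simp
  finally have "vp P u = 0" using f by simp
  moreover have "P \<noteq> 0"
  proof -
    obtain i where "i \<le> CARD('n)" "a i \<noteq> 0" using f(1) by (auto simp: S_def a_def)
    then have "coeff P i \<noteq> 0" by (simp add: cP)
    then show ?thesis by auto
  qed
  ultimately show ?thesis by blast
qed

lemma finite_int_lattice_bounded: "finite {v :: real ^ 'n. v \<in> int_lattice \<and> norm v \<le> B}"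
proof (rule finite_subset)
  let ?I = "real_of_int ` {-\<lceil>B\<rceil>..\<lceil>B\<rceil>}"
  show "finite ((\<lambda>f. \<chi> i. f i) ` ((UNIV :: 'n set) \<rightarrow>\<^sub>E ?I))"
    by (intro finite_imageI finite_PiE) auto
  show "{v :: real ^ 'n. v \<in> int_lattice \<and> norm v \<le> B} \<subseteq> (\<lambda>f. \<chi> i. f i) ` ((UNIV :: 'n set) \<rightarrow>\<^sub>E ?I)"
  proof
    fix v :: "real ^ 'n" assume v: "v \<in> {v. v \<in> int_lattice \<and> norm v \<le> B}"
    have "v $ i \<in> ?I" for i
    proof -
      obtain m where m: "v $ i = of_int m" using v by (auto simp: int_lattice_def elim!: Ints_cases)
      have "\<bar>real_of_int m\<bar> \<le> B" using v component_le_norm_cart[of v i] m by simp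
      then have "m \<in> {-\<lceil>B\<rceil>..\<lceil>B\<rceil>}" by auto linarith+
      then show ?thesis using m by blast
    qed
    then show "v \<in> (\<lambda>f. \<chi> i. f i) ` ((UNIV :: 'n set) \<rightarrow>\<^sub>E ?I)"
      by (intro image_eqI[of _ _ "\<lambda>i. v $ i"]) auto
  qed
qed

lemma funpow_matrix_sum:
  "((*v) (M :: 'a::field ^ 'n ^ 'n) ^^ n) (\<Sum>x\<in>X. c x *s v x) = (\<Sum>x\<in>X. c x *s ((*v) M ^^ n) (v x))"
  by (induction n) (auto simp: vec.linear_sum[OF matrix_vector_mul_linear_gen] vector_scalar_commute)

lemma of_rat_Ints: "x \<in> \<int> \<Longrightarrow> real_of_rat x \<in> \<int>"
  by (auto elim!: Ints_cases)

lemma of_real_of_rat: "complex_of_real (real_of_rat x) = of_rat x"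
  by (cases x) (simp add: of_rat_rat)

lemma common_denominator_vec:
  fixes x :: "rat ^ 'n"
  obtains N :: int where "N > 0" "\<And>j. of_int N * x $ j \<in> \<int>"
proof -
  have "\<exists>d > 0. of_int d * y \<in> \<int>" for y :: rat
  proof (cases y)
    case (Fract a b)
    then show ?thesis by (intro exI[of _ b]) (simp add: Fract_of_int_quotient)
  qed
  then obtain d where d: "\<And>y. d y > 0" "\<And>y. of_int (d y) * y \<in> (\<int> :: rat set)" by metis
  define N where "N = (\<Prod>j\<in>UNIV. d (x $ j))"
  have "of_int N * x $ j \<in> \<int>" for j
  proof -
    have "of_int N * x $ j = of_int (\<Prod>l\<in>UNIV - {j}. d (x $ l)) * (of_int (d (x $ j)) * x $ j)"
      unfolding N_def by (subst prod.remove[of _ j]) auto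
    also have "\<dots> \<in> \<int>" by (intro Ints_mult Ints_of_int d(2))
    finally show ?thesis .
  qed
  moreover have "N > 0" unfolding N_def using d(1) by (intro prod_pos) auto
  ultimately show ?thesis using that by blast
qed

text \<open>Let \<open>P\<close> have least degree among the polynomials annihilating
  \<open>e\<close>, and let \<open>Q\<close> be its squarefree part, \<open>P = Q * D\<close>. Then
  \<open>D\<close> applied to \<open>e\<close> is nonzero by minimality and is annihilated by
  \<open>Q\<close>, so the coordinates along its orbit are sums of pure exponentials. Clearing
  denominators gives the integer vector.\<close>

lemma exponential_orbit:
  fixes A :: "int ^ 'n ^ 'n"
  assumes inj: "\<And>k. k \<in> int_lattice \<Longrightarrow> k \<noteq> 0 \<Longrightarrow> inj (\<lambda>n. ((*v) (real_matrix A) ^^ n) k)"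
  obtains k \<rho> a C where "k \<in> int_lattice" "\<rho> > 1" "a > 0" "C > 0"
    "\<And>n. a * \<rho> ^ n \<le> norm (((*v) (real_matrix A) ^^ n) k)"
    "\<And>n. norm (((*v) (real_matrix A) ^^ n) k) \<le> C * \<rho> ^ n"
proof -
  define M where "M = map_matrix rat_of_int A"
  define e :: "rat ^ 'n" where "e = axis undefined 1"
  have e0: "e \<noteq> 0" by (simp add: e_def axis_eq_0_iff)
  define vp where "vp P = (\<Sum>i\<le>degree P. coeff P i *s ((*v) M ^^ i) e)" for P
  have vp: "(((*v) M ^^ n) (vp P)) $ j = shift_poly P (\<lambda>m. ((*v) M ^^ m) e $ j) n" for P n j
    unfolding vp_def funpow_matrix_sum shift_poly_def by (simp add: funpow_add)
  obtain P where P: "P \<noteq> 0 \<and> vp P = 0" and min: "\<And>R. R \<noteq> 0 \<and> vp R = 0 \<Longrightarrow> degree P \<le> degree R"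
    using ex_has_least_nat[of "\<lambda>P. P \<noteq> 0 \<and> vp P = 0" _ degree]
      rat_orbit_annihilator[of M e] unfolding vp_def by blast
  have degP: "degree P > 0"
  proof (rule ccontr)
    assume "\<not> degree P > 0"
    then obtain b where "P = [:b:]" by (metis degree_eq_zeroE gr0I)
    then show False using P e0 by (auto simp: vp_def)
  qed
  obtain Q D where QD: "P = Q * D" "D \<noteq> 0" "degree D < degree P"
    "rsquarefree (map_poly (of_rat :: rat \<Rightarrow> complex) Q)"
    using rat_squarefree_part[OF degP] .
  have "vp D \<noteq> 0" using min[of D] QD by auto
  obtain N where N: "N > 0" "\<And>j. of_int N * vp D $ j \<in> \<int>"
    using common_denominator_vec[of "vp D"] by blast
  define w where "w n = ((*v) M ^^ n) (vp D)" for n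
  define k where "k n = (\<chi> j. real_of_rat (of_int N * w n $ j))" for n
  have k_Suc: "real_matrix A *v k n = k (Suc n)" for n
    by (simp add: vec_eq_iff k_def w_def M_def matrix_vector_mult_def map_matrix_def of_rat_mult
        of_rat_sum sum_distrib_left mult_ac)
  have k: "((*v) (real_matrix A) ^^ n) (k 0) = k n" for n
    by (induction n) (auto simp: k_Suc)
  have k0: "k 0 \<in> int_lattice"
    using N(2) by (auto simp: int_lattice_def k_def w_def of_rat_Ints)
  have k_nz: "k 0 \<noteq> 0"
    using \<open>vp D \<noteq> 0\<close> N(1) by (auto simp: k_def w_def vec_eq_iff)
  define s where "s j n = complex_of_real (k n $ j)" for j n
  have s: "s j = (\<lambda>n. of_rat (of_int N * w n $ j))" for j
    by (simp add: s_def k_def fun_eq_iff of_real_of_rat)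
  have rec: "shift_poly (map_poly of_rat Q) (s j) n = 0" for j n
  proof -
    define u where "u m = ((*v) M ^^ m) e $ j" for m
    have "(\<lambda>n. of_int N * w n $ j) = (\<lambda>n. of_int N * shift_poly D u n)"
      by (simp add: w_def vp u_def[abs_def])
    then have "shift_poly (map_poly of_rat Q) (s j) n = of_rat (of_int N * shift_poly P u n)"
      unfolding s shift_poly_of_rat QD(1) shift_poly_mult
      by (simp only: shift_poly_scale)
    also have "shift_poly P u n = 0"
      using P vp[of n P j] by (simp add: u_def[abs_def])
    finally show ?thesis by simp
  qed
  define R where "R = {z. poly (map_poly (of_rat :: rat \<Rightarrow> complex) Q) z = 0}"
  have finR: "finite R"
    unfolding R_def using QD(4) by (intro poly_roots_finite) (auto simp: rsquarefree_def)
  have "\<forall>j. \<exists>c. \<forall>n. s j n = (\<Sum>z\<in>R. c z * z ^ n)"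
    unfolding R_def using recurrence_simple_roots[OF QD(4) rec] by blast
  then obtain c where c: "\<And>j n. s j n = (\<Sum>z\<in>R. c j z * z ^ n)" by metis
  \<comment> \<open>Only exponents that really occur may determine the growth rate; a root of
    \<open>Q\<close> with zero coefficients would spoil the lower bound.\<close>
  define \<Lambda> where "\<Lambda> = {z\<in>R. \<exists>j. c j z \<noteq> 0}"
  have "\<Lambda> \<noteq> {}"
  proof
    assume "\<Lambda> = {}"
    then have "s j 0 = 0" for j unfolding c by (intro sum.neutral) (auto simp: \<Lambda>_def)
    then show False using k_nz by (auto simp: s_def vec_eq_iff)
  qed
  have fin\<Lambda>: "finite \<Lambda>" using finR by (simp add: \<Lambda>_def)
  define \<rho> where "\<rho> = Max (cmod ` \<Lambda>)"
  have "\<rho> \<in> cmod ` \<Lambda>" unfolding \<rho>_def using \<open>\<Lambda> \<noteq> {}\<close> fin\<Lambda> by (intro Max_in) auto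
  then obtain z0 j0 where z0: "z0 \<in> R" "cmod z0 = \<rho>" "c j0 z0 \<noteq> 0" by (auto simp: \<Lambda>_def)
  have \<rho>0: "\<rho> \<ge> 0" using z0(2) by (metis norm_ge_zero)
  define C where "C = 1 + (\<Sum>j\<in>UNIV. \<Sum>z\<in>R. cmod (c j z))"
  have C: "C > 0" unfolding C_def by (intro add_pos_nonneg sum_nonneg) auto
  have upper: "norm (k n) \<le> C * \<rho> ^ n" for n
  proof -
    have "norm (k n) \<le> (\<Sum>j\<in>UNIV. \<bar>k n $ j\<bar>)" by (rule norm_le_l1_cart)
    also have "\<dots> \<le> (\<Sum>j\<in>UNIV. (\<Sum>z\<in>R. cmod (c j z)) * \<rho> ^ n)"
    proof (rule sum_mono)
      fix j
      have "\<bar>k n $ j\<bar> = cmod (s j n)" by (simp add: s_def)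
      also have "\<dots> \<le> (\<Sum>z\<in>R. cmod (c j z) * \<rho> ^ n)"
        unfolding c
      proof (rule sum_norm_le)
        fix z assume "z \<in> R"
        show "cmod (c j z * z ^ n) \<le> cmod (c j z) * \<rho> ^ n"
        proof (cases "c j z = 0")
          case False
          then have "z \<in> \<Lambda>" using \<open>z \<in> R\<close> by (auto simp: \<Lambda>_def)
          then have "cmod z \<le> \<rho>" unfolding \<rho>_def using fin\<Lambda> by (intro Max_ge) auto
          then show ?thesis by (simp add: norm_mult norm_power mult_left_mono power_mono)
        qed simp
      qed
      finally show "\<bar>k n $ j\<bar> \<le> (\<Sum>z\<in>R. cmod (c j z)) * \<rho> ^ n" by (simp add: sum_distrib_right)
    qed
    also have "\<dots> = (C - 1) * \<rho> ^ n" by (simp add: C_def sum_distrib_right)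
    also have "\<dots> \<le> C * \<rho> ^ n" using \<rho>0 by (intro mult_right_mono) auto
    finally show ?thesis .
  qed
  \<comment> \<open>Several terms of modulus \<open>\<rho>\<close> might cancel at some
    \<open>n\<close>. After filtering only \<open>z0\<close> is left, and the filtered value at
    \<open>n\<close> involves a fixed number of later orbit vectors, each of norm at most
    \<open>B ^ i * norm (k n)\<close>.\<close>
  obtain L where L0: "\<And>n. shift_poly L (\<lambda>m. \<Sum>x\<in>R. c j0 x * x ^ m) n = c j0 z0 * poly L z0 * z0 ^ n"
    and L1: "poly L z0 \<noteq> 0"
    using exponential_sum_extract[OF finR z0(1), of "c j0"] by blast
  have "s j0 = (\<lambda>m. \<Sum>x\<in>R. c j0 x * x ^ m)" using c by (simp add: fun_eq_iff)
  then have L: "shift_poly L (s j0) n = c j0 z0 * poly L z0 * z0 ^ n" for n using L0 by simp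
  obtain B where B: "B \<ge> 1" "\<And>n v. norm (((*v) (real_matrix A) ^^ n) v) \<le> B ^ n * norm v"
    using norm_funpow_matrix_le[of "real_matrix A"] by blast
  define E where "E = (\<Sum>i\<le>degree L. cmod (coeff L i) * B ^ i)"
  have lower0: "cmod (c j0 z0) * cmod (poly L z0) * \<rho> ^ n \<le> E * norm (k n)" for n
  proof -
    have "cmod (c j0 z0) * cmod (poly L z0) * \<rho> ^ n = cmod (shift_poly L (s j0) n)"
      by (simp add: L norm_mult norm_power z0)
    also have "\<dots> \<le> (\<Sum>i\<le>degree L. cmod (coeff L i) * (B ^ i * norm (k n)))"
      unfolding shift_poly_def
    proof (rule sum_norm_le)
      fix i
      have "cmod (s j0 (n + i)) \<le> norm (k (n + i))"
        using component_le_norm_cart[of "k (n + i)" j0] by (simp add: s_def)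
      also have "k (n + i) = ((*v) (real_matrix A) ^^ i) (k n)"
        by (metis k funpow_add comp_apply add.commute)
      also have "norm \<dots> \<le> B ^ i * norm (k n)" by (rule B)
      finally show "cmod (coeff L i * s j0 (n + i)) \<le> cmod (coeff L i) * (B ^ i * norm (k n))"
        by (simp add: norm_mult mult_left_mono)
    qed
    also have "\<dots> = E * norm (k n)" by (simp add: E_def sum_distrib_right mult.assoc)
    finally show ?thesis .
  qed
  have pos: "cmod (c j0 z0) * cmod (poly L z0) > 0" using z0 L1 by simp
  have E: "E > 0"
  proof -
    have "0 < E * norm (k 0)" using lower0[of 0] pos by simp
    then show ?thesis using norm_ge_zero[of "k 0"] by (simp add: zero_less_mult_iff)
  qed
  define a where "a = cmod (c j0 z0) * cmod (poly L z0) / E"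
  have a: "a > 0" using pos E by (simp add: a_def)
  have lower: "a * \<rho> ^ n \<le> norm (k n)" for n
    using lower0[of n] E by (simp add: a_def field_simps)
  have "\<rho> > 1"
  proof (rule ccontr)
    assume "\<not> \<rho> > 1"
    then have "\<rho> ^ n \<le> 1" for n using \<rho>0 by (intro power_le_one) auto
    then have "norm (k n) \<le> C" for n
      using upper[of n] C mult_left_mono[of "\<rho> ^ n" 1 C] by (auto intro: order_trans)
    moreover have "k n \<in> int_lattice" for n
      by (induction n) (use k0 in \<open>auto simp: k_Suc[symmetric] intro: int_lattice_matrix_mult\<close>)
    ultimately have "range k \<subseteq> {v. v \<in> int_lattice \<and> norm v \<le> C}" by auto
    then have "finite (range k)" using finite_int_lattice_bounded finite_subset by blast
    moreover have "inj k" using inj[OF k0 k_nz] by (simp add: k)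
    ultimately show False using finite_imageD by blast
  qed
  show ?thesis
    by (rule that[OF k0 \<open>\<rho> > 1\<close> a C]) (use lower upper k in auto)
qed

section \<open>Cantor sets avoiding slabs\<close>

text \<open>A cube of stage \<open>N\<close> has side \<open>1 / M ^ N\<close> and is named by its
  integer corner \<open>c\<close>; \<open>dig N c\<close> lists the \<open>G\<close> subcubes of it
  that are kept. Letting the list depend on the cube allows it to react to the slab met
  there.\<close>

locale cantor_scheme =
  fixes J :: "'n set" and M G :: nat and dig :: "nat \<Rightarrow> ('n \<Rightarrow> int) \<Rightarrow> nat \<Rightarrow> 'n \<Rightarrow> int"
  assumes fin: "finite J" and M: "M \<ge> 2" and G: "G \<ge> 1"
    and dig: "\<And>N c a. a < G \<Longrightarrow> dig N c a \<in> J \<rightarrow>\<^sub>E {0..<int M}"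
    and inj: "\<And>N c. inj_on (dig N c) {..<G}"
begin

text \<open>The base-\<open>G\<close> digits of \<open>a\<close> are the path through the tree of
  cubes: \<open>a div G\<close> is the parent and \<open>a mod G\<close> selects the child.\<close>

primrec corner :: "nat \<Rightarrow> nat \<Rightarrow> 'n \<Rightarrow> int" where
  "corner 0 a = (\<lambda>_. 0)"
| "corner (Suc N) a =
    (\<lambda>j. int M * corner N (a div G) j + dig N (corner N (a div G)) (a mod G) j)"

text \<open>The first \<open>N\<close> base-\<open>G\<close> digits of \<open>\<omega>\<close>. Thus
  Lebesgue measure on the unit interval gives every cube of stage \<open>N\<close> the mass
  \<open>1 / G ^ N\<close>.\<close>

definition index :: "nat \<Rightarrow> real \<Rightarrow> nat" where
  "index N \<omega> = nat \<lfloor>real G ^ N * \<omega>\<rfloor>"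

definition approx :: "nat \<Rightarrow> real \<Rightarrow> 'n \<Rightarrow> real" where
  "approx N \<omega> j = real_of_int (corner N (index N \<omega>) j) / real M ^ N"

definition point :: "real \<Rightarrow> 'n \<Rightarrow> real" where
  "point \<omega> j = lim (\<lambda>N. approx N \<omega> j)"

lemma digit_bounds: "j \<in> J \<Longrightarrow> 0 \<le> dig N c (a mod G) j \<and> dig N c (a mod G) j < int M"
  using dig[of "a mod G" N c] G by (auto simp: PiE_iff)

text \<open>Digits lie below \<open>M\<close>, so division by \<open>M\<close> recovers the parent
  corner and then the digit; distinct paths therefore lead to distinct cubes.\<close>

lemma corner_inj:
  assumes "a < G ^ N" "b < G ^ N" "\<And>j. j \<in> J \<Longrightarrow> corner N a j = corner N b j"
  shows "a = b"
  using assms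
proof (induction N arbitrary: a b)
  case (Suc N)
  let ?c = "corner N (a div G)" and ?c' = "corner N (b div G)"
  have *: "?c j = ?c' j \<and> dig N ?c (a mod G) j = dig N ?c' (b mod G) j" if "j \<in> J" for j
  proof -
    have eq: "int M * ?c j + dig N ?c (a mod G) j = int M * ?c' j + dig N ?c' (b mod G) j"
      using Suc.prems(3)[OF that] by simp
    then have "(int M * ?c j + dig N ?c (a mod G) j) div int M = (int M * ?c' j + dig N ?c' (b mod G) j) div int M"
      by simp
    then have "?c j = ?c' j"
      using digit_bounds[OF that] M by simp
    then show ?thesis using eq by simp
  qed
  have lt: "a div G < G ^ N" "b div G < G ^ N"
    using Suc.prems(1,2) by (auto simp: less_mult_imp_div_less mult.commute)
  have div: "a div G = b div G" using * by (intro Suc.IH lt) auto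
  have "dig N ?c (a mod G) = dig N ?c (b mod G)"
  proof (rule PiE_ext)
    show "dig N ?c (a mod G) \<in> J \<rightarrow>\<^sub>E {0..<int M}" "dig N ?c (b mod G) \<in> J \<rightarrow>\<^sub>E {0..<int M}"
      using G by (intro dig; simp)+
  qed (use * div in auto)
  then have "a mod G = b mod G"
    using inj_onD[OF inj, of N ?c "a mod G" "b mod G"] G by simp
  then show ?case using div by (metis div_mult_mod_eq)
qed simp

lemma index_div: "\<omega> \<ge> 0 \<Longrightarrow> index (Suc N) \<omega> div G = index N \<omega>"
proof -
  assume "\<omega> \<ge> 0"
  have "\<lfloor>real G ^ Suc N * \<omega>\<rfloor> div int G = \<lfloor>real G ^ Suc N * \<omega> / real_of_int (int G)\<rfloor>"
    by (rule floor_divide_real_eq_div[symmetric]) simp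
  also have "real G ^ Suc N * \<omega> / real_of_int (int G) = real G ^ N * \<omega>" using G by simp
  finally have "nat (\<lfloor>real G ^ Suc N * \<omega>\<rfloor> div int G) = index N \<omega>" by (simp add: index_def)
  then show ?thesis
    using \<open>\<omega> \<ge> 0\<close> by (simp add: index_def nat_div_distrib)
qed

lemma index_less:
  assumes "0 \<le> \<omega>" "\<omega> < 1" shows "index N \<omega> < G ^ N"
proof -
  have "real G ^ N * \<omega> < real G ^ N * 1" using assms G by (intro mult_strict_left_mono) auto
  then have "\<lfloor>real G ^ N * \<omega>\<rfloor> < int (G ^ N)" by (simp add: floor_less_iff)
  then show ?thesis using assms by (simp add: index_def nat_less_iff)
qed

text \<open>Nesting of the cubes: lower ends rise and upper ends fall.\<close>

lemma approx_Suc: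
  assumes "\<omega> \<ge> 0" "j \<in> J"
  shows "approx N \<omega> j \<le> approx (Suc N) \<omega> j"
    "approx (Suc N) \<omega> j + 1 / real M ^ Suc N \<le> approx N \<omega> j + 1 / real M ^ N"
proof -
  let ?c = "corner N (index N \<omega>)"
  let ?d = "dig N ?c (index (Suc N) \<omega> mod G) j"
  have d: "0 \<le> ?d" "?d + 1 \<le> int M" using digit_bounds[OF assms(2)] by (auto simp: add1_zle_eq)
  have d': "real_of_int ?d + 1 \<le> real M" using d(2) by linarith
  have eq: "approx (Suc N) \<omega> j = approx N \<omega> j + real_of_int ?d / real M ^ Suc N"
    unfolding approx_def corner.simps index_div[OF assms(1)] using M by (simp add: field_simps)
  show "approx N \<omega> j \<le> approx (Suc N) \<omega> j" unfolding eq using d M by simp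
  have "approx (Suc N) \<omega> j + 1 / real M ^ Suc N = approx N \<omega> j + (real_of_int ?d + 1) / real M ^ Suc N"
    unfolding eq by (simp add: add_divide_distrib)
  also have "\<dots> \<le> approx N \<omega> j + real M / real M ^ Suc N"
    using d' by (intro add_left_mono divide_right_mono) auto
  finally show "approx (Suc N) \<omega> j + 1 / real M ^ Suc N \<le> approx N \<omega> j + 1 / real M ^ N"
    using M by simp
qed

lemma point_bounds:
  assumes "\<omega> \<ge> 0" "j \<in> J"
  shows "approx N \<omega> j \<le> point \<omega> j" "point \<omega> j \<le> approx N \<omega> j + 1 / real M ^ N"
proof -
  have inc: "incseq (\<lambda>N. approx N \<omega> j)" by (intro incseq_SucI approx_Suc assms)
  have dec: "decseq (\<lambda>N. approx N \<omega> j + 1 / real M ^ N)" by (intro decseq_SucI approx_Suc assms)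
  have ub: "approx K \<omega> j \<le> approx N \<omega> j + 1 / real M ^ N" for K N
  proof -
    have "approx K \<omega> j \<le> approx (max K N) \<omega> j" using inc by (auto simp: incseq_def)
    also have "\<dots> \<le> approx (max K N) \<omega> j + 1 / real M ^ max K N" by simp
    also have "\<dots> \<le> approx N \<omega> j + 1 / real M ^ N" using decseqD[OF dec, of N "max K N"] by simp
    finally show ?thesis .
  qed
  obtain L where "(\<lambda>N. approx N \<omega> j) \<longlonglongrightarrow> L"
    using incseq_convergent[OF inc, of "approx 0 \<omega> j + 1 / real M ^ 0"] ub[of _ 0] by blast
  then have "convergent (\<lambda>N. approx N \<omega> j)" by (auto simp: convergent_def)
  then have lim: "(\<lambda>N. approx N \<omega> j) \<longlonglongrightarrow> point \<omega> j"
    unfolding point_def by (simp add: convergent_LIMSEQ_iff)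
  show "approx N \<omega> j \<le> point \<omega> j" by (rule incseq_le[OF inc lim])
  show "point \<omega> j \<le> approx N \<omega> j + 1 / real M ^ N"
    using ub by (intro LIMSEQ_le_const2[OF lim]) auto
qed

lemma point_in_unit: "\<omega> \<ge> 0 \<Longrightarrow> j \<in> J \<Longrightarrow> 0 \<le> point \<omega> j \<and> point \<omega> j \<le> 1"
  using point_bounds[of \<omega> j 0] by (simp add: approx_def)

lemma measurable_point [measurable]: "(\<lambda>\<omega>. point \<omega> j) \<in> borel_measurable borel"
  unfolding point_def
proof (rule borel_measurable_lim_metric)
  fix N
  have "index N \<in> borel \<rightarrow>\<^sub>M count_space UNIV" unfolding index_def by measurable
  then have "(\<lambda>\<omega>. real_of_int (corner N (index N \<omega>) j)) \<in> borel_measurable borel"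
    by (rule measurable_compose) simp
  then show "(\<lambda>\<omega>. approx N \<omega> j) \<in> borel_measurable borel" unfolding approx_def by measurable
qed

text \<open>The integer corner of a cube that contributes is confined, in every coordinate, to an
  interval of length \<open>2 * K + 1\<close>, which holds at most \<open>2 * K + 2\<close>
  integers. Each cube carries mass \<open>1 / G ^ N\<close>.\<close>

lemma emeasure_point_le:
  fixes c :: "'n \<Rightarrow> real"
  shows "emeasure lborel {\<omega>\<in>{0..<1}. \<forall>j\<in>J. \<bar>point \<omega> j - c j\<bar> \<le> real K / real M ^ N}
    \<le> ennreal (real (2 * K + 2) ^ card J / real G ^ N)"
proof -
  \<comment> \<open>The extra 1 accounts for the side of the cube: the point may exceed the corner
    by up to \<open>1 / M ^ N\<close>.\<close>
  define x where "x j = real M ^ N * c j - real K - 1" for j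
  define y where "y j = x j + real (2 * K + 1)" for j
  define A where "A = {a. a < G ^ N \<and> (\<forall>j\<in>J. x j \<le> corner N a j \<and> corner N a j \<le> y j)}"
  have "finite A" unfolding A_def by simp
  have cardA: "card A \<le> (2 * K + 2) ^ card J"
  proof -
    let ?P = "\<Pi>\<^sub>E j\<in>J. {\<lceil>x j\<rceil>..\<lfloor>y j\<rfloor>}"
    have "card A \<le> card ?P"
    proof (rule card_inj_on_le)
      show "inj_on (\<lambda>a. restrict (corner N a) J) A"
      proof (rule inj_onI)
        fix a b assume ab: "a \<in> A" "b \<in> A" "restrict (corner N a) J = restrict (corner N b) J"
        have "corner N a j = corner N b j" if "j \<in> J" for j using ab(3) that by (metis restrict_apply')
        then show "a = b" using ab by (intro corner_inj[of a N b]) (auto simp: A_def)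
      qed
      show "(\<lambda>a. restrict (corner N a) J) ` A \<subseteq> ?P"
        by (auto simp: A_def ceiling_le_iff le_floor_iff)
      show "finite ?P" using fin by (intro finite_PiE) auto
    qed
    also have "\<dots> = (\<Prod>j\<in>J. card {\<lceil>x j\<rceil>..\<lfloor>y j\<rfloor>})" using fin by (rule card_PiE)
    also have "\<dots> \<le> (\<Prod>j\<in>J. 2 * K + 2)"
    proof (rule prod_mono, safe)
      fix j
      have "\<lfloor>y j\<rfloor> - \<lceil>x j\<rceil> \<le> 2 * int K + 1" unfolding y_def by linarith
      then show "card {\<lceil>x j\<rceil>..\<lfloor>y j\<rfloor>} \<le> 2 * K + 2" by (simp add: nat_le_iff)
    qed
    finally show ?thesis by simp
  qed
  have G0: "real G ^ N > 0" using G by simp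
  define I where "I a = {real a / real G ^ N..<(real a + 1) / real G ^ N}" for a
  have I: "emeasure lborel (I a) = ennreal (1 / real G ^ N)" for a
    unfolding I_def using G0
    by (subst emeasure_lborel_Ico) (auto simp: divide_right_mono diff_divide_distrib[symmetric])
  have "{\<omega>\<in>{0..<1}. \<forall>j\<in>J. \<bar>point \<omega> j - c j\<bar> \<le> real K / real M ^ N} \<subseteq> (\<Union>a\<in>A. I a)"
  proof
    fix \<omega> assume \<omega>: "\<omega> \<in> {\<omega>\<in>{0..<1}. \<forall>j\<in>J. \<bar>point \<omega> j - c j\<bar> \<le> real K / real M ^ N}"
    define a where "a = index N \<omega>"
    have "a \<in> A"
      unfolding A_def
    proof (intro CollectI conjI ballI)
      show "a < G ^ N" unfolding a_def using \<omega> by (intro index_less) auto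
      fix j assume j: "j \<in> J"
      let ?m = "real M ^ N"
      have m: "?m > 0" using M by simp
      have p: "approx N \<omega> j \<le> point \<omega> j" "point \<omega> j \<le> approx N \<omega> j + 1 / ?m"
        "\<bar>point \<omega> j - c j\<bar> \<le> real K / ?m"
        using point_bounds[of \<omega> j N] \<omega> j by auto
      have "approx N \<omega> j \<ge> c j - real K / ?m - 1 / ?m" "approx N \<omega> j \<le> c j + real K / ?m"
        using p by (auto simp: abs_le_iff)
      moreover have "real_of_int (corner N a j) = ?m * approx N \<omega> j"
        using m by (simp add: approx_def a_def)
      ultimately have "real_of_int (corner N a j) \<ge> ?m * (c j - real K / ?m - 1 / ?m)"
        "real_of_int (corner N a j) \<le> ?m * (c j + real K / ?m)"
        using m by simp_all
      then show "x j \<le> corner N a j" "corner N a j \<le> y j"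
        using m by (auto simp: x_def y_def algebra_simps)
    qed
    moreover have "\<omega> \<in> I a"
    proof -
      have "real a \<le> real G ^ N * \<omega>" "real G ^ N * \<omega> < real a + 1"
        unfolding a_def index_def using \<omega> G0 by (auto simp: of_nat_nat mult_nonneg_nonneg)
      then show ?thesis using G0 by (auto simp: I_def field_simps)
    qed
    ultimately show "\<omega> \<in> (\<Union>a\<in>A. I a)" by blast
  qed
  then have "emeasure lborel {\<omega>\<in>{0..<1}. \<forall>j\<in>J. \<bar>point \<omega> j - c j\<bar> \<le> real K / real M ^ N}
      \<le> emeasure lborel (\<Union>a\<in>A. I a)"
    using \<open>finite A\<close> by (intro emeasure_mono) (auto simp: I_def)
  also have "\<dots> \<le> (\<Sum>a\<in>A. emeasure lborel (I a))"
    using \<open>finite A\<close> by (intro emeasure_subadditive_finite) (auto simp: I_def)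
  also have "\<dots> = ennreal (real (card A) / real G ^ N)"
    unfolding I using G0 by (simp add: ennreal_of_nat_eq_real_of_nat ennreal_mult'[symmetric])
  also have "\<dots> \<le> ennreal (real (2 * K + 2) ^ card J / real G ^ N)"
  proof -
    have "real (card A) \<le> real ((2 * K + 2) ^ card J)" using cardA by (simp only: of_nat_le_iff)
    then show ?thesis using G0 by (intro ennreal_leI divide_right_mono) (auto simp del: of_nat_add)
  qed
  finally show ?thesis .
qed

end

text \<open>With the other digits fixed, the linear form runs through an arithmetic progression of
  step \<open>\<bar>r j0\<bar>\<close> and length at most 1/4. It meets the neighbourhood of one
  integer only, and at most \<open>2 * card J + 2\<close> digits at \<open>j0\<close> are
  bad.\<close>

lemma card_bad_digits:
  fixes r :: "'n \<Rightarrow> real" and M :: nat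
  assumes J: "finite J" "j0 \<in> J" and M: "card J + 1 \<le> M"
    and r: "r j0 \<noteq> 0" "real M * \<bar>r j0\<bar> \<le> 1 / 4"
  shows "card {d \<in> J \<rightarrow>\<^sub>E {0..<int M}. \<exists>z::int. \<bar>g + (\<Sum>j\<in>J. r j * d j) - z\<bar> < real (card J + 1) * \<bar>r j0\<bar>}
    \<le> (2 * card J + 2) * M ^ (card J - 1)"
proof -
  let ?u = "card J + 1"
  define Bad where "Bad = {d \<in> J \<rightarrow>\<^sub>E {0..<int M}. \<exists>z::int. \<bar>g + (\<Sum>j\<in>J. r j * d j) - z\<bar> < real ?u * \<bar>r j0\<bar>}"
  \<comment> \<open>Bad digit vectors that agree off \<open>j0\<close> have digits at \<open>j0\<close> differing by less than \<open>2 * ?u\<close>,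
    so reducing that digit modulo \<open>2 * ?u\<close> loses nothing.\<close>
  define \<phi> where "\<phi> d = d(j0 := d j0 mod int (2 * ?u))" for d :: "'n \<Rightarrow> int"
  define P where "P = (\<Pi>\<^sub>E j\<in>J. if j = j0 then {0..<int (2 * ?u)} else {0..<int M})"
  have "card Bad \<le> card P"
  proof (rule card_inj_on_le)
    show "finite P" unfolding P_def using J by (intro finite_PiE) auto
    show "\<phi> ` Bad \<subseteq> P" unfolding \<phi>_def P_def Bad_def using J(2) by (auto simp: PiE_iff extensional_def)
    show "inj_on \<phi> Bad"
    proof (rule inj_onI)
      fix d e assume de: "d \<in> Bad" "e \<in> Bad" "\<phi> d = \<phi> e"
      have other: "d j = e j" if "j \<noteq> j0" for j
        using fun_cong[OF de(3), of j] that by (simp add: \<phi>_def)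
      have md: "d j0 mod int (2 * ?u) = e j0 mod int (2 * ?u)"
        using fun_cong[OF de(3), of j0] by (simp add: \<phi>_def)
      obtain z z' :: int where
        z: "\<bar>g + (\<Sum>j\<in>J. r j * d j) - z\<bar> < real ?u * \<bar>r j0\<bar>"
           "\<bar>g + (\<Sum>j\<in>J. r j * e j) - z'\<bar> < real ?u * \<bar>r j0\<bar>"
        using de by (auto simp: Bad_def)
      have range: "0 \<le> d j0" "d j0 < int M" "0 \<le> e j0" "e j0 < int M"
        using de J(2) by (auto simp: Bad_def PiE_iff)
      define D where "D = real_of_int (d j0 - e j0)"
      have D: "\<bar>D\<bar> \<le> real M" using range by (simp add: D_def)
      have diff: "(\<Sum>j\<in>J. r j * d j) - (\<Sum>j\<in>J. r j * e j) = r j0 * D"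
      proof -
        have "(\<Sum>j\<in>J. r j * d j) - (\<Sum>j\<in>J. r j * e j) = (\<Sum>j\<in>J. if j = j0 then r j0 * D else 0)"
          unfolding sum_subtractf[symmetric] using other
          by (intro sum.cong) (auto simp: D_def algebra_simps)
        then show ?thesis using J by simp
      qed
      have bd: "real ?u * \<bar>r j0\<bar> \<le> 1 / 4"
      proof -
        have "real ?u * \<bar>r j0\<bar> \<le> real M * \<bar>r j0\<bar>" using M by (intro mult_right_mono) auto
        then show ?thesis using r(2) by linarith
      qed
      have "\<bar>r j0 * D\<bar> \<le> \<bar>r j0\<bar> * real M" using D by (simp add: abs_mult mult_left_mono)
      then have "\<bar>r j0 * D\<bar> \<le> 1 / 4" using r(2) by (simp add: mult.commute)
      \<comment> \<open>Two margins and the variation of the form, each at most 1/4.\<close>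
      then have "\<bar>real_of_int z - real_of_int z'\<bar> < 1" using z bd diff by linarith
      then have "z = z'" by linarith
      then have "\<bar>r j0 * D\<bar> < 2 * real ?u * \<bar>r j0\<bar>" using z diff by linarith
      then have "\<bar>D\<bar> < 2 * real ?u" using r(1) by (simp add: abs_mult)
      then have "\<bar>d j0 - e j0\<bar> < int (2 * ?u)" unfolding D_def by linarith
      moreover have "int (2 * ?u) dvd d j0 - e j0" using md by (simp only: mod_eq_dvd_iff)
      ultimately have "d j0 - e j0 = 0"
        using dvd_imp_le_int[of "d j0 - e j0" "int (2 * ?u)"] by linarith
      then show "d = e" using other by (intro ext) (metis eq_iff_diff_eq_0)
    qed
  qed
  also have "card P = (\<Prod>j\<in>J. card (if j = j0 then {0..<int (2 * ?u)} else {0..<int M}))"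
    unfolding P_def using J(1) by (rule card_PiE)
  also have "\<dots> = card {0..<int (2 * ?u)} * (\<Prod>j\<in>J - {j0}. card {0..<int M})"
    using J by (subst prod.remove[of J j0]) (auto intro!: prod.cong simp del: card_atLeastLessThan_int)
  also have "\<dots> = (2 * ?u) * (\<Prod>j\<in>J - {j0}. M)"
    by (simp only: card_atLeastLessThan_int diff_zero nat_int)
  also have "\<dots> = (2 * card J + 2) * M ^ (card J - 1)" using J by simp
  finally show ?thesis by (simp add: Bad_def)
qed

text \<open>At the corner of a kept subcube of side \<open>h\<close> the margin is
  \<open>(card J + 1) * Q n * h\<close>. Moving inside the subcube changes the form by at most
  \<open>card J * Q n * h\<close>, so \<open>Q n * h\<close> remains, and the stage condition makes
  this at least \<open>1 / (4 * M ^ 2)\<close> for every \<open>n\<close>.\<close>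

lemma cantor_scheme_avoiding:
  fixes q :: "nat \<Rightarrow> 'n \<Rightarrow> real" and M :: nat and Q :: "nat \<Rightarrow> real"
  assumes J: "finite J" and M: "2 * card J + 2 < M"
    and Q: "\<And>n j. j \<in> J \<Longrightarrow> \<bar>q n j\<bar> \<le> Q n" "\<And>n. \<exists>j\<in>J. \<bar>q n j\<bar> = Q n"
    and Q1: "\<And>n. Q n \<ge> 1" and lac: "\<And>n. Q (Suc n) \<ge> real M * Q n"
  defines "G \<equiv> M ^ card J - (2 * card J + 2) * M ^ (card J - 1)"
  obtains dig where "cantor_scheme J M G dig"
    "\<And>\<omega> n z. 0 \<le> \<omega> \<Longrightarrow> \<omega> < 1 \<Longrightarrow> z \<in> \<int> \<Longrightarrow>
       \<bar>(\<Sum>j\<in>J. q n j * cantor_scheme.point M G dig \<omega> j) - z\<bar> \<ge> 1 / (4 * (real M)\<^sup>2)"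
proof -
  let ?u = "card J + 1"
  have M1: "real M > 1" using M by simp
  \<comment> \<open>At stage \<open>N\<close> the cubes have side \<open>M\<^sup>-\<^sup>N\<close>. The window of values of \<open>Q n\<close> is so chosen that
    \<open>q n\<close> varies by at most a constant on such a cube, so that only one integer matters; by
    lacunarity each stage has to deal with at most one \<open>n\<close>.\<close>
  define stage where "stage N n \<longleftrightarrow> real M ^ N < 4 * real M * Q n \<and> 4 * Q n \<le> real M ^ N" for N n
  define Good where "Good N c = {d \<in> J \<rightarrow>\<^sub>E {0..<int M}. \<forall>n. stage N n \<longrightarrow> (\<forall>z::int.
    \<bar>(\<Sum>j\<in>J. q n j * real_of_int (int M * c j + d j)) / real M ^ Suc N - z\<bar> \<ge> real ?u * Q n / real M ^ Suc N)}"
    for N and c :: "'n \<Rightarrow> int"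
  have Jpos: "card J > 0" using Q(2)[of 0] J by (auto simp: card_gt_0_iff)
  have finP: "finite (J \<rightarrow>\<^sub>E {0..<int M})" using J by (intro finite_PiE) auto
  have cardP: "card (J \<rightarrow>\<^sub>E {0..<int M}) = M ^ card J" using J by (simp add: card_PiE)
  have Qmono: "real M * Q n \<le> Q n'" if "n < n'" for n n'
    using that
  proof (induction n')
    case (Suc n')
    show ?case
    proof (cases "n = n'")
      case False
      then have "real M * Q n \<le> Q n'" using Suc by simp
      also have "\<dots> \<le> real M * Q n'" using M1 Q1[of n'] by simp
      also have "\<dots> \<le> Q (Suc n')" by (rule lac)
      finally show ?thesis .
    qed (use lac in simp)
  qed simp
  have stage_unique: "n = n'" if "stage N n" "stage N n'" for N n n'
  proof (rule ccontr)
    assume "n \<noteq> n'"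
    then consider "n < n'" | "n' < n" by linarith
    then show False
    proof cases
      case 1
      from Qmono[OF 1] that show False by (auto simp: stage_def)
    next
      case 2
      from Qmono[OF 2] that show False by (auto simp: stage_def)
    qed
  qed
  have cardGood: "card (Good N c) \<ge> G" for N c
  proof (cases "\<exists>n. stage N n")
    case False
    then have "Good N c = (J \<rightarrow>\<^sub>E {0..<int M})" by (auto simp: Good_def)
    then show ?thesis by (simp add: cardP G_def)
  next
    case True
    then obtain n where n: "stage N n" by blast
    obtain j0 where j0: "j0 \<in> J" "\<bar>q n j0\<bar> = Q n" using Q(2) by blast
    define r where "r j = q n j / real M ^ Suc N" for j
    define g where "g = (\<Sum>j\<in>J. r j * real_of_int (int M * c j))"
    have rj0: "\<bar>r j0\<bar> = Q n / real M ^ Suc N" using j0 by (simp add: r_def abs_divide)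
    have sum_eq: "(\<Sum>j\<in>J. q n j * real_of_int (int M * c j + d j)) / real M ^ Suc N = g + (\<Sum>j\<in>J. r j * d j)" for d
      unfolding g_def r_def sum.distrib[symmetric] sum_divide_distrib
      by (intro sum.cong refl) (simp add: add_divide_distrib ring_distribs)
    define Bad where "Bad = {d \<in> J \<rightarrow>\<^sub>E {0..<int M}. \<exists>z::int. \<bar>g + (\<Sum>j\<in>J. r j * d j) - z\<bar> < real ?u * \<bar>r j0\<bar>}"
    have "Good N c = (J \<rightarrow>\<^sub>E {0..<int M}) - Bad"
    proof -
      have "(\<forall>n'. stage N n' \<longrightarrow> (\<forall>z::int. P n' z)) \<longleftrightarrow> (\<forall>z. P n z)" for P :: "nat \<Rightarrow> int \<Rightarrow> bool"
        using n stage_unique by blast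
      then have "Good N c = {d \<in> J \<rightarrow>\<^sub>E {0..<int M}. \<forall>z::int.
         \<bar>g + (\<Sum>j\<in>J. r j * d j) - z\<bar> \<ge> real ?u * \<bar>r j0\<bar>}"
        unfolding Good_def rj0 by (simp only: sum_eq times_divide_eq_right) 
      then show ?thesis unfolding Bad_def by (simp add: set_eq_iff) (meson leD leI)
    qed
    moreover have "card Bad \<le> (2 * card J + 2) * M ^ (card J - 1)"
      unfolding Bad_def
    proof (rule card_bad_digits[OF J j0(1)])
      show "r j0 \<noteq> 0" using rj0 Q1[of n] M1 by (auto simp: field_simps)
      show "real M * \<bar>r j0\<bar> \<le> 1 / 4" using n M1 unfolding rj0 stage_def by (simp add: field_simps)
    qed (use M in simp)
    moreover have "card ((J \<rightarrow>\<^sub>E {0..<int M}) - Bad) = M ^ card J - card Bad"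
      using finP by (subst card_Diff_subset) (auto simp: Bad_def cardP intro: finite_subset[OF _ finP])
    ultimately show ?thesis by (simp add: G_def)
  qed
  have G1: "G \<ge> 1"
  proof -
    have "(2 * card J + 2) * M ^ (card J - 1) < M * M ^ (card J - 1)"
      using M by (intro mult_strict_right_mono) auto
    also have "\<dots> = M ^ card J" using Jpos by (simp add: power_eq_if)
    finally show ?thesis by (simp add: G_def)
  qed
  have "\<exists>f. inj_on f {..<G} \<and> f ` {..<G} \<subseteq> Good N c" for N c
  proof -
    have "finite (Good N c)" unfolding Good_def using finP by simp
    then show ?thesis using cardGood[of N c] card_le_inj[of "{..<G}" "Good N c"] by auto
  qed
  then obtain dig where digs: "\<And>N c. inj_on (dig N c) {..<G}" "\<And>N c. dig N c ` {..<G} \<subseteq> Good N c"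
    by metis
  have "dig N c a \<in> J \<rightarrow>\<^sub>E {0..<int M}" if "a < G" for N c a
    using digs(2)[of N c] that by (auto simp: Good_def)
  then interpret cantor_scheme J M G dig
    using J M G1 digs by unfold_locales auto
  have "1 / (4 * (real M)\<^sup>2) \<le> \<bar>(\<Sum>j\<in>J. q n j * point \<omega> j) - real_of_int z\<bar>"
    if \<omega>: "0 \<le> \<omega>" "\<omega> < 1" for \<omega> n z
  proof -
    \<comment> \<open>The least such \<open>N\<close> is the stage of \<open>n\<close>: leastness
      gives the other half of the window, and \<open>Q n \<ge> 1\<close> excludes
      \<open>N = 0\<close>.\<close>
    have "\<exists>N. 4 * Q n \<le> real M ^ N"
      using real_arch_pow[OF M1, of "4 * Q n"] less_imp_le by blast
    then obtain N where N: "4 * Q n \<le> real M ^ N" "\<And>K. K < N \<Longrightarrow> \<not> 4 * Q n \<le> real M ^ K"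
      using exists_least_iff[of "\<lambda>N. 4 * Q n \<le> real M ^ N"] by blast
    have "N \<noteq> 0" using N(1) Q1[of n] by (intro notI) simp
    then have "real M ^ (N - 1) < 4 * Q n" using N(2)[of "N - 1"] by simp
    then have "real M * real M ^ (N - 1) < real M * (4 * Q n)" using M1 by simp
    then have lt: "real M ^ N < 4 * real M * Q n" using \<open>N \<noteq> 0\<close> by (simp add: power_eq_if mult_ac)
    have st: "stage N n" using N(1) lt by (simp add: stage_def)
    define h where "h = 1 / real M ^ Suc N"
    have h: "h > 0" using M1 by (simp add: h_def)
    define c where "c = corner N (index N \<omega>)"
    define d where "d = dig N c (index (Suc N) \<omega> mod G)"
    have "d \<in> Good N c" unfolding d_def using digs(2)[of N c] G1 by auto
    then have "real ?u * Q n / real M ^ Suc N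
        \<le> \<bar>(\<Sum>j\<in>J. q n j * real_of_int (int M * c j + d j)) / real M ^ Suc N - z\<bar>"
      using st unfolding Good_def by blast
    moreover have ap: "approx (Suc N) \<omega> j = real_of_int (int M * c j + d j) / real M ^ Suc N" for j
      unfolding approx_def corner.simps index_div[OF \<omega>(1)] c_def d_def ..
    have "(\<Sum>j\<in>J. q n j * real_of_int (int M * c j + d j)) / real M ^ Suc N = (\<Sum>j\<in>J. q n j * approx (Suc N) \<omega> j)"
      unfolding ap sum_divide_distrib by simp
    ultimately have 1: "real ?u * Q n * h \<le> \<bar>(\<Sum>j\<in>J. q n j * approx (Suc N) \<omega> j) - z\<bar>"
      by (simp add: h_def)
    have 2: "\<bar>(\<Sum>j\<in>J. q n j * point \<omega> j) - (\<Sum>j\<in>J. q n j * approx (Suc N) \<omega> j)\<bar> \<le> real (card J) * (Q n * h)"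
    proof -
      have "\<bar>(\<Sum>j\<in>J. q n j * point \<omega> j) - (\<Sum>j\<in>J. q n j * approx (Suc N) \<omega> j)\<bar>
          = \<bar>\<Sum>j\<in>J. q n j * (point \<omega> j - approx (Suc N) \<omega> j)\<bar>"
        by (simp add: sum_subtractf[symmetric] algebra_simps)
      also have "\<dots> \<le> (\<Sum>j\<in>J. Q n * h)"
      proof (rule order_trans[OF sum_abs], rule sum_mono)
        fix j assume j: "j \<in> J"
        have "\<bar>point \<omega> j - approx (Suc N) \<omega> j\<bar> \<le> h"
          using point_bounds[OF \<omega>(1) j, of "Suc N"] by (simp add: h_def)
        then show "\<bar>q n j * (point \<omega> j - approx (Suc N) \<omega> j)\<bar> \<le> Q n * h"
          unfolding abs_mult using Q(1)[OF j, of n] Q1[of n] by (intro mult_mono) auto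
      qed
      finally show ?thesis by simp
    qed
    have "1 / (4 * (real M)\<^sup>2) \<le> Q n * h"
      using lt M1 by (simp add: h_def field_simps power2_eq_square)
    moreover have "real ?u * Q n * h - real (card J) * (Q n * h) = Q n * h" by (simp add: algebra_simps)
    ultimately show ?thesis using 1 2 by linarith
  qed
  then show ?thesis
    using that cantor_scheme_axioms by (metis Ints_cases)
qed

section \<open>Gaussian averages of characters\<close>

lemma sum_exp_abs_le:
  "(\<Sum>z\<in>{- int R..int R}. exp (- \<bar>real_of_int z\<bar>)) \<le> 2 / (1 - exp (- 1))"
proof -
  have geo: "(\<Sum>n\<in>{..R}. exp (- real n)) \<le> 1 / (1 - exp (- 1))"
  proof -
    have "(\<Sum>n\<in>{..R}. exp (- real n)) = (\<Sum>n<Suc R. exp (- 1) ^ n)"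
      unfolding lessThan_Suc_atMost by (intro sum.cong) (auto simp: exp_of_nat_mult[symmetric])
    also have "\<dots> \<le> (\<Sum>n. exp (- 1 :: real) ^ n)"
      by (intro sum_le_suminf summable_geometric) auto
    also have "\<dots> = 1 / (1 - exp (- 1))" by (rule suminf_geometric) simp
    finally show ?thesis .
  qed
  have "(\<Sum>z\<in>{- int R..int R}. exp (- \<bar>real_of_int z\<bar>))
      \<le> (\<Sum>z\<in>int ` {..R} \<union> (\<lambda>n. - int n) ` {..R}. exp (- \<bar>real_of_int z\<bar>))"
  proof (intro sum_mono2)
    show "{- int R..int R} \<subseteq> int ` {..R} \<union> (\<lambda>n. - int n) ` {..R}"
    proof
      fix z assume z: "z \<in> {- int R..int R}"
      then have "z = int (nat z) \<and> nat z \<le> R \<or> z = - int (nat (- z)) \<and> nat (- z) \<le> R" by auto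
      then show "z \<in> int ` {..R} \<union> (\<lambda>n. - int n) ` {..R}" by (metis UnI1 UnI2 atMost_iff image_eqI)
    qed
  qed auto
  also have "\<dots> \<le> (\<Sum>z\<in>int ` {..R}. exp (- \<bar>real_of_int z\<bar>)) + (\<Sum>z\<in>(\<lambda>n. - int n) ` {..R}. exp (- \<bar>real_of_int z\<bar>))"
    by (subst sum_Un) (auto intro!: sum_nonneg)
  also have "(\<Sum>z\<in>int ` {..R}. exp (- \<bar>real_of_int z\<bar>)) = (\<Sum>n\<in>{..R}. exp (- real n))"
    by (subst sum.reindex) (auto simp: inj_on_def)
  also have "(\<Sum>z\<in>(\<lambda>n. - int n) ` {..R}. exp (- \<bar>real_of_int z\<bar>)) = (\<Sum>n\<in>{..R}. exp (- real n))"
    by (subst sum.reindex) (auto simp: inj_on_def)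
  finally show ?thesis using geo by simp
qed

text \<open>The l1 norm is used because the sum over a box then factors into one-dimensional sums,
  each bounded by two geometric series.\<close>

lemma sum_int_lattice_exp_le:
  fixes F :: "(real ^ 'n) set"
  assumes "finite F" "F \<subseteq> int_lattice"
  shows "(\<Sum>l\<in>F. exp (- (\<Sum>i\<in>UNIV. \<bar>l $ i\<bar>))) \<le> (2 / (1 - exp (- 1))) ^ CARD('n)"
proof -
  define R where "R = nat \<lceil>Max (insert 0 (norm ` F))\<rceil>"
  define P where "P = (UNIV :: 'n set) \<rightarrow>\<^sub>E {- int R..int R}"
  define \<phi> where "\<phi> f = (\<chi> i. real_of_int (f i))" for f :: "'n \<Rightarrow> int"
  have sub: "F \<subseteq> \<phi> ` P"
  proof
    fix l assume l: "l \<in> F"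
    define f where "f i = \<lfloor>l $ i\<rfloor>" for i
    have f: "l $ i = real_of_int (f i)" for i
      using assms(2) l by (auto simp: int_lattice_def f_def elim!: Ints_cases dest!: subsetD)
    have "\<bar>f i\<bar> \<le> int R" for i
    proof -
      have "norm l \<le> Max (insert 0 (norm ` F))" using assms(1) l by (intro Max_ge) auto
      then have "\<bar>real_of_int (f i)\<bar> \<le> Max (insert 0 (norm ` F))"
        using component_le_norm_cart[of l i] by (simp add: f)
      then show ?thesis unfolding R_def by linarith
    qed
    then have "f \<in> P" by (auto simp: P_def abs_le_iff) (metis minus_le_iff)
    moreover have "l = \<phi> f" using f by (simp add: \<phi>_def vec_eq_iff)
    ultimately show "l \<in> \<phi> ` P" by blast
  qed
  have finP: "finite P" unfolding P_def by (intro finite_PiE) auto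
  have "inj_on \<phi> P" by (auto simp: inj_on_def \<phi>_def vec_eq_iff)
  have "(\<Sum>l\<in>F. exp (- (\<Sum>i\<in>UNIV. \<bar>l $ i\<bar>))) \<le> (\<Sum>l\<in>\<phi> ` P. exp (- (\<Sum>i\<in>UNIV. \<bar>l $ i\<bar>)))"
    using sub finP by (intro sum_mono2) auto
  also have "\<dots> = (\<Sum>f\<in>P. \<Prod>i\<in>UNIV. exp (- \<bar>real_of_int (f i)\<bar>))"
    using \<open>inj_on \<phi> P\<close> by (subst sum.reindex) (auto simp: \<phi>_def exp_sum[symmetric] sum_negf)
  also have "\<dots> = (\<Prod>i\<in>(UNIV :: 'n set). \<Sum>z\<in>{- int R..int R}. exp (- \<bar>real_of_int z\<bar>))"
    unfolding P_def by (rule prod_sum_PiE[symmetric]) auto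
  also have "\<dots> \<le> (\<Prod>i\<in>(UNIV :: 'n set). 2 / (1 - exp (- 1)))"
    by (intro prod_mono conjI sum_nonneg sum_exp_abs_le) auto
  finally show ?thesis by simp
qed

abbreviation gauss_PiM :: "'i set \<Rightarrow> ('i \<Rightarrow> real) measure" where
  "gauss_PiM I \<equiv> PiM I (\<lambda>_. density lborel std_normal_density)"

lemma prob_space_std_normal: "prob_space (density lborel std_normal_density)"
  by (rule prob_space_normal_density) simp

lemma prob_space_gauss_PiM: "prob_space (gauss_PiM I)"
  by (intro prob_space_PiM prob_space_std_normal)

lemma integral_gauss_PiM_cis:
  fixes I :: "'i set"
  assumes "finite I"
  shows "(\<integral>w. cis (\<Sum>i\<in>I. t i * w i) \<partial>gauss_PiM I) = of_real (exp (- (\<Sum>i\<in>I. (t i)\<^sup>2) / 2))"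
proof -
  interpret product_prob_space "\<lambda>_ :: 'i. density lborel std_normal_density" I
    by (intro product_prob_spaceI prob_space_std_normal)
  have [measurable]: "cis \<in> borel_measurable borel"
    by (intro borel_measurable_continuous_onI continuous_intros)
  have "cis (\<Sum>i\<in>I. t i * w i) = (\<Prod>i\<in>I. cis (t i * w i))" for w
    by (simp add: cis_conv_exp exp_sum[OF assms] sum_distrib_left)
  then have "(\<integral>w. cis (\<Sum>i\<in>I. t i * w i) \<partial>gauss_PiM I) = (\<integral>w. (\<Prod>i\<in>I. cis (t i * w i)) \<partial>gauss_PiM I)"
    by simp
  also have "\<dots> = (\<Prod>i\<in>I. \<integral>x. cis (t i * x) \<partial>density lborel std_normal_density)"
    by (rule product_integral_prod[OF assms]) (intro finite_measure.integrable_const_bound[of _ _ 1]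
        prob_space.finite_measure prob_space_std_normal; simp)
  also have "\<dots> = (\<Prod>i\<in>I. char std_normal_distribution (t i))"
    by (simp add: char_def cis_conv_exp)
  also have "\<dots> = of_real (exp (\<Sum>i\<in>I. - (t i)\<^sup>2 / 2))"
    by (simp only: char_std_normal_distribution of_real_prod[symmetric] exp_sum[OF assms])
  finally show ?thesis by (simp add: sum_negf sum_divide_distrib)
qed

lemma torus_char_sum: "finite I \<Longrightarrow> torus_char l (\<Sum>i\<in>I. w i *\<^sub>R b i) = cis (\<Sum>i\<in>I. 2 * pi * (l \<bullet> b i) * w i)"
  by (simp add: torus_char_def inner_sum_right sum_distrib_left mult_ac)

text \<open>By Fubini \<open>Y\<close> contributes only a factor of modulus 1 to an explicit
  Gaussian integral. The bound thus holds for every law of \<open>Y\<close>, also one carried by a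
  Cantor set.\<close>

lemma fourier_gauss_le:
  fixes Y :: "'w \<Rightarrow> real ^ 'n" and b :: "'i \<Rightarrow> real ^ 'n"
  assumes "prob_space U" "finite I" and Y [measurable]: "Y \<in> borel_measurable U"
  shows "cmod (\<integral>x. torus_char l (Y (fst x) + (\<Sum>i\<in>I. snd x i *\<^sub>R b i)) \<partial>(U \<Otimes>\<^sub>M gauss_PiM I))
    \<le> exp (- 2 * pi\<^sup>2 * (\<Sum>i\<in>I. (l \<bullet> b i)\<^sup>2))"
proof -
  interpret U: prob_space U by fact
  interpret P: prob_space "gauss_PiM I" by (rule prob_space_gauss_PiM)
  interpret UP: pair_prob_space U "gauss_PiM I" ..
  have [measurable]: "torus_char l \<in> borel_measurable borel"
    by (intro borel_measurable_continuous_onI continuous_on_torus_char)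
  let ?e = "exp (- 2 * pi\<^sup>2 * (\<Sum>i\<in>I. (l \<bullet> b i)\<^sup>2))"
  have inner: "(\<integral>w. torus_char l (Y \<omega> + (\<Sum>i\<in>I. w i *\<^sub>R b i)) \<partial>gauss_PiM I) = torus_char l (Y \<omega>) * of_real ?e" for \<omega>
  proof -
    have "(\<integral>w. torus_char l (Y \<omega> + (\<Sum>i\<in>I. w i *\<^sub>R b i)) \<partial>gauss_PiM I)
        = torus_char l (Y \<omega>) * (\<integral>w. cis (\<Sum>i\<in>I. 2 * pi * (l \<bullet> b i) * w i) \<partial>gauss_PiM I)"
      by (simp add: torus_char_add_right torus_char_sum[OF assms(2)])
    also have "(\<integral>w. cis (\<Sum>i\<in>I. 2 * pi * (l \<bullet> b i) * w i) \<partial>gauss_PiM I) = of_real ?e"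
    proof -
      have "(\<Sum>i\<in>I. (2 * pi * (l \<bullet> b i))\<^sup>2) = 4 * pi\<^sup>2 * (\<Sum>i\<in>I. (l \<bullet> b i)\<^sup>2)"
        by (simp add: power_mult_distrib sum_distrib_left mult.assoc)
      then show ?thesis by (simp add: integral_gauss_PiM_cis[OF assms(2)])
    qed
    finally show ?thesis .
  qed
  have "(\<integral>x. torus_char l (Y (fst x) + (\<Sum>i\<in>I. snd x i *\<^sub>R b i)) \<partial>(U \<Otimes>\<^sub>M gauss_PiM I))
      = (\<integral>\<omega>. (\<integral>w. torus_char l (Y \<omega> + (\<Sum>i\<in>I. w i *\<^sub>R b i)) \<partial>gauss_PiM I) \<partial>U)"
    by (subst UP.integral_fst'[symmetric]) (auto intro!: UP.integrable_const_bound[of _ 1])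
  also have "cmod \<dots> \<le> (\<integral>\<omega>. ?e \<partial>U)"
    unfolding inner by (rule order_trans[OF integral_norm_bound]) (simp add: norm_mult)
  finally show ?thesis by (simp add: U.prob_space)
qed

text \<open>Completing the square, \<open>A * t \<le> t ^ 2 + A ^ 2 / 4\<close>, trades Gaussian
  decay in the directions \<open>b i\<close> for exponential decay in the full l1 norm, which is
  summable over the lattice.\<close>

lemma gauss_weight_le:
  fixes l :: "real ^ 'n" and b :: "'i \<Rightarrow> real ^ 'n" and A C :: real
  assumes "finite I" and l: "(\<Sum>i\<in>UNIV. \<bar>l $ i\<bar>) \<le> C + A * (\<Sum>i\<in>I. \<bar>l \<bullet> b i\<bar>)"
  shows "exp (- 2 * pi\<^sup>2 * (\<Sum>i\<in>I. (l \<bullet> b i)\<^sup>2))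
    \<le> exp (C + card I * A\<^sup>2 / 4) * exp (- (\<Sum>i\<in>UNIV. \<bar>l $ i\<bar>))"
proof -
  have "A * (\<Sum>i\<in>I. \<bar>l \<bullet> b i\<bar>) \<le> (\<Sum>i\<in>I. (l \<bullet> b i)\<^sup>2 + A\<^sup>2 / 4)"
    unfolding sum_distrib_left
  proof (rule sum_mono)
    fix i
    have "0 \<le> (\<bar>l \<bullet> b i\<bar> - A / 2)\<^sup>2" by simp
    then show "A * \<bar>l \<bullet> b i\<bar> \<le> (l \<bullet> b i)\<^sup>2 + A\<^sup>2 / 4"
      by (simp add: power2_diff power_divide algebra_simps)
  qed
  also have "\<dots> = (\<Sum>i\<in>I. (l \<bullet> b i)\<^sup>2) + card I * A\<^sup>2 / 4" by (simp add: sum.distrib)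
  also have "(\<Sum>i\<in>I. (l \<bullet> b i)\<^sup>2) \<le> 2 * pi\<^sup>2 * (\<Sum>i\<in>I. (l \<bullet> b i)\<^sup>2)"
  proof -
    have "1 \<le> pi\<^sup>2" using pi_gt3 by (intro one_le_power) auto
    then have "1 \<le> 2 * pi\<^sup>2" by simp
    moreover have "0 \<le> (\<Sum>i\<in>I. (l \<bullet> b i)\<^sup>2)" by (intro sum_nonneg) simp
    ultimately show ?thesis using mult_right_mono[of 1 "2 * pi\<^sup>2" "\<Sum>i\<in>I. (l \<bullet> b i)\<^sup>2"] by simp
  qed
  finally show ?thesis using l by (simp add: exp_add[symmetric])
qed

text \<open>For \<open>u\<close> with bounded orbit, pairing with \<open>\<kappa> n\<close> is
  bounded in \<open>n\<close>. Writing the unit vectors as such \<open>u\<close> plus combinations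
  of the \<open>b j\<close> shows that the size of \<open>\<kappa> n - \<kappa> m\<close> is seen,
  up to constants, on the \<open>b j\<close> alone. The correlations therefore decay exponentially
  in its l1 norm, and there are only countably many \<open>k\<close>.\<close>

lemma AE_Eq:
  fixes S :: "int ^ 'n ^ 'n" and Y :: "'w \<Rightarrow> real ^ 'n" and b :: "'i \<Rightarrow> real ^ 'n"
  assumes S: "toral_endomorphism S" "quasihyperbolic S"
    and span: "\<And>x. \<exists>u c. u \<in> bounded_orbits (real_matrix S) \<and> x = u + (\<Sum>i\<in>I. c i *\<^sub>R b i)"
    and U: "prob_space U" "finite I" and Y [measurable]: "Y \<in> borel_measurable U"
  shows "AE x in U \<Otimes>\<^sub>M gauss_PiM I. to_torus (Y (fst x) + (\<Sum>i\<in>I. snd x i *\<^sub>R b i)) \<in> Eq S"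
proof -
  interpret U: prob_space U by fact
  interpret P: prob_space "gauss_PiM I" by (rule prob_space_gauss_PiM)
  interpret UP: pair_prob_space U "gauss_PiM I" ..
  define X where "X x = Y (fst x) + (\<Sum>i\<in>I. snd x i *\<^sub>R b i)" for x
  have X [measurable]: "X \<in> borel_measurable (U \<Otimes>\<^sub>M gauss_PiM I)"
    unfolding X_def by measurable
  have [measurable]: "torus_char l \<in> borel_measurable borel" for l :: "real ^ 'n"
    by (intro borel_measurable_continuous_onI continuous_on_torus_char)
  have char: "AE x in U \<Otimes>\<^sub>M gauss_PiM I.
      (\<lambda>N. (\<Sum>n<N. torus_char k (((*v) (real_matrix S) ^^ n) (X x))) / of_nat N) \<longlonglongrightarrow> 0"
    if k: "k \<in> int_lattice - {0}" for k :: "real ^ 'n"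
  proof -
    define \<kappa> where "\<kappa> n = ((*v) (real_matrix (transpose S)) ^^ n) k" for n
    have char_eq: "torus_char k (((*v) (real_matrix S) ^^ n) v) = torus_char (\<kappa> n) v" for n v
      by (simp add: torus_char_def \<kappa>_def inner_funpow_transpose)
    have \<kappa>_int: "\<kappa> n \<in> int_lattice" for n unfolding \<kappa>_def using k by (intro int_lattice_funpow) auto
    have inj: "inj \<kappa>"
      unfolding \<kappa>_def[abs_def] using S k by (intro inj_orbit_transpose) (auto simp: toral_endomorphism_def)
    have "\<forall>i. \<exists>u c. u \<in> bounded_orbits (real_matrix S) \<and> axis i 1 = u + (\<Sum>j\<in>I. c j *\<^sub>R b j)"
      using span by blast
    then obtain u c where uc: "\<And>i. u i \<in> bounded_orbits (real_matrix S)"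
      "\<And>i. axis i 1 = u i + (\<Sum>j\<in>I. c i j *\<^sub>R b j)" by metis
    have "\<forall>i. \<exists>B. \<forall>n. norm (((*v) (real_matrix S) ^^ n) (u i)) \<le> B"
      using uc(1) by (auto simp: bounded_orbits_def bounded_iff)
    then obtain B where B: "\<And>i n. norm (((*v) (real_matrix S) ^^ n) (u i)) \<le> B i" by metis
    define C where "C = (\<Sum>i\<in>UNIV. 2 * norm k * B i)"
    define A where "A = (\<Sum>i\<in>UNIV. \<Sum>j\<in>I. \<bar>c i j\<bar>)"
    have l_le: "(\<Sum>i\<in>UNIV. \<bar>(\<kappa> n - \<kappa> m) $ i\<bar>) \<le> C + A * (\<Sum>j\<in>I. \<bar>(\<kappa> n - \<kappa> m) \<bullet> b j\<bar>)" for n m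
    proof -
      let ?l = "\<kappa> n - \<kappa> m"
      let ?t = "\<Sum>j\<in>I. \<bar>?l \<bullet> b j\<bar>"
      have "\<bar>?l $ i\<bar> \<le> 2 * norm k * B i + (\<Sum>j\<in>I. \<bar>c i j\<bar>) * ?t" for i
      proof -
        have "?l $ i = ?l \<bullet> axis i 1" by (simp add: inner_axis)
        also have "\<dots> = ?l \<bullet> u i + (\<Sum>j\<in>I. c i j * (?l \<bullet> b j))"
          by (subst uc(2)) (simp only: inner_add_right inner_sum_right inner_scaleR_right)
        finally have "\<bar>?l $ i\<bar> \<le> \<bar>?l \<bullet> u i\<bar> + \<bar>\<Sum>j\<in>I. c i j * (?l \<bullet> b j)\<bar>" by simp
        moreover have "\<bar>?l \<bullet> u i\<bar> \<le> 2 * norm k * B i"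
        proof -
          have "\<bar>\<kappa> n' \<bullet> u i\<bar> \<le> norm k * B i" for n'
            unfolding \<kappa>_def inner_funpow_transpose
            by (rule order_trans[OF Cauchy_Schwarz_ineq2]) (intro mult_left_mono B norm_ge_zero)
          from this[of n] this[of m] show ?thesis unfolding inner_diff_left by linarith
        qed
        moreover have "\<bar>\<Sum>j\<in>I. c i j * (?l \<bullet> b j)\<bar> \<le> (\<Sum>j\<in>I. \<bar>c i j\<bar> * ?t)"
        proof (rule order_trans[OF sum_abs], rule sum_mono)
          fix j assume "j \<in> I"
          then have "\<bar>?l \<bullet> b j\<bar> \<le> ?t" using U(2) by (intro member_le_sum) auto
          then show "\<bar>c i j * (?l \<bullet> b j)\<bar> \<le> \<bar>c i j\<bar> * ?t" by (simp add: abs_mult mult_left_mono)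
        qed
        ultimately show ?thesis by (simp add: sum_distrib_right)
      qed
      then have "(\<Sum>i\<in>UNIV. \<bar>?l $ i\<bar>) \<le> (\<Sum>i\<in>UNIV. 2 * norm k * B i + (\<Sum>j\<in>I. \<bar>c i j\<bar>) * ?t)"
        by (intro sum_mono)
      also have "\<dots> = C + A * ?t" by (simp only: sum.distrib C_def A_def sum_distrib_right)
      finally show ?thesis .
    qed
    define E where "E = exp (C + card I * A\<^sup>2 / 4)"
    define a where "a n m = E * exp (- (\<Sum>i\<in>UNIV. \<bar>(\<kappa> n - \<kappa> m) $ i\<bar>))" for n m
    have "AE x in U \<Otimes>\<^sub>M gauss_PiM I. (\<lambda>N. (\<Sum>n<N. torus_char (\<kappa> n) (X x)) / of_nat N) \<longlonglongrightarrow> 0"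
    proof (rule UP.AE_cesaro_tendsto_0[where a = a and C = "E * (2 / (1 - exp (- 1))) ^ CARD('n)"])
      show "cmod (\<integral>x. torus_char (\<kappa> n) (X x) * cnj (torus_char (\<kappa> m) (X x)) \<partial>(U \<Otimes>\<^sub>M gauss_PiM I)) \<le> a n m" for n m
        unfolding torus_char_mult_cnj X_def a_def E_def
        by (rule order_trans[OF fourier_gauss_le[OF U Y] gauss_weight_le[OF U(2) l_le]])
      show "(\<Sum>m<N. a n m) \<le> E * (2 / (1 - exp (- 1))) ^ CARD('n)" for n N
      proof -
        \<comment> \<open>For fixed \<open>n\<close> these are distinct lattice vectors, so the row
          sum is part of one sum over the lattice.\<close>
        have "inj_on (\<lambda>m. \<kappa> n - \<kappa> m) {..<N}" using inj by (auto simp: inj_on_def)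
        then have "(\<Sum>m<N. a n m) = E * (\<Sum>l\<in>(\<lambda>m. \<kappa> n - \<kappa> m) ` {..<N}. exp (- (\<Sum>i\<in>UNIV. \<bar>l $ i\<bar>)))"
          unfolding a_def by (subst sum.reindex) (auto simp: sum_distrib_left)
        also have "\<dots> \<le> E * (2 / (1 - exp (- 1))) ^ CARD('n)"
          using \<kappa>_int by (intro mult_left_mono sum_int_lattice_exp_le) (auto simp: E_def intro: int_lattice_diff)
        finally show ?thesis .
      qed
    qed auto
    then show ?thesis by (simp only: char_eq)
  qed
  have "AE x in U \<Otimes>\<^sub>M gauss_PiM I. \<forall>k \<in> int_lattice - {0}.
      (\<lambda>N. (\<Sum>n<N. torus_char k (((*v) (real_matrix S) ^^ n) (X x))) / of_nat N) \<longlonglongrightarrow> 0"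
    by (rule AE_ball_countable') (use char countable_int_lattice in auto)
  then show ?thesis
  proof eventually_elim
    case (elim x)
    then show ?case unfolding X_def[symmetric] by (intro Eq_weyl_criterion) auto
  qed
qed

section \<open>The random point\<close>

text \<open>A basis of \<open>V\<close> is extended to the whole space and indexed by the coordinate
  type, so that \<open>- I\<close> indexes a complement of \<open>V\<close>. The constant
  \<open>L\<close> exists because an injective linear map is bounded below.\<close>

lemma adapted_basis:
  fixes V :: "(real ^ 'n) set"
  assumes "subspace V"
  obtains I :: "'n set" and b :: "'n \<Rightarrow> real ^ 'n" and L :: real where
    "\<And>i. i \<in> I \<Longrightarrow> b i \<in> V"
    "\<And>v. v \<in> V \<Longrightarrow> \<exists>c. v = (\<Sum>i\<in>I. c i *\<^sub>R b i)"
    "\<And>v. \<exists>c. v = (\<Sum>i\<in>UNIV. c i *\<^sub>R b i)"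
    "L > 0" "\<And>c i. \<bar>c i\<bar> \<le> L * norm (\<Sum>i\<in>UNIV. c i *\<^sub>R b i)"
proof -
  obtain B1 where B1: "B1 \<subseteq> V" "independent B1" "V \<subseteq> span B1"
    using maximal_independent_subset[of V] by metis
  obtain B2 where B2: "B1 \<subseteq> B2" "independent B2" "UNIV \<subseteq> span B2"
    using maximal_independent_subset_extend[OF subset_UNIV B1(2)] by metis
  have fin: "finite B2" using B2(2) by (rule independent_imp_finite)
  have "card B2 = dim (UNIV :: (real ^ 'n) set)"
    using B2 by (intro basis_card_eq_dim) auto
  then have "card B2 = CARD('n)" by simp
  then obtain b where b: "bij_betw b (UNIV :: 'n set) B2"
    using fin finite_same_card_bij[of "UNIV :: 'n set" B2] by auto
  define I where "I = b -` B1"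
  have bI: "b ` I = B1" using b B2(1) by (auto simp: I_def bij_betw_def)
  have injb: "inj b" using b by (simp add: bij_betw_def)
  have rep: "\<exists>c. v = (\<Sum>i\<in>X. c i *\<^sub>R b i)" if "v \<in> span (b ` X)" for v X
  proof -
    have "finite (b ` X)" by simp
    with that have "v \<in> range (\<lambda>u. \<Sum>x\<in>b ` X. u x *\<^sub>R x)" by (simp only: span_finite)
    then obtain u where "v = (\<Sum>x\<in>b ` X. u x *\<^sub>R x)" by blast
    then have "v = (\<Sum>i\<in>X. u (b i) *\<^sub>R b i)"
      by (simp add: sum.reindex[OF inj_on_subset[OF injb subset_UNIV]])
    then show ?thesis by (intro exI[of _ "\<lambda>i. u (b i)"])
  qed
  define f where "f w = (\<Sum>i\<in>UNIV. w $ i *\<^sub>R b i)" for w :: "real ^ 'n"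
  have lin: "linear f"
    by (auto simp: f_def linear_iff sum.distrib scaleR_add_left scaleR_sum_right)
  have "w = 0" if "f w = 0" for w
  proof -
    have "(\<Sum>x\<in>B2. (w $ inv b x) *\<^sub>R x) = f w"
      unfolding f_def using sum.reindex_bij_betw[OF b, of "\<lambda>x. (w $ inv b x) *\<^sub>R x"] injb by simp
    then have "w $ inv b x = 0" if "x \<in> B2" for x
      using independentD[OF B2(2) fin subset_refl] \<open>f w = 0\<close> that by metis
    then have "w $ i = 0" for i using b injb by (metis bij_betwE UNIV_I inv_f_f)
    then show ?thesis by (simp add: vec_eq_iff)
  qed
  then have "inj f" using lin by (simp add: linear_injective_0)
  then obtain B where B: "B > 0" "\<And>w. B * norm w \<le> norm (f w)"
    using linear_inj_bounded_below_pos[OF lin] by blast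
  show ?thesis
  proof (rule that[of I b "1 / B"])
    show "\<exists>c. v = (\<Sum>i\<in>UNIV. c i *\<^sub>R b i)" for v
      using rep[of v UNIV] B2(3) b by (auto simp: bij_betw_def)
    show "\<bar>c i\<bar> \<le> 1 / B * norm (\<Sum>i\<in>UNIV. c i *\<^sub>R b i)" for c i
    proof -
      have "\<bar>c i\<bar> \<le> norm (\<chi> i. c i)" using component_le_norm_cart[of "\<chi> i. c i" i] by simp
      then have "B * \<bar>c i\<bar> \<le> B * norm (\<chi> i. c i)" using B(1) by (intro mult_left_mono) auto
      also have "\<dots> \<le> norm (\<Sum>i\<in>UNIV. c i *\<^sub>R b i)" using B(2)[of "\<chi> i. c i"] by (simp add: f_def)
      finally show ?thesis using B(1) by (simp add: field_simps)
    qed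
  qed (use bI B1 B(1) rep[of _ I] in auto)
qed

text \<open>On \<open>I\<close> the functionals are bounded. Expanding \<open>\<kappa> n\<close> in
  the basis and pairing it with itself shows that its growth, of exact order
  \<open>\<rho> ^ n\<close>, must appear on \<open>- I\<close>. The two-sided bound lets
  \<open>Q\<close> grow by any prescribed factor in a fixed number of steps.\<close>

lemma lacunary_functionals:
  fixes T :: "int ^ 'n ^ 'n" and b :: "'n \<Rightarrow> real ^ 'n"
  assumes T: "det T \<noteq> 0" "quasihyperbolic T"
    and I: "\<And>i. i \<in> I \<Longrightarrow> b i \<in> bounded_orbits (real_matrix T)"
    and b: "\<And>v. \<exists>c. v = (\<Sum>i\<in>UNIV. c i *\<^sub>R b i)"
    and L: "L > 0" "\<And>c i. \<bar>c i\<bar> \<le> L * norm (\<Sum>i\<in>UNIV. c i *\<^sub>R b i)"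
  obtains k C0 Q where "k \<in> int_lattice" "C0 > 0" "- I \<noteq> {}"
    "\<And>n i. i \<in> I \<Longrightarrow> \<bar>((*v) (real_matrix (transpose T)) ^^ n) k \<bullet> b i\<bar> \<le> C0"
    "\<And>n j. j \<in> - I \<Longrightarrow> \<bar>((*v) (real_matrix (transpose T)) ^^ n) k \<bullet> b j\<bar> \<le> Q n"
    "\<And>n. \<exists>j\<in>- I. \<bar>((*v) (real_matrix (transpose T)) ^^ n) k \<bullet> b j\<bar> = Q n"
    "\<And>n. 1 \<le> Q n" "\<And>m::real. \<exists>p>0. \<forall>n. m * Q n \<le> Q (n + p)"
proof -
  obtain k0 \<rho> a C where k0: "k0 \<in> int_lattice" "\<rho> > 1" "a > 0" "C > 0"
    and lower: "\<And>n. a * \<rho> ^ n \<le> norm (((*v) (real_matrix (transpose T)) ^^ n) k0)"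
    and upper: "\<And>n. norm (((*v) (real_matrix (transpose T)) ^^ n) k0) \<le> C * \<rho> ^ n"
    using exponential_orbit[of "transpose T"] inj_orbit_transpose[OF T] by blast
  define \<kappa> where "\<kappa> n = ((*v) (real_matrix (transpose T)) ^^ n) k0" for n
  have "\<exists>B. \<forall>n. \<bar>\<kappa> n \<bullet> b i\<bar> \<le> B" if i: "i \<in> I" for i
  proof -
    obtain B where B: "\<And>n. norm (((*v) (real_matrix T) ^^ n) (b i)) \<le> B"
      using I[OF i] by (auto simp: bounded_orbits_def bounded_iff)
    have "\<bar>\<kappa> n \<bullet> b i\<bar> \<le> norm k0 * B" for n
      unfolding \<kappa>_def inner_funpow_transpose
      by (rule order_trans[OF Cauchy_Schwarz_ineq2]) (intro mult_left_mono B norm_ge_zero)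
    then show ?thesis by blast
  qed
  then obtain B0 where B0: "\<And>n i. i \<in> I \<Longrightarrow> \<bar>\<kappa> n \<bullet> b i\<bar> \<le> B0 i" by metis
  define C0 where "C0 = 1 + (\<Sum>i\<in>I. \<bar>B0 i\<bar>)"
  have C0: "C0 > 0" unfolding C0_def by (intro add_pos_nonneg sum_nonneg) auto
  have C0b: "\<bar>\<kappa> n \<bullet> b i\<bar> \<le> C0" if "i \<in> I" for n i
  proof -
    have "\<bar>B0 i\<bar> \<le> (\<Sum>i\<in>I. \<bar>B0 i\<bar>)" using that by (intro member_le_sum) auto
    then show ?thesis using B0[OF that, of n] by (simp add: C0_def)
  qed
  define d where "d = real CARD('n)"
  have d: "d > 0" by (simp add: d_def)
  \<comment> \<open>The inserted 0 makes the maximum meaningful before \<open>- I\<close> is known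
    to be nonempty.\<close>
  define Q0 where "Q0 n = Max (insert 0 ((\<lambda>j. \<bar>\<kappa> n \<bullet> b j\<bar>) ` (- I)))" for n
  have Q0: "Q0 n \<ge> 0" "\<And>j. j \<in> - I \<Longrightarrow> \<bar>\<kappa> n \<bullet> b j\<bar> \<le> Q0 n" for n
    unfolding Q0_def by (auto intro!: Max_ge)
  have "norm (\<kappa> n) \<le> L * (d * (C0 + Q0 n))" for n
  proof -
    obtain c where c: "\<kappa> n = (\<Sum>i\<in>UNIV. c i *\<^sub>R b i)" using b by blast
    have "norm (\<kappa> n) * norm (\<kappa> n) = \<kappa> n \<bullet> (\<Sum>i\<in>UNIV. c i *\<^sub>R b i)"
      using c by (simp add: dot_square_norm power2_eq_square)
    also have "\<dots> = (\<Sum>i\<in>UNIV. c i * (\<kappa> n \<bullet> b i))" by (simp add: inner_sum_right)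
    also have "\<dots> \<le> (\<Sum>i\<in>(UNIV :: 'n set). L * norm (\<kappa> n) * (C0 + Q0 n))"
    proof (rule sum_mono)
      fix i
      have "\<bar>\<kappa> n \<bullet> b i\<bar> \<le> C0 + Q0 n"
        using C0b[of i n] Q0(1)[of n] Q0(2)[of i n] C0 by (cases "i \<in> I") auto
      moreover have "\<bar>c i\<bar> \<le> L * norm (\<kappa> n)" using L(2)[of c i] c by simp
      ultimately have "\<bar>c i * (\<kappa> n \<bullet> b i)\<bar> \<le> L * norm (\<kappa> n) * (C0 + Q0 n)"
        unfolding abs_mult using L(1) by (intro mult_mono) auto
      then show "c i * (\<kappa> n \<bullet> b i) \<le> L * norm (\<kappa> n) * (C0 + Q0 n)" by linarith
    qed
    also have "\<dots> = L * (d * (C0 + Q0 n)) * norm (\<kappa> n)" by (simp add: d_def algebra_simps)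
    finally have le: "norm (\<kappa> n) * norm (\<kappa> n) \<le> L * (d * (C0 + Q0 n)) * norm (\<kappa> n)" .
    show ?thesis
    proof (cases "norm (\<kappa> n) = 0")
      case True
      then show ?thesis using L(1) d C0 Q0(1)[of n] by simp
    next
      case False
      then show ?thesis
        using le by (simp add: mult_le_cancel_right)
    qed
  qed
  then have low: "a * \<rho> ^ n \<le> L * d * C0 + L * d * Q0 n" for n
    using lower[of n] by (simp add: \<kappa>_def algebra_simps) (metis order_trans)
  define a' where "a' = a / (2 * L * d)"
  have a': "a' > 0" using k0 L d by (simp add: a'_def)
  \<comment> \<open>From \<open>n0\<close> on the bounded part is less than half of
    \<open>a * \<rho> ^ n\<close>, and the maximum is at least 1; the orbit is restarted
    there.\<close>
  obtain n0 where n0: "2 * L * d * C0 / a + 1 / a' < \<rho> ^ n0"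
    using real_arch_pow[OF k0(2)] by blast
  have Q0_low: "a' * \<rho> ^ n \<le> Q0 n \<and> 1 \<le> Q0 n" if "n \<ge> n0" for n
  proof -
    have "\<rho> ^ n0 \<le> \<rho> ^ n" using that k0 by (intro power_increasing) auto
    moreover have "0 \<le> 2 * L * d * C0 / a" "0 \<le> 1 / a'" using a' L d C0 k0 by auto
    ultimately have 1: "2 * L * d * C0 / a < \<rho> ^ n" "1 / a' < \<rho> ^ n" using n0 by linarith+
    then have "2 * L * d * C0 < a * \<rho> ^ n" using k0 by (simp add: field_simps)
    then have "a * \<rho> ^ n \<le> 2 * L * d * Q0 n" using low[of n] by linarith
    then have "a' * \<rho> ^ n \<le> Q0 n" using L d by (simp add: a'_def field_simps)
    moreover have "1 \<le> a' * \<rho> ^ n" using 1(2) a' by (simp add: field_simps)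
    ultimately show ?thesis by linarith
  qed
  have attained: "\<exists>j\<in>- I. \<bar>\<kappa> n \<bullet> b j\<bar> = Q0 n" if "n \<ge> n0" for n
  proof -
    have "Q0 n \<in> insert 0 ((\<lambda>j. \<bar>\<kappa> n \<bullet> b j\<bar>) ` (- I))" unfolding Q0_def by (intro Max_in) auto
    then show ?thesis using Q0_low[OF that] by auto
  qed
  define Bm where "Bm = (\<Sum>j\<in>UNIV. norm (b j)) * C + 1"
  have Bm: "Bm > 0" unfolding Bm_def using k0 by (intro add_nonneg_pos mult_nonneg_nonneg sum_nonneg) auto
  have Q0_up: "Q0 n \<le> Bm * \<rho> ^ n" for n
    unfolding Q0_def
  proof (rule Max.boundedI)
    fix x assume "x \<in> insert 0 ((\<lambda>j. \<bar>\<kappa> n \<bullet> b j\<bar>) ` (- I))"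
    then consider "x = 0" | j where "x = \<bar>\<kappa> n \<bullet> b j\<bar>" by auto
    then show "x \<le> Bm * \<rho> ^ n"
    proof cases
      case 2
      have "x \<le> norm (\<kappa> n) * norm (b j)" unfolding 2 by (rule Cauchy_Schwarz_ineq2)
      also have "\<dots> \<le> (C * \<rho> ^ n) * (\<Sum>j\<in>UNIV. norm (b j))"
        using upper[of n] k0 by (intro mult_mono member_le_sum) (auto simp: \<kappa>_def)
      also have "\<dots> \<le> Bm * \<rho> ^ n" using k0 by (simp add: Bm_def algebra_simps)
      finally show ?thesis .
    qed (use Bm k0 in simp)
  qed auto
  have shift: "((*v) (real_matrix (transpose T)) ^^ n) (\<kappa> n0) = \<kappa> (n + n0)" for n
    by (simp add: \<kappa>_def funpow_add)
  show ?thesis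
  proof (rule that[of "\<kappa> n0" C0 "\<lambda>n. Q0 (n + n0)"])
    show "\<kappa> n0 \<in> int_lattice" unfolding \<kappa>_def using k0(1) by (rule int_lattice_funpow)
    show "- I \<noteq> {}" using attained[of n0] by auto
    show "\<exists>p>0. \<forall>n. m * Q0 (n + n0) \<le> Q0 (n + p + n0)" for m
    proof -
      \<comment> \<open>\<open>\<rho> ^ p\<close> has to beat \<open>m\<close> times the ratio of
        upper to lower bound; the successor in \<open>p\<close> only ensures
        \<open>p > 0\<close>.\<close>
      obtain p0 where p0: "\<bar>m\<bar> * Bm / a' < \<rho> ^ p0" using real_arch_pow[OF k0(2)] by blast
      define p where "p = Suc p0"
      have "\<rho> ^ p0 \<le> \<rho> ^ p" unfolding p_def using k0 by (intro power_increasing) auto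
      then have "\<bar>m\<bar> * Bm / a' \<le> \<rho> ^ p" using p0 by linarith
      then have p: "\<bar>m\<bar> * Bm \<le> a' * \<rho> ^ p" using a' by (simp add: field_simps)
      have "m * Q0 (n + n0) \<le> Q0 (n + p + n0)" for n
      proof -
        have "m * Q0 (n + n0) \<le> \<bar>m\<bar> * Q0 (n + n0)" using Q0(1) by (intro mult_right_mono) auto
        also have "\<dots> \<le> \<bar>m\<bar> * (Bm * \<rho> ^ (n + n0))" by (intro mult_left_mono Q0_up) auto
        also have "\<dots> \<le> a' * \<rho> ^ p * \<rho> ^ (n + n0)"
          unfolding mult.assoc[symmetric] using p k0 by (intro mult_right_mono) auto
        also have "\<dots> = a' * \<rho> ^ (n + p + n0)" by (simp add: power_add)
        also have "\<dots> \<le> Q0 (n + p + n0)" using Q0_low by simp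
        finally show ?thesis .
      qed
      then show ?thesis by (intro exI[of _ p]) (simp add: p_def)
    qed
  qed (use C0 C0b Q0 Q0_low attained in \<open>auto simp: shift\<close>)
qed

section \<open>Small-ball estimates for the Gaussian and the Cantor factor\<close>

lemma emeasure_std_normal_Icc_le:
  assumes "r \<ge> 0" shows "emeasure (density lborel std_normal_density) {c - r..c + r} \<le> ennreal (2 * r)"
proof -
  have "emeasure (density lborel std_normal_density) {c - r..c + r}
      = (\<integral>\<^sup>+x. ennreal (std_normal_density x) * indicator {c - r..c + r} x \<partial>lborel)"
    by (rule emeasure_density) auto
  also have "\<dots> \<le> (\<integral>\<^sup>+x. indicator {c - r..c + r} x \<partial>lborel)"
  proof (rule nn_integral_mono)
    fix x :: real
    have "1 \<le> sqrt (2 * pi)" using pi_gt3 by simp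
    then have "1 / sqrt (2 * pi) * exp (- x\<^sup>2 / 2) \<le> 1 * 1" by (intro mult_mono) auto
    then have "ennreal (std_normal_density x) \<le> 1" by (simp add: std_normal_density_def)
    then show "ennreal (std_normal_density x) * indicator {c - r..c + r} x \<le> indicator {c - r..c + r} x"
      by (auto simp: indicator_def)
  qed
  also have "\<dots> = ennreal (2 * r)" using assms by simp
  finally show ?thesis .
qed

lemma emeasure_std_normal_Icc_pos:
  assumes "a < b" shows "emeasure (density lborel std_normal_density) {a..b} > 0"
proof (rule ccontr)
  assume "\<not> ?thesis"
  then have "{a..b} \<in> null_sets (density lborel std_normal_density)" by auto
  then have "AE x in lborel. x \<in> {a..b} \<longrightarrow> ennreal (std_normal_density x) = 0"
    by (simp add: null_sets_density_iff)
  moreover have "ennreal (std_normal_density x) \<noteq> 0" for x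
    using normal_density_pos[of 1 0 x] by (simp add: ennreal_eq_0_iff)
  ultimately have "AE x in lborel. x \<notin> {a..b}" by simp
  then have "{a..b} \<in> null_sets lborel" by (subst AE_iff_null_sets) auto
  then show False using assms by (simp add: null_sets_def)
qed

lemma gauss_PiM_box:
  assumes "finite I" "\<And>i. i \<in> I \<Longrightarrow> A i \<in> sets borel"
  shows "emeasure (gauss_PiM I) (Pi\<^sub>E I A) = (\<Prod>i\<in>I. emeasure (density lborel std_normal_density) (A i))"
proof -
  interpret product_prob_space "\<lambda>_ :: 'a. density lborel std_normal_density" I
    by (intro product_prob_spaceI prob_space_std_normal)
  show ?thesis using assms by (intro emeasure_PiM) auto
qed

text \<open>Take the scale \<open>K\<close> with \<open>1 / M ^ Suc K < r \<le> 1 / M ^ K\<close> in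
  \<open>emeasure_point_le\<close>. Then \<open>1 / G ^ K \<le> (1 / M ^ K) powr \<sigma>\<close>
  turns mass into a power of \<open>r\<close>; the factor \<open>M powr \<sigma>\<close> pays for
  rounding \<open>r\<close> to a scale.\<close>

lemma (in cantor_scheme) emeasure_point_powr_le:
  assumes \<sigma>: "0 < \<sigma>" "real M powr \<sigma> \<le> real G" and r: "0 < r" "r \<le> 1" and L: "L > 0"
  shows "emeasure lborel {\<omega>\<in>{0..<1}. \<forall>j\<in>J. \<bar>point \<omega> j - c j\<bar> \<le> L * r}
    \<le> ennreal (real (2 * nat \<lceil>L\<rceil> + 2) ^ card J * real M powr \<sigma> * r powr \<sigma>)"
proof -
  have M1: "real M > 1" using M by simp
  have "\<exists>N. 1 / r < real M ^ N" using real_arch_pow[OF M1] by blast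
  then obtain N where N: "1 / r < real M ^ N" "\<And>K. K < N \<Longrightarrow> \<not> 1 / r < real M ^ K"
    using exists_least_iff[of "\<lambda>N. 1 / r < real M ^ N"] by blast
  have "N \<noteq> 0" using N(1) r by (intro notI) (simp add: field_simps)
  then obtain K where K: "N = Suc K" by (metis not0_implies_Suc)
  have rK: "r \<le> 1 / real M ^ K" "1 / real M ^ K < real M * r"
    using N(1) N(2)[of K] r M1 by (auto simp: K field_simps not_less)
  define l where "l = nat \<lceil>L\<rceil>"
  have lL: "L \<le> real l" unfolding l_def by linarith
  have "emeasure lborel {\<omega>\<in>{0..<1}. \<forall>j\<in>J. \<bar>point \<omega> j - c j\<bar> \<le> L * r}
    \<le> emeasure lborel {\<omega>\<in>{0..<1}. \<forall>j\<in>J. \<bar>point \<omega> j - c j\<bar> \<le> real l / real M ^ K}"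
  proof (rule emeasure_mono)
    have "L * r \<le> real l / real M ^ K"
      using mult_mono[OF lL rK(1)] L r by simp
    then show "{\<omega>\<in>{0..<1}. \<forall>j\<in>J. \<bar>point \<omega> j - c j\<bar> \<le> L * r}
      \<subseteq> {\<omega>\<in>{0..<1}. \<forall>j\<in>J. \<bar>point \<omega> j - c j\<bar> \<le> real l / real M ^ K}"
      by (auto intro: order_trans)
    show "{\<omega>\<in>{0..<1}. \<forall>j\<in>J. \<bar>point \<omega> j - c j\<bar> \<le> real l / real M ^ K} \<in> sets lborel"
      using fin by measurable
  qed
  also have "\<dots> \<le> ennreal (real (2 * l + 2) ^ card J / real G ^ K)" by (rule emeasure_point_le)
  also have "\<dots> \<le> ennreal (real (2 * l + 2) ^ card J * (real M powr \<sigma> * r powr \<sigma>))"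
  proof (intro ennreal_leI)
    have "(real M powr \<sigma>) ^ K \<le> real G ^ K" using \<sigma> by (intro power_mono) auto
    then have "1 / real G ^ K \<le> 1 / (real M powr \<sigma>) ^ K" using M1 G by (intro divide_left_mono) auto
    also have "\<dots> = (1 / real M ^ K) powr \<sigma>"
      using M1 by (simp add: powr_divide powr_realpow[symmetric] powr_powr mult.commute)
    also have "\<dots> \<le> (real M * r) powr \<sigma>" using rK \<sigma> M1 by (intro powr_mono2) auto
    also have "\<dots> = real M powr \<sigma> * r powr \<sigma>" by (rule powr_mult)
    finally have "1 / real G ^ K \<le> real M powr \<sigma> * r powr \<sigma>" .
    then have "real (2 * l + 2) ^ card J * (1 / real G ^ K) \<le> real (2 * l + 2) ^ card J * (real M powr \<sigma> * r powr \<sigma>)"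
      by (intro mult_left_mono) auto
    then show "real (2 * l + 2) ^ card J / real G ^ K \<le> real (2 * l + 2) ^ card J * (real M powr \<sigma> * r powr \<sigma>)"
      by simp
  qed
  finally show ?thesis by (simp only: l_def mult.assoc)
qed

text \<open>The kept proportion is \<open>1 - (2 * u + 2) / M\<close>, at least 1/2 for
  \<open>M\<close> above \<open>2 * (2 * u + 2)\<close>, whereas \<open>M powr - \<eta>\<close>
  falls below 1/2.\<close>

lemma exists_base:
  fixes u :: nat and \<eta> :: real
  assumes "\<eta> > 0" "u > 0"
  obtains M :: nat where "2 * u + 2 < M"
    "real M powr (real u - \<eta>) \<le> real (M ^ u - (2 * u + 2) * M ^ (u - 1))"
proof -
  have "(\<lambda>M. real M powr - \<eta>) \<longlonglongrightarrow> 0"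
    using assms(1) by (intro tendsto_neg_powr filterlim_real_sequentially) auto
  then have "\<forall>\<^sub>F M in sequentially. real M powr - \<eta> < 1 / 2" by (rule order_tendstoD) simp
  then have ev: "\<forall>\<^sub>F M in sequentially. real M powr - \<eta> < 1 / 2 \<and> 2 * (2 * u + 2) < M"
    using eventually_gt_at_top[of "2 * (2 * u + 2)"] by (rule eventually_conj)
  obtain M where M: "real M powr - \<eta> < 1 / 2" "2 * (2 * u + 2) < M"
    using eventually_happens'[OF sequentially_bot ev] by blast
  have M0: "real M > 0" using M by simp
  have pw: "M ^ u = M * M ^ (u - 1)" using assms(2) by (simp add: power_eq_if)
  have "2 * ((2 * u + 2) * M ^ (u - 1)) \<le> M ^ u"
    unfolding pw mult.assoc[symmetric] using M(2) by (intro mult_right_mono) auto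
  then have "M ^ u \<le> 2 * (M ^ u - (2 * u + 2) * M ^ (u - 1))" by linarith
  then have "real (M ^ u) \<le> 2 * real (M ^ u - (2 * u + 2) * M ^ (u - 1))" by linarith
  moreover have "real M powr (real u - \<eta>) = real M ^ u * real M powr - \<eta>"
    using M0 by (simp add: powr_diff powr_realpow powr_minus divide_inverse)
  moreover have "real M ^ u * real M powr - \<eta> \<le> real M ^ u * (1 / 2)"
    using M(1) by (intro mult_left_mono) auto
  ultimately have "real M powr (real u - \<eta>) \<le> real (M ^ u - (2 * u + 2) * M ^ (u - 1))" by simp
  moreover have "2 * u + 2 < M" using M(2) by simp
  ultimately show ?thesis by (intro that)
qed

lemma prod_le_power_ennreal:
  fixes f :: "'a \<Rightarrow> ennreal"
  assumes "\<And>i. i \<in> I \<Longrightarrow> f i \<le> c"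
  shows "prod f I \<le> c ^ card I"
  using assms by (induction I rule: infinite_finite_induct) (auto intro: mult_mono)

lemma norm_unit_cube_le: "v \<in> unit_cube \<Longrightarrow> norm (v :: real ^ 'n) \<le> real CARD('n)"
proof -
  assume v: "v \<in> unit_cube"
  have "norm v \<le> (\<Sum>i\<in>UNIV. \<bar>v $ i\<bar>)" by (rule norm_le_l1_cart)
  also have "\<dots> \<le> (\<Sum>i\<in>(UNIV :: 'n set). 1)"
    using v by (intro sum_mono) (auto simp: unit_cube_def less_imp_le)
  finally show ?thesis by simp
qed

lemma prob_space_uniform_unit: "prob_space (uniform_measure lborel {0..<1::real})"
  by (intro prob_space_uniform_measure) auto

lemma emeasure_uniform_unit:
  "A \<in> sets borel \<Longrightarrow> A \<subseteq> {0..<1::real} \<Longrightarrow> emeasure (uniform_measure lborel {0..<1}) A = emeasure lborel A"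
  by (subst emeasure_uniform_measure) (auto simp: Int_absorb1 divide_ennreal_def)

locale cantor_gauss = cantor_scheme J M G dig
  for J :: "'n::finite set" and M G dig +
  fixes I :: "'n set" and b :: "'n \<Rightarrow> real ^ 'n" and L \<tau> :: real
  assumes I: "I = - J" and \<tau>: "\<tau> > 0" and L: "L > 0"
    and rep: "\<And>v. \<exists>c. v = (\<Sum>i\<in>UNIV. c i *\<^sub>R b i)"
    and coord: "\<And>c i. \<bar>c i\<bar> \<le> L * norm (\<Sum>i\<in>UNIV. c i *\<^sub>R b i)"
begin

definition Y :: "real \<Rightarrow> real ^ 'n" where
  "Y \<omega> = (\<Sum>j\<in>J. point \<omega> j *\<^sub>R b j)"

definition \<xi> :: "real \<times> ('n \<Rightarrow> real) \<Rightarrow> real ^ 'n" where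
  "\<xi> x = Y (fst x) + (\<Sum>i\<in>I. snd x i *\<^sub>R b i)"

abbreviation \<mu> :: "(real \<times> ('n \<Rightarrow> real)) measure" where
  "\<mu> \<equiv> uniform_measure lborel {0..<1} \<Otimes>\<^sub>M gauss_PiM I"

text \<open>Truncation of the Gaussian coordinates as an event of positive measure. Equidistribution
  is almost sure for the full law; avoidance is claimed on \<open>A\<close> only.\<close>

definition A :: "(real \<times> ('n \<Rightarrow> real)) set" where
  "A = {0..<1} \<times> (I \<rightarrow>\<^sub>E {- \<tau>..\<tau>})"

lemma prob_space_\<mu>: "prob_space \<mu>"
proof -
  interpret A1: prob_space "uniform_measure lborel {0..<1::real}" by (rule prob_space_uniform_unit)
  interpret A2: prob_space "gauss_PiM I" by (rule prob_space_gauss_PiM)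
  interpret pair_prob_space "uniform_measure lborel {0..<1::real}" "gauss_PiM I" ..
  show ?thesis by (rule P.prob_space_axioms)
qed

lemma measurable_Y [measurable]: "Y \<in> borel_measurable borel"
  unfolding Y_def by measurable

lemma measurable_\<xi> [measurable]: "\<xi> \<in> borel_measurable \<mu>"
proof -
  have [measurable]: "Y \<in> borel_measurable (uniform_measure lborel {0..<1})"
    using measurable_Y by (simp add: measurable_def)
  show ?thesis unfolding \<xi>_def by measurable
qed

lemma emeasure_times:
  assumes "B \<in> sets borel" "B \<subseteq> {0..<1}" "\<And>i. i \<in> I \<Longrightarrow> H i \<in> sets borel"
  shows "B \<times> Pi\<^sub>E I H \<in> sets \<mu>"
    "emeasure \<mu> (B \<times> Pi\<^sub>E I H) = emeasure lborel B * (\<Prod>i\<in>I. emeasure (density lborel std_normal_density) (H i))"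
proof -
  interpret P: prob_space "gauss_PiM I" by (rule prob_space_gauss_PiM)
  have s: "Pi\<^sub>E I H \<in> sets (gauss_PiM I)" using assms(3) by (intro sets_PiM_I_finite) auto
  show "B \<times> Pi\<^sub>E I H \<in> sets \<mu>" using assms(1) s by (intro pair_measureI) auto
  have "emeasure \<mu> (B \<times> Pi\<^sub>E I H) = emeasure (uniform_measure lborel {0..<1}) B * emeasure (gauss_PiM I) (Pi\<^sub>E I H)"
    using assms(1) s by (intro P.emeasure_pair_measure_Times) auto
  then show "emeasure \<mu> (B \<times> Pi\<^sub>E I H) = emeasure lborel B * (\<Prod>i\<in>I. emeasure (density lborel std_normal_density) (H i))"
    by (simp only: emeasure_uniform_unit[OF assms(1,2)] gauss_PiM_box[OF finite assms(3)])
qed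

lemma A: "A \<in> sets \<mu>" "emeasure \<mu> A > 0"
proof -
  show "A \<in> sets \<mu>" unfolding A_def by (rule emeasure_times) auto
  have "emeasure \<mu> A = (\<Prod>i\<in>I. emeasure (density lborel std_normal_density) {- \<tau>..\<tau>})"
    unfolding A_def by (subst emeasure_times) auto
  also have "\<dots> \<noteq> 0" using emeasure_std_normal_Icc_pos[of "- \<tau>" \<tau>] \<tau> by (auto simp: zero_less_iff_neq_zero)
  finally show "emeasure \<mu> A > 0" by (simp add: zero_less_iff_neq_zero)
qed

text \<open>On \<open>A\<close> the lift \<open>\<xi>\<close> is bounded, so only finitely many
  lattice translates of the ball matter. For each of them all basis coordinates lie in intervals of
  half-length \<open>L * r\<close>; the product law gives order \<open>r powr \<sigma>\<close> from
  the Cantor coordinates together and order \<open>r\<close> from each Gaussian one.\<close>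

lemma emeasure_ball_le:
  assumes \<sigma>: "0 < \<sigma>" "real M powr \<sigma> \<le> real G"
  obtains C where "C > 0" "\<And>x r. 0 < r \<Longrightarrow> r \<le> 1 \<Longrightarrow>
    emeasure \<mu> ((\<lambda>w. to_torus (\<xi> w)) -` cball x r \<inter> A) \<le> ennreal (C * r powr (\<sigma> + card I))"
proof -
  \<comment> \<open>Bounds for the lift of the centre in the unit cube, for \<open>\<xi>\<close> on
    \<open>A\<close>, and for the radius \<open>r \<le> 1\<close>, added up.\<close>
  define R where "R = real CARD('n) + (\<Sum>i\<in>UNIV. (1 + \<tau>) * norm (b i)) + 1"
  define Z where "Z = {z :: real ^ 'n. z \<in> int_lattice \<and> norm z \<le> R}"
  have finZ: "finite Z" unfolding Z_def by (rule finite_int_lattice_bounded)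
  define C1 where "C1 = real (2 * nat \<lceil>L\<rceil> + 2) ^ card J * real M powr \<sigma>"
  have C1: "C1 \<ge> 0" by (simp add: C1_def)
  define C where "C = real (card Z) * (C1 * (2 * L) ^ card I) + 1"
  have C: "C > 0" unfolding C_def using C1 L by (intro add_nonneg_pos mult_nonneg_nonneg) auto
  obtain cf where cf: "\<And>v. v = (\<Sum>i\<in>UNIV. cf v i *\<^sub>R b i)" using rep by metis
  have "emeasure \<mu> ((\<lambda>w. to_torus (\<xi> w)) -` cball x r \<inter> A) \<le> ennreal (C * r powr (\<sigma> + card I))"
    if r: "0 < r" "r \<le> 1" for x r
  proof -
    obtain a where a: "x = to_torus a" "a \<in> unit_cube" by (rule to_torus_unit_cube_cases)
    define F where "F z = {\<omega>\<in>{0..<1}. \<forall>j\<in>J. \<bar>point \<omega> j - cf (a - z) j\<bar> \<le> L * r}" for z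
    define H where "H z i = {cf (a - z) i - L * r..cf (a - z) i + L * r}" for z i
    have F: "F z \<in> sets borel" "F z \<subseteq> {0..<1}" for z
      unfolding F_def using fin by (measurable, auto)
    have H: "H z i \<in> sets borel" for z i by (simp add: H_def)
    have sub: "(\<lambda>w. to_torus (\<xi> w)) -` cball x r \<inter> A \<subseteq> (\<Union>z\<in>Z. F z \<times> Pi\<^sub>E I (H z))"
    proof
      fix y assume y: "y \<in> (\<lambda>w. to_torus (\<xi> w)) -` cball x r \<inter> A"
      obtain \<omega> w where yw: "y = (\<omega>, w)" by (cases y)
      have \<omega>: "0 \<le> \<omega>" "\<omega> < 1" and w: "w \<in> I \<rightarrow>\<^sub>E {- \<tau>..\<tau>}" using y yw by (auto simp: A_def)
      have "dist (to_torus a) (to_torus (\<xi> y)) \<le> r" using y a by simp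
      then obtain z where z: "z \<in> int_lattice" "norm (a - \<xi> y - z) \<le> r"
        using infdist_int_lattice_attained[of "a - \<xi> y"] unfolding dist_to_torus by metis
      define c where "c i = (if i \<in> I then w i else point \<omega> i)" for i
      have \<xi>: "\<xi> y = (\<Sum>i\<in>UNIV. c i *\<^sub>R b i)"
      proof -
        have "(\<Sum>i\<in>UNIV. c i *\<^sub>R b i) = (\<Sum>i\<in>J \<union> I. c i *\<^sub>R b i)" by (simp add: I)
        also have "\<dots> = (\<Sum>i\<in>J. c i *\<^sub>R b i) + (\<Sum>i\<in>I. c i *\<^sub>R b i)"
          by (rule sum.union_disjoint) (auto simp: I)
        also have "\<dots> = \<xi> y"
          unfolding \<xi>_def Y_def yw by (auto simp: c_def I intro!: arg_cong2[where f = "(+)"] sum.cong)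
        finally show ?thesis by simp
      qed
      have c_le: "\<bar>c i\<bar> \<le> 1 + \<tau>" for i
      proof (cases "i \<in> I")
        case True
        then have "- \<tau> \<le> w i \<and> w i \<le> \<tau>" using w by (auto simp: PiE_iff)
        then show ?thesis using True by (simp add: c_def abs_le_iff)
      next
        case False
        then show ?thesis using point_in_unit[OF \<omega>(1), of i] \<tau> by (simp add: c_def I)
      qed
      have "norm (\<xi> y) \<le> (\<Sum>i\<in>UNIV. (1 + \<tau>) * norm (b i))"
        unfolding \<xi> using c_le by (intro sum_norm_le) (auto intro: mult_right_mono)
      moreover have "norm a \<le> real CARD('n)" using a(2) by (rule norm_unit_cube_le)
      moreover have "norm z \<le> norm a + norm (\<xi> y) + norm (a - \<xi> y - z)"
        using norm_triangle_ineq4[of "a - \<xi> y" "a - \<xi> y - z"] norm_triangle_ineq4[of a "\<xi> y"] by simp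
      ultimately have "z \<in> Z" using z r by (simp add: Z_def R_def)
      have close: "\<bar>c i - cf (a - z) i\<bar> \<le> L * r" for i
      proof -
        have "(\<Sum>i\<in>UNIV. (c i - cf (a - z) i) *\<^sub>R b i) = \<xi> y - (a - z)"
          using cf[of "a - z"] by (simp add: \<xi> scaleR_diff_left sum_subtractf)
        then have "\<bar>c i - cf (a - z) i\<bar> \<le> L * norm (\<xi> y - (a - z))"
          using coord[of "\<lambda>i. c i - cf (a - z) i" i] by simp
        also have "norm (\<xi> y - (a - z)) \<le> r"
          using z(2) by (simp add: norm_minus_commute algebra_simps)
        finally show ?thesis using L by simp
      qed
      have "\<omega> \<in> F z" using \<omega> close by (auto simp: F_def c_def I) (metis ComplD)
      moreover have "w \<in> Pi\<^sub>E I (H z)"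
      proof (rule PiE_I)
        show "w i \<in> H z i" if "i \<in> I" for i
          using close[of i] that by (simp add: H_def c_def abs_le_iff)
        show "w i = undefined" if "i \<notin> I" for i using w that by (rule PiE_arb)
      qed
      ultimately show "y \<in> (\<Union>z\<in>Z. F z \<times> Pi\<^sub>E I (H z))" using \<open>z \<in> Z\<close> yw by blast
    qed
    have "emeasure \<mu> ((\<lambda>w. to_torus (\<xi> w)) -` cball x r \<inter> A) \<le> emeasure \<mu> (\<Union>z\<in>Z. F z \<times> Pi\<^sub>E I (H z))"
      using finZ F H by (intro emeasure_mono sub sets.finite_UN emeasure_times) auto
    also have "\<dots> \<le> (\<Sum>z\<in>Z. emeasure \<mu> (F z \<times> Pi\<^sub>E I (H z)))"
      using finZ F H by (intro emeasure_subadditive_finite) (auto intro: emeasure_times)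
    also have "\<dots> \<le> (\<Sum>z\<in>Z. ennreal (C1 * (2 * L) ^ card I * r powr (\<sigma> + card I)))"
    proof (rule sum_mono)
      fix z
      have "emeasure \<mu> (F z \<times> Pi\<^sub>E I (H z)) = emeasure lborel (F z) * (\<Prod>i\<in>I. emeasure (density lborel std_normal_density) (H z i))"
        using F H by (intro emeasure_times)
      also have "\<dots> \<le> ennreal (C1 * r powr \<sigma>) * ennreal (2 * (L * r)) ^ card I"
      proof (intro mult_mono prod_le_power_ennreal)
        show "emeasure lborel (F z) \<le> ennreal (C1 * r powr \<sigma>)"
          unfolding F_def C1_def by (intro emeasure_point_powr_le \<sigma> r L)
        show "emeasure (density lborel std_normal_density) (H z i) \<le> ennreal (2 * (L * r))" for i
          unfolding H_def using L r by (intro emeasure_std_normal_Icc_le) auto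
      qed auto
      also have "\<dots> = ennreal (C1 * r powr \<sigma> * (2 * (L * r)) ^ card I)"
      proof -
        have "ennreal (2 * (L * r)) ^ card I = ennreal ((2 * (L * r)) ^ card I)"
          using L r by (intro ennreal_power) auto
        moreover have "0 \<le> (2 * (L * r)) ^ card I" using L r by simp
        ultimately show ?thesis using C1 by (simp only: ennreal_mult''[symmetric])
      qed
      also have "C1 * r powr \<sigma> * (2 * (L * r)) ^ card I = C1 * (2 * L) ^ card I * r powr (\<sigma> + card I)"
        using r by (simp add: powr_add powr_realpow power_mult_distrib)
      finally show "emeasure \<mu> (F z \<times> Pi\<^sub>E I (H z)) \<le> ennreal (C1 * (2 * L) ^ card I * r powr (\<sigma> + card I))" .
    qed
    also have "\<dots> = ennreal (real (card Z) * (C1 * (2 * L) ^ card I * r powr (\<sigma> + card I)))"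
      by (simp add: ennreal_of_nat_eq_real_of_nat ennreal_mult'[symmetric])
    also have "\<dots> \<le> ennreal (C * r powr (\<sigma> + card I))"
      by (intro ennreal_leI) (simp add: C_def distrib_right mult.assoc)
    finally show ?thesis .
  qed
  then show ?thesis using that C by blast
qed

end

theorem corollary1p3:
  fixes T :: "int ^ 'n ^ 'n"
    and S :: "'k \<Rightarrow> int ^ 'n ^ 'n"
    and K :: "'k set"
  assumes "toral_automorphism T" "quasihyperbolic T"
    and "countable K"
    and "\<And>k. k \<in> K \<Longrightarrow> toral_endomorphism (S k)"
    and "\<And>k. k \<in> K \<Longrightarrow> quasihyperbolic (S k)"
    and "\<And>k. k \<in> K \<Longrightarrow>
      subspace_sum
        (subspace_sum (contracted_space (S k)) (unimodular_eigenspaces (S k)))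
        (subspace_sum (contracted_space T) (unimodular_eigenspaces T)) = UNIV"
  shows "hausdorff_dim ((\<Inter>k\<in>K. Eq (S k)) \<inter> ND T) = of_nat CARD('n)"
proof -
  define E where "E = (\<Inter>k\<in>K. Eq (S k)) \<inter> ND T"
  define V where "V = bounded_orbits (real_matrix T)"
  have subV: "subspace V" unfolding V_def by (rule subspace_bounded_orbits)
  obtain I :: "'n set" and b :: "'n \<Rightarrow> real ^ 'n" and L :: real where
    bV: "\<And>i. i \<in> I \<Longrightarrow> b i \<in> V"
    and Vb: "\<And>v. v \<in> V \<Longrightarrow> \<exists>c. v = (\<Sum>i\<in>I. c i *\<^sub>R b i)"
    and rep: "\<And>v. \<exists>c. v = (\<Sum>i\<in>UNIV. c i *\<^sub>R b i)"
    and L: "L > 0" "\<And>c i. \<bar>c i\<bar> \<le> L * norm (\<Sum>i\<in>UNIV. c i *\<^sub>R b i)"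
  proof (rule adapted_basis[OF subV], goal_cases)
    case (1 I b L)
    show ?case by (rule 1(1)) (fact 1)+
  qed
  have detT: "det T \<noteq> 0" using assms(1) by (auto simp: toral_automorphism_def)
  obtain k C0 Q where k: "k \<in> int_lattice" and C0: "C0 > 0" and "- I \<noteq> {}"
    and kI: "\<And>n i. i \<in> I \<Longrightarrow> \<bar>((*v) (real_matrix (transpose T)) ^^ n) k \<bullet> b i\<bar> \<le> C0"
    and kJ: "\<And>n j. j \<in> - I \<Longrightarrow> \<bar>((*v) (real_matrix (transpose T)) ^^ n) k \<bullet> b j\<bar> \<le> Q n"
      "\<And>n. \<exists>j\<in>- I. \<bar>((*v) (real_matrix (transpose T)) ^^ n) k \<bullet> b j\<bar> = Q n"
    and Q: "\<And>n. 1 \<le> Q n" "\<And>m::real. \<exists>p>0. \<forall>n. m * Q n \<le> Q (n + p)"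
  proof (rule lacunary_functionals[where T = T and b = b and I = I and L = L], goal_cases)
    case (3 i)
    then show ?case using bV by (simp add: V_def)
  next
    case (7 k C0 Q)
    show ?case by (rule 7(1)) (fact 7)+
  qed (rule detT assms(2) rep L)+
  define \<kappa> where "\<kappa> n = ((*v) (real_matrix (transpose T)) ^^ n) k" for n
  define J where "J = - I"
  have u: "card J > 0" using \<open>- I \<noteq> {}\<close> by (simp add: J_def card_gt_0_iff)
  have cards: "card I + card J = CARD('n)"
    unfolding J_def by (subst card_Un_disjoint[symmetric]) auto
  have "hausdorff_measure t E > 0" if t: "0 \<le> t" "t < real CARD('n)" for t
  proof -
    \<comment> \<open>Above \<open>t\<close> for the mass distribution principle, and above
      \<open>CARD('n) - 1 \<ge> card I\<close> so that the Cantor exponent \<open>\<sigma>\<close>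
      is positive.\<close>
    define s where "s = (max t (real CARD('n) - 1) + real CARD('n)) / 2"
    have s: "t \<le> s" "s < real CARD('n)" "real CARD('n) - 1 < s" using t by (auto simp: s_def)
    define \<sigma> where "\<sigma> = s - real (card I)"
    have "real (card I) \<le> real CARD('n) - 1" using cards u by linarith
    then have \<sigma>0: "\<sigma> > 0" using s by (simp add: \<sigma>_def)
    have s0: "s > 0" using \<sigma>0 by (simp add: \<sigma>_def)
    obtain M where M: "2 * card J + 2 < M"
      "real M powr (real (card J) - (real CARD('n) - s)) \<le> real (M ^ card J - (2 * card J + 2) * M ^ (card J - 1))"
      using exists_base[of "real CARD('n) - s" "card J"] s u by auto
    define G where "G = M ^ card J - (2 * card J + 2) * M ^ (card J - 1)"
    have "real (card J) - (real CARD('n) - s) = \<sigma>" unfolding \<sigma>_def using cards by linarith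
    then have \<sigma>: "real M powr \<sigma> \<le> real G" using M(2) by (simp add: G_def)
    obtain p where p: "p > 0" "\<And>n. real M * Q n \<le> Q (n + p)" using Q(2)[of "real M"] by blast
    \<comment> \<open>Sampling along multiples of \<open>p\<close> makes the functionals lacunary
      with ratio \<open>M\<close>.\<close>
    define q where "q n j = \<kappa> (p * n) \<bullet> b j" for n j
    obtain dig where dig: "cantor_scheme J M G dig"
      and avoid: "\<And>\<omega> n z. 0 \<le> \<omega> \<Longrightarrow> \<omega> < 1 \<Longrightarrow> z \<in> \<int> \<Longrightarrow>
       \<bar>(\<Sum>j\<in>J. q n j * cantor_scheme.point M G dig \<omega> j) - z\<bar> \<ge> 1 / (4 * (real M)\<^sup>2)"
    proof (rule cantor_scheme_avoiding[of J M q "\<lambda>n. Q (p * n)"])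
      show "\<bar>q n j\<bar> \<le> Q (p * n)" if "j \<in> J" for n j using kJ(1) that by (simp add: q_def \<kappa>_def J_def)
      show "\<exists>j\<in>J. \<bar>q n j\<bar> = Q (p * n)" for n using kJ(2) by (simp add: q_def \<kappa>_def J_def)
      show "real M * Q (p * n) \<le> Q (p * Suc n)" for n using p(2)[of "p * n"] by (simp add: add.commute)
    qed (use M(1) Q(1) in \<open>auto simp: G_def\<close>)
    define \<epsilon> where "\<epsilon> = 1 / (4 * (real M)\<^sup>2)"
    have \<epsilon>: "\<epsilon> > 0" using M(1) by (simp add: \<epsilon>_def)
    \<comment> \<open>With Gaussian coordinates below \<open>\<tau>\<close> the functionals move by
      at most \<open>\<epsilon> / 2\<close>, half of the margin left by the Cantor set.\<close>
    define \<tau> where "\<tau> = \<epsilon> / (2 * (real CARD('n) * C0))"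
    have \<tau>: "\<tau> > 0" using \<epsilon> C0 by (simp add: \<tau>_def)
    interpret cantor_scheme J M G dig by (rule dig)
    interpret cantor_gauss J M G dig I b L \<tau>
      by unfold_locales (use \<tau> L rep in \<open>auto simp: J_def\<close>)
    interpret \<mu>: prob_space \<mu> by (rule prob_space_\<mu>)
    have ND: "to_torus (\<xi> x) \<in> ND T" if x: "x \<in> A" for x
    proof (rule ND_I[OF k, where \<epsilon> = "\<epsilon> / 2" and p = p])
      fix n z assume z: "z \<in> (\<int> :: real set)"
      obtain \<omega> w where xw: "x = (\<omega>, w)" "0 \<le> \<omega>" "\<omega> < 1" "w \<in> I \<rightarrow>\<^sub>E {- \<tau>..\<tau>}"
        using x by (cases x) (auto simp: A_def)
      have eq: "\<kappa> (p * n) \<bullet> \<xi> x = (\<Sum>j\<in>J. q n j * point \<omega> j) + (\<Sum>i\<in>I. w i * (\<kappa> (p * n) \<bullet> b i))"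
        by (simp add: \<xi>_def Y_def xw q_def inner_add_right inner_sum_right mult.commute)
      have "\<bar>\<Sum>i\<in>I. w i * (\<kappa> (p * n) \<bullet> b i)\<bar> \<le> (\<Sum>i\<in>I. \<tau> * C0)"
      proof (rule order_trans[OF sum_abs], rule sum_mono)
        fix i assume i: "i \<in> I"
        have "\<bar>w i\<bar> \<le> \<tau>" using xw(4) i by (auto simp: PiE_iff abs_le_iff)
        then show "\<bar>w i * (\<kappa> (p * n) \<bullet> b i)\<bar> \<le> \<tau> * C0"
          unfolding abs_mult \<kappa>_def using kI[OF i] \<tau> by (intro mult_mono) auto
      qed
      also have "\<dots> \<le> real CARD('n) * (\<tau> * C0)"
        using \<tau> C0 cards by (simp add: mult_right_mono)
      also have "\<dots> = \<epsilon> / 2" using C0 by (simp add: \<tau>_def)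
      finally show "\<epsilon> / 2 \<le> \<bar>((*v) (real_matrix (transpose T)) ^^ (p * n)) k \<bullet> \<xi> x - z\<bar>"
        using avoid[OF xw(2,3) z, of n] unfolding \<epsilon>_def[symmetric] \<kappa>_def[symmetric] eq by linarith
    qed (use \<epsilon> p in auto)
    have AE_Eq_S: "AE x in \<mu>. to_torus (\<xi> x) \<in> Eq (S l)" if l: "l \<in> K" for l
      unfolding \<xi>_def
    proof (rule AE_Eq)
      show "\<exists>v c. v \<in> bounded_orbits (real_matrix (S l)) \<and> x = v + (\<Sum>i\<in>I. c i *\<^sub>R b i)" for x
      proof -
        have "x \<in> subspace_sum
          (subspace_sum (contracted_space (S l)) (unimodular_eigenspaces (S l)))
          (subspace_sum (contracted_space T) (unimodular_eigenspaces T))"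
          using assms(6)[OF l] by simp
        then obtain v w where vw: "x = v + w"
          "v \<in> subspace_sum (contracted_space (S l)) (unimodular_eigenspaces (S l))"
          "w \<in> subspace_sum (contracted_space T) (unimodular_eigenspaces T)"
          by (auto simp: subspace_sum_def[of "subspace_sum _ _"])
        then have "v \<in> bounded_orbits (real_matrix (S l))" "w \<in> V"
          using subspace_sum_bounded_orbits unfolding V_def by blast+
        then show ?thesis using Vb[of w] vw(1) by blast
      qed
      show "Y \<in> borel_measurable (uniform_measure lborel {0..<1})"
        using measurable_Y by (simp add: measurable_def)
    qed (use assms(4,5) l prob_space_uniform_unit in auto)
    have "AE x in \<mu>. \<forall>l\<in>K. to_torus (\<xi> x) \<in> Eq (S l)"
      by (rule AE_ball_countable') (use AE_Eq_S assms(3) in auto)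
    then have AE_E: "AE x in \<mu>. x \<in> A \<longrightarrow> to_torus (\<xi> x) \<in> E"
      by eventually_elim (use ND in \<open>auto simp: E_def\<close>)
    obtain C where C: "C > 0" "\<And>x r. 0 < r \<Longrightarrow> r \<le> 1 \<Longrightarrow>
      emeasure \<mu> ((\<lambda>w. to_torus (\<xi> w)) -` cball x r \<inter> A) \<le> ennreal (C * r powr (\<sigma> + card I))"
      using emeasure_ball_le[OF \<sigma>0 \<sigma>] by blast
    show ?thesis
    proof (rule hausdorff_measure_mass_distribution[OF \<mu>.finite_measure_axioms A AE_E _ s0 t(1) s(1) C(1)])
      show "(\<lambda>w. to_torus (\<xi> w)) -` cball x r \<inter> A \<in> sets \<mu>" for x r
      proof -
        have "(\<lambda>w. to_torus (\<xi> w)) \<in> borel_measurable \<mu>" by measurable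
        then have "(\<lambda>w. to_torus (\<xi> w)) -` cball x r \<inter> space \<mu> \<in> sets \<mu>"
          by (rule measurable_sets) simp
        then have "((\<lambda>w. to_torus (\<xi> w)) -` cball x r \<inter> space \<mu>) \<inter> A \<in> sets \<mu>"
          using A(1) by (rule sets.Int)
        moreover have "space \<mu> \<inter> A = A" using sets.sets_into_space[OF A(1)] by blast
        ultimately show ?thesis by (simp only: Int_assoc)
      qed
      show "emeasure \<mu> ((\<lambda>w. to_torus (\<xi> w)) -` cball x r \<inter> A) \<le> ennreal (C * r powr s)"
        if "0 < r" "r \<le> 1" for x r
        using C(2)[OF that] by (simp add: \<sigma>_def)
    qed simp
  qed
  then have "ennreal (real CARD('n)) \<le> hausdorff_dim E" by (rule hausdorff_dim_geI)
  then have "of_nat CARD('n) \<le> hausdorff_dim E" by (simp add: ennreal_of_nat_eq_real_of_nat)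
  then show ?thesis
    using hausdorff_dim_torus_le[of E] unfolding E_def by (rule antisym[rotated])
qed

end
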